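(* Let $V$ satisfy assumptions (A1)--(A2) (stated in the context). Let $\varepsilon>0$ and $\Omega_{\ge\varepsilon}:=\{x\in\overline\Omega: d(x,\{T=+\infty\})\ge\varepsilon\}$. Then there exists a constant $C=C(\Omega,V,\varepsilon)>0$ such that for every $x_0\in\Omega_{\ge\varepsilon}$ with $V(x_0)\ne0$, writing $x(\cdot):=x(\cdot;x_0)$, $$\sup_{t\in\mathbb R}\Big|J_{\Phi(t)}(x_0)w_0+t\,\big(w_0\cdot\nabla\ln T(x_0)\big)\,V(x(t))\Big|\le C|w_0|,\qquad w_0\in\mathbb R^2.$$ In particular, there is a constant $C=C(\Omega,V,\varepsilon)>0$ such that for every such $x_0$ and each $t\in\mathbb R$, $$C^{-1}(1+|t|)^{-1}|w_0|\le|J_{\Phi(t)}(x_0)w_0|\le C(1+|t|)|w_0|,\qquad w_0\in\mathbb R^2.$$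
   Context: $\Omega\subset\mathbb R^2$ is a bounded Lipschitz domain (open, connected) and $V\in C^1(\overline\Omega;\mathbb R^2)$ (meaning $V$ is $C^1$ on some open set containing $\overline\Omega$) is a time-independent vector field with $\operatorname{div}V=0$ in $\Omega$ and $V\cdot\vec n=0$ on $\partial\Omega$ ($\vec n$ the outward unit normal). Assumptions: (A1) There is $H\in C^2(\mathbb R^2)$ with $V=(\partial_2H,-\partial_1H)^\top$ in $\overline\Omega$ and $H=0$ on $\partial\Omega$. (A2) $H$ has finitely many critical points $x_1^*,\dots,x_K^*$ on $\overline\Omega$, and for each $k$ there are a real number $m_k\ge1$ and a symmetric nonsingular $S_k\in\mathbb R^{2\times2}$ such that $H(x_k^*+y)-H(x_k^* )=\frac12|y|^{m_k-1}y^\top S_ky+R_k(y)$ for $y$ near $0$, where $R_k\in C^2(\mathbb R^2)$ and $\|D^jR_k(y)\|=o(|y|^{m_k+1-j})$ as $y\to0$, $j=0,1,2$. Flow: for $x_0\in\overline\Omega$, $x(\cdot;x_0)$ solves $x'(t)=V(x(t))$, $t\in\mathbb R$, $x(0)=x_0$, and $\Phi(t)(x_0):=x(t;x_0)$ (a $C^1$ map); $J_{\Phi(t)}(x_0)$ is its Jacobian matrix with respect to $x_0$. Orbit period: $T(x_0):=\inf\{\hat t>0: x(\hat t;x_0)=x_0\}\in[0,+\infty]$ for $x_0\in\overline\Omega$, with $T(x_0)=+\infty$ if the set is empty. $T$ is $C^1$ on the set $\{0<T<+\infty\}$. $d(\cdot,\cdot)$ is the Euclidean distance (between points and/or sets),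 equal to $+\infty$ by convention if one of the sets is empty. $C(\ldots)$ denotes a constant depending only on the listed parameters. *)

theory Defs
  imports "HOL-Analysis.Analysis" "HOL-Library.Landau_Symbols"
begin

section \<open>Differential calculus\<close>

text \<open>Like \<^const>\<open>jacobian\<close>, the gradient takes a filter, so that it also makes sense at boundary
  points, with the filter \<open>at x within closure \<Omega>\<close>. For a Lipschitz domain \<open>\<Omega>\<close> that derivative
  is unique at every point of \<open>closure \<Omega>\<close>.\<close>

definition gradient :: "(real^'n \<Rightarrow> real) \<Rightarrow> (real^'n) filter \<Rightarrow> real^'n" where
  "gradient f F = (\<chi> i. frechet_derivative f F (axis i 1))"

definition C1_on :: "'a::real_normed_vector set \<Rightarrow> ('a \<Rightarrow> 'b::real_normed_vector) \<Rightarrow> bool" where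
  "C1_on U f \<longleftrightarrow>
     (\<exists>f' :: 'a \<Rightarrow> 'a \<Rightarrow>\<^sub>L 'b.
        (\<forall>x\<in>U. (f has_derivative blinfun_apply (f' x)) (at x)) \<and> continuous_on U f')"

definition C2_on :: "(real^'n) set \<Rightarrow> (real^'n \<Rightarrow> real) \<Rightarrow> bool" where
  "C2_on U f \<longleftrightarrow> C1_on U f \<and> C1_on U (\<lambda>x. gradient f (at x))"

definition divergence :: "(real^'n \<Rightarrow> real^'n) \<Rightarrow> real^'n \<Rightarrow> real" where
  "divergence V x = trace (jacobian V (at x))"


section \<open>Planar Lipschitz domains\<close>

text \<open>Near \<open>p\<close>, in the orthonormal frame \<open>(e1, e2)\<close> centred at \<open>p\<close>, the set \<open>\<Omega>\<close> is the part of the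
  ball lying strictly above the graph of the Lipschitz function \<open>\<gamma>\<close>.\<close>

definition lipschitz_chart ::
    "(real^2) set \<Rightarrow> real^2 \<Rightarrow> real^2 \<Rightarrow> real^2 \<Rightarrow> real \<Rightarrow> (real \<Rightarrow> real) \<Rightarrow> bool" where
  "lipschitz_chart \<Omega> p e1 e2 r \<gamma> \<longleftrightarrow>
     norm e1 = 1 \<and> norm e2 = 1 \<and> e1 \<bullet> e2 = 0 \<and> r > 0 \<and> (\<exists>L. L-lipschitz_on UNIV \<gamma>) \<and>
     \<Omega> \<inter> ball p r = {x \<in> ball p r. (x - p) \<bullet> e2 > \<gamma> ((x - p) \<bullet> e1)}"

definition bounded_lipschitz_domain :: "(real^2) set \<Rightarrow> bool" where
  "bounded_lipschitz_domain \<Omega> \<longleftrightarrow>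
     \<Omega> \<noteq> {} \<and> open \<Omega> \<and> connected \<Omega> \<and> bounded \<Omega> \<and>
     (\<forall>p\<in>frontier \<Omega>. \<exists>e1 e2 r \<gamma>. lipschitz_chart \<Omega> p e1 e2 r \<gamma>)"

text \<open>The outward unit normal exists at those boundary points where the boundary graph is
  differentiable, hence at almost every boundary point (Rademacher).\<close>

definition outward_unit_normal :: "(real^2) set \<Rightarrow> real^2 \<Rightarrow> real^2 \<Rightarrow> bool" where
  "outward_unit_normal \<Omega> p n \<longleftrightarrow>
     (\<exists>e1 e2 r \<gamma> s. lipschitz_chart \<Omega> p e1 e2 r \<gamma> \<and> (\<gamma> has_real_derivative s) (at 0) \<and>
        n = (1 / sqrt (1 + s\<^sup>2)) *\<^sub>R (s *\<^sub>R e1 - e2))"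


section \<open>The vector field and its stream function\<close>

definition steady_field :: "(real^2) set \<Rightarrow> (real^2 \<Rightarrow> real^2) \<Rightarrow> bool" where
  "steady_field \<Omega> V \<longleftrightarrow>
     (\<exists>U. open U \<and> closure \<Omega> \<subseteq> U \<and> C1_on U V) \<and>
     (\<forall>x\<in>\<Omega>. divergence V x = 0) \<and>
     (\<forall>p\<in>frontier \<Omega>. \<forall>n. outward_unit_normal \<Omega> p n \<longrightarrow> V p \<bullet> n = 0)"

definition assumption_A1 ::
    "(real^2) set \<Rightarrow> (real^2 \<Rightarrow> real^2) \<Rightarrow> (real^2 \<Rightarrow> real) \<Rightarrow> bool" where
  "assumption_A1 \<Omega> V H \<longleftrightarrow>
     C2_on UNIV H \<and>
     (\<forall>x\<in>closure \<Omega>. V x = vector [gradient H (at x) $ 2, - (gradient H (at x) $ 1)]) \<and>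
     (\<forall>x\<in>frontier \<Omega>. H x = 0)"

definition critical_points :: "(real^2) set \<Rightarrow> (real^2 \<Rightarrow> real) \<Rightarrow> (real^2) set" where
  "critical_points \<Omega> H = {x \<in> closure \<Omega>. gradient H (at x) = 0}"

text \<open>Where \<open>norm y = 0\<close> and the exponent is \<open>0\<close>, \<open>norm y powr 0\<close> is \<open>0\<close> rather than \<open>1\<close>. This is
  harmless: the quadratic form vanishes there, and the \<open>o\<close>-conditions refer to \<open>y \<noteq> 0\<close>.\<close>

definition assumption_A2 :: "(real^2) set \<Rightarrow> (real^2 \<Rightarrow> real) \<Rightarrow> bool" where
  "assumption_A2 \<Omega> H \<longleftrightarrow>
     finite (critical_points \<Omega> H) \<and>
     (\<forall>p\<in>critical_points \<Omega> H. \<exists>(m::real) (S::real^2^2) (R::real^2 \<Rightarrow> real).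
        m \<ge> 1 \<and> transpose S = S \<and> invertible S \<and> C2_on UNIV R \<and>
        (\<forall>\<^sub>F y in nhds 0.
           H (p + y) - H p = 1/2 * norm y powr (m - 1) * (y \<bullet> (S *v y)) + R y) \<and>
        R \<in> o[at 0](\<lambda>y. norm y powr (m + 1)) \<and>
        (\<lambda>y. norm (gradient R (at y))) \<in> o[at 0](\<lambda>y. norm y powr m) \<and>
        (\<lambda>y. norm (jacobian (\<lambda>z. gradient R (at z)) (at y))) \<in> o[at 0](\<lambda>y. norm y powr (m - 1)))"


section \<open>Flow and orbit period\<close>

text \<open>\<open>V\<close> only matters on \<open>closure \<Omega>\<close>, so trajectories are required to stay there.\<close>

definition trajectory ::
    "(real^2) set \<Rightarrow> (real^2 \<Rightarrow> real^2) \<Rightarrow> real^2 \<Rightarrow> (real \<Rightarrow> real^2) \<Rightarrow> bool" where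
  "trajectory \<Omega> V x0 x \<longleftrightarrow>
     x 0 = x0 \<and> (\<forall>t. x t \<in> closure \<Omega> \<and> (x has_vector_derivative V (x t)) (at t))"

definition flow :: "(real^2) set \<Rightarrow> (real^2 \<Rightarrow> real^2) \<Rightarrow> real \<Rightarrow> real^2 \<Rightarrow> real^2" where
  "flow \<Omega> V t x0 = (THE x. trajectory \<Omega> V x0 x) t"

definition flow_jacobian :: "(real^2) set \<Rightarrow> (real^2 \<Rightarrow> real^2) \<Rightarrow> real \<Rightarrow> real^2 \<Rightarrow> real^2^2" where
  "flow_jacobian \<Omega> V t x0 = jacobian (flow \<Omega> V t) (at x0 within closure \<Omega>)"

text \<open>In \<^typ>\<open>ereal\<close> the infimum of the empty set is \<open>\<infinity>\<close>, here and in \<open>set_distance\<close>.\<close>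

definition period :: "(real^2) set \<Rightarrow> (real^2 \<Rightarrow> real^2) \<Rightarrow> real^2 \<Rightarrow> ereal" where
  "period \<Omega> V x0 = Inf {ereal t | t. t > 0 \<and> flow \<Omega> V t x0 = x0}"

definition set_distance :: "real^2 \<Rightarrow> (real^2) set \<Rightarrow> ereal" where
  "set_distance x A = (INF y\<in>A. ereal (dist x y))"

definition aperiodic_set :: "(real^2) set \<Rightarrow> (real^2 \<Rightarrow> real^2) \<Rightarrow> (real^2) set" where
  "aperiodic_set \<Omega> V = {x \<in> closure \<Omega>. period \<Omega> V x = \<infinity>}"

definition Omega_ge :: "(real^2) set \<Rightarrow> (real^2 \<Rightarrow> real^2) \<Rightarrow> real \<Rightarrow> (real^2) set" where
  "Omega_ge \<Omega> V \<epsilon> = {x \<in> closure \<Omega>. set_distance x (aperiodic_set \<Omega> V) \<ge> ereal \<epsilon>}"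

definition grad_ln_period :: "(real^2) set \<Rightarrow> (real^2 \<Rightarrow> real^2) \<Rightarrow> real^2 \<Rightarrow> real^2" where
  "grad_ln_period \<Omega> V x0 =
     gradient (\<lambda>x. ln (real_of_ereal (period \<Omega> V x))) (at x0 within closure \<Omega>)"

end

theory Submission
  imports Defs
begin

text \<open>Let \<open>T\<close> be the period of a closed orbit. Differentiating \<open>\<Phi>(T(x), x) = x\<close> gives
  \<open>J(T) w = w - (w \<bullet> \<nabla>T) V\<close>. As the flow derivative maps \<open>V(x)\<close> to \<open>V(x(t))\<close>, the
  expression \<open>J(t) w + t (w \<bullet> \<nabla> ln T) V(x(t))\<close> is then a \<open>T\<close>-periodic function of \<open>t\<close>, so it suffices
  to bound \<open>J\<close> over a single period, which by Gronwall's inequality follows from a bound on the integral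
  of \<open>|DV|\<close> over one period.

  That integral is locally bounded on \<open>\<Omega>\<^sub>\<ge>\<^sub>\<epsilon>\<close>, which suffices by compactness. Near a regular point, \<open>T\<close>
  is locally bounded since the first integral \<open>H\<close> makes nearby orbits close up. Near a critical point
  \<open>p\<close>, an orbit in the level set of \<open>p\<close> cannot be closed, because at its point closest to \<open>p\<close> it would have
  to be orthogonal to the radial direction, which the expansion of \<open>H\<close> excludes. So if \<open>p\<close> is far from
  all aperiodic points, then \<open>p\<close> is interior and a strict local extremum of \<open>H\<close>; with \<open>s\<close> the initial
  distance to \<open>p\<close>, the orbits nearby stay at distance comparable to \<open>s\<close>, turn around \<open>p\<close> with angular
  speed at least of order \<open>s\<^sup>m\<^sup>-\<^sup>1\<close>, and \<open>|DV|\<close> is at most of order \<open>s\<^sup>m\<^sup>-\<^sup>1\<close> along them.\<close>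

section \<open>Ordinary differential equations\<close>

text \<open>Near a center with \<open>m > 1\<close> the period may be unbounded, so a Gronwall
  exponent made from the period and a global bound on the derivative of the field is useless there.
  What stays bounded is the product of the period with the supremum of that derivative along the
  same orbit: the two are bounded by powers of the distance to the center with opposite exponents.
  Centers cannot be kept away by compactness, since an equilibrium returns to itself at every time,
  has period 0 and may therefore belong to \<open>Omega_ge\<close>.

  The boundary is the other obstacle. Derivatives are taken within \<open>closure \<Omega>\<close>,
  where \<open>frechet_derivative\<close> is a mere choice until uniqueness has been derived from
  the cones that a Lipschitz chart provides.

  The lower estimate comes from the upper one: the flow derivative at time \<open>t\<close> is
  inverted by the one at time \<open>- t\<close> from the point reached, which lies on the same
  orbit. Its linear growth rate is uniform because a closed orbit that is not an equilibrium needs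
  at least the time \<open>1 / L\<close>.\<close>

lemma antiderivative_on_reals:
  fixes g :: "real \<Rightarrow> 'a::banach"
  assumes "continuous_on UNIV g"
  obtains G where "G 0 = 0" "\<And>t. (G has_vector_derivative g t) (at t)"
proof -
  \<comment> \<open>At most one of the two intervals is nondegenerate, so this is the oriented
    integral from 0 to \<open>t\<close>.\<close>
  define G where "G t = integral {0..t} g - integral {t..0} g" for t
  have int: "g integrable_on {a..b}" for a b
    using assms continuous_on_subset integrable_continuous_real by blast
  have "(G has_vector_derivative g t) (at t)" for t
  proof -
    \<comment> \<open>With a base point to the left of both 0 and \<open>t\<close>, \<open>G\<close>
      differs by a constant from a single integral with variable upper end, so the fundamental
      theorem also applies across 0.\<close>
    define a where "a = - \<bar>t\<bar> - 1"
    define b where "b = \<bar>t\<bar> + 1"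
    have t: "t \<in> {a<..<b}" "a < 0" "0 < b" by (auto simp: a_def b_def)
    have eq: "G s = integral {a..s} g - integral {a..0} g" if "s \<in> {a<..<b}" for s
    proof (cases "s \<ge> 0")
      case True
      have "integral {a..0} g + integral {0..s} g = integral {a..s} g"
        using True t int by (intro Henstock_Kurzweil_Integration.integral_combine) auto
      moreover have "integral {s..0} g = 0"
        using True by (cases "s = 0") auto
      ultimately show ?thesis unfolding G_def by (simp add: algebra_simps)
    next
      case False
      have "integral {a..s} g + integral {s..0} g = integral {a..0} g"
        using False that int by (intro Henstock_Kurzweil_Integration.integral_combine) auto
      then show ?thesis using False unfolding G_def by (simp add: algebra_simps)
    qed
    have "((\<lambda>s. integral {a..s} g) has_vector_derivative g t) (at t within {a..b})"
      using t assms by (intro integral_has_vector_derivative continuous_on_subset[OF assms]) auto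
    then have "((\<lambda>s. integral {a..s} g - integral {a..0} g) has_vector_derivative g t)
        (at t within {a..b})"
      by (auto intro!: derivative_eq_intros)
    then have "((\<lambda>s. integral {a..s} g - integral {a..0} g) has_vector_derivative g t) (at t)"
      using t(1) at_within_Icc_at by fastforce
    then show ?thesis
      by (rule has_vector_derivative_transform_within_open[where S="{a<..<b}"]) (use t eq in auto)
  qed
  moreover have "G 0 = 0" by (simp add: G_def)
  ultimately show ?thesis using that by blast
qed

lemma has_vector_derivative_reflect:
  fixes u :: "real \<Rightarrow> 'a::real_normed_vector"
  assumes "\<And>t. (u has_vector_derivative u' t) (at t)"
  shows "((\<lambda>s. u (- s)) has_vector_derivative - u' (- t)) (at t)"
proof -
  have "(uminus has_vector_derivative -1) (at t)"
    by (auto intro!: derivative_eq_intros)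
  from vector_diff_chain_at[OF this, of u "u' (- t)"] assms[of "- t"]
  show ?thesis by (simp add: o_def)
qed

text \<open>The norm of \<open>u\<close> need not be differentiable. An antiderivative of
  \<open>M * norm (u t) + b\<close> gives a differentiable majorant, and the comparison is carried
  out for that majorant.\<close>

lemma gronwall_forward:
  fixes u :: "real \<Rightarrow> 'a::real_normed_vector"
  assumes "T \<ge> 0" "b \<ge> 0"
    and d: "\<And>t. (u has_vector_derivative u' t) (at t)"
    and le: "\<And>t. 0 \<le> t \<Longrightarrow> t \<le> T \<Longrightarrow> norm (u' t) \<le> M * norm (u t) + b"
    and M: "M \<ge> 0"
  shows "norm (u T) \<le> (norm (u 0) + b * T) * exp (M * T)"
proof -
  have cu: "continuous_on UNIV u"
    using d by (meson continuous_at_imp_continuous_on has_vector_derivative_continuous)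
  define k where "k t = M * norm (u t) + b" for t
  have "continuous_on UNIV k"
    unfolding k_def by (intro continuous_intros cu)
  then obtain G where G0: "G 0 = 0" and G: "\<And>t. (G has_vector_derivative k t) (at t)"
    using antiderivative_on_reals by blast
  have cG: "continuous_on A G" for A
    using G by (meson continuous_at_imp_continuous_on has_vector_derivative_continuous)
  have bound: "norm (u t) \<le> norm (u 0) + G t" if "0 \<le> t" "t \<le> T" for t
  proof (cases "t = 0")
    case False
    have "norm (u t - u 0) \<le> G t - G 0"
    proof (rule differentiable_bound_general)
      show "0 < t" using that False by auto
      show "continuous_on {0..t} u" using cu continuous_on_subset by blast
      show "continuous_on {0..t} G" by (rule cG)
      show "norm (u' x) \<le> k x" if "0 < x" "x < t" for x
        using le[of x] that \<open>t \<le> T\<close> by (auto simp: k_def)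
    qed (use d G in auto)
    then show ?thesis using G0 norm_triangle_ineq2[of "u t" "u 0"] by linarith
  qed (use G0 in auto)
  \<comment> \<open>Integrating factor. Subtracting \<open>b * t\<close> suffices because
    \<open>exp (- M * t) \<le> 1\<close> for \<open>t \<ge> 0\<close>.\<close>
  define e where "e t = (norm (u 0) + G t) * exp (- M * t) - b * t" for t
  have "e T \<le> e 0"
  proof (rule DERIV_nonpos_imp_nonincreasing[OF \<open>T \<ge> 0\<close>])
    fix t assume t: "0 \<le> t" "t \<le> T"
    have G': "(G has_real_derivative k t) (at t)"
      using G by (simp add: has_real_derivative_iff_has_vector_derivative)
    have "(e has_real_derivative
        k t * exp (- M * t) + (norm (u 0) + G t) * (exp (- M * t) * (- M)) - b) (at t)"
      unfolding e_def by (rule derivative_eq_intros G' refl | simp)+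
    moreover have "k t * exp (- M * t) + (norm (u 0) + G t) * (exp (- M * t) * (- M)) - b \<le> 0"
    proof -
      have "k t \<le> M * (norm (u 0) + G t) + b"
        unfolding k_def using bound[OF t] M by (intro add_right_mono mult_left_mono)
      then have "(k t - M * (norm (u 0) + G t)) * exp (- M * t) \<le> b * 1"
        using M t \<open>b \<ge> 0\<close> by (intro mult_mono) auto
      then show ?thesis by (simp add: algebra_simps)
    qed
    ultimately show "\<exists>y. (e has_real_derivative y) (at t) \<and> y \<le> 0" by blast
  qed
  then have "(norm (u 0) + G T) * exp (- M * T) \<le> norm (u 0) + b * T"
    using G0 by (simp add: e_def)
  then have "norm (u 0) + G T \<le> (norm (u 0) + b * T) * exp (M * T)"
    by (simp add: exp_minus field_simps)
  then show ?thesis using bound[of T] \<open>T \<ge> 0\<close> by linarith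
qed

text \<open>Negative times are reflected to positive ones. The differential inequality is asked for
  only when \<open>\<bar>s\<bar> \<le> \<bar>t\<bar>\<close>, because the later perturbation
  estimates hold only on such a window.\<close>

lemma gronwall:
  fixes u :: "real \<Rightarrow> 'a::real_normed_vector"
  assumes d: "\<And>t. (u has_vector_derivative u' t) (at t)"
    and le: "\<And>s. \<bar>s\<bar> \<le> \<bar>t\<bar> \<Longrightarrow> norm (u' s) \<le> M * norm (u s) + b"
    and "M \<ge> 0" "b \<ge> 0"
  shows "norm (u t) \<le> (norm (u 0) + b * \<bar>t\<bar>) * exp (M * \<bar>t\<bar>)"
proof (cases "t \<ge> 0")
  case True
  have "norm (u t) \<le> (norm (u 0) + b * t) * exp (M * t)"
    using True assms by (intro gronwall_forward[where u'=u']) auto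
  then show ?thesis using True by simp
next
  case False
  have "norm ((\<lambda>s. u (- s)) (- t)) \<le> (norm (u (- 0)) + b * (- t)) * exp (M * (- t))"
    using False assms(3,4) le by (intro gronwall_forward[where u'="\<lambda>s. - u' (- s)"]
        has_vector_derivative_reflect d) auto
  then show ?thesis using False by simp
qed

text \<open>The Picard operator is a contraction for the sup norm weighted by \<open>exp (- K * \<bar>t\<bar>)\<close>, so one
  application of Banach's theorem gives a solution on the whole line.\<close>

lemma ode_existence:
  fixes f :: "real \<Rightarrow> 'a::banach \<Rightarrow> 'a"
  assumes cont: "\<And>x. continuous_on UNIV x \<Longrightarrow> continuous_on UNIV (\<lambda>t. f t (x t))"
    and lip: "\<And>t x y. norm (f t x - f t y) \<le> L * norm (x - y)"
    and bdd: "\<And>t. norm (f t x0) \<le> B"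
  obtains x where "x 0 = x0" "\<And>t. (x has_vector_derivative f t (x t)) (at t)"
proof -
  \<comment> \<open>Chosen larger than \<open>\<bar>L\<bar>\<close>: the contraction factor of the
    weighted Picard operator is \<open>\<bar>L\<bar> / K\<close>.\<close>
  define K where "K = \<bar>L\<bar> + 1"
  have K: "K > 0" "\<bar>L\<bar> / K < 1" "\<bar>L\<bar> / K \<ge> 0" by (auto simp: K_def)
  have B: "B \<ge> 0" using bdd[of 0] norm_ge_zero order_trans by blast
  have lip': "norm (f t x - f t y) \<le> \<bar>L\<bar> * norm (x - y)" for t x y
    using lip[of t x y] by (smt (verit) mult_right_mono norm_ge_zero)
  \<comment> \<open>The unknown is the bounded function \<open>z\<close>, and \<open>X z\<close> is
    the path that it encodes. The fixed point is thus sought in the complete space of bounded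
    continuous functions on the whole line.\<close>
  define X where "X z t = x0 + exp (K * \<bar>t\<bar>) *\<^sub>R apply_bcontfun z t" for z :: "real \<Rightarrow>\<^sub>C 'a" and t
  have cX: "continuous_on UNIV (X z)" for z
    unfolding X_def by (intro continuous_intros) auto
  have "\<exists>G. G 0 = 0 \<and> (\<forall>t. (G has_vector_derivative f t (X z t)) (at t))" for z
    using antiderivative_on_reals[OF cont[OF cX[of z]]] by metis
  then obtain P where P0: "\<And>z. P z 0 = 0"
    and P: "\<And>z t. (P z has_vector_derivative f t (X z t)) (at t)" by metis
  have growth: "norm (g t) \<le> b * \<bar>t\<bar> + c / K * exp (K * \<bar>t\<bar>)"
    if "g 0 = 0" "\<And>s. (g has_vector_derivative g' s) (at s)"
      "\<And>s. norm (g' s) \<le> b + c * exp (K * \<bar>s\<bar>)" "c \<ge> 0" for g :: "real \<Rightarrow> 'a" and g' b c t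
  proof -
    have half: "norm (g t) \<le> b * t + c / K * exp (K * t)"
      if g: "g 0 = 0" "\<And>s. (g has_vector_derivative g' s) (at s)"
        "\<And>s. norm (g' s) \<le> b + c * exp (K * \<bar>s\<bar>)" and "t > 0" for g :: "real \<Rightarrow> 'a" and g' t
    proof -
      define p where "p s = b * s + c / K * exp (K * s)" for s
      have p: "(p has_vector_derivative b + c * exp (K * s)) (at s)" for s
        unfolding p_def has_real_derivative_iff_has_vector_derivative[symmetric]
        using K by (auto intro!: derivative_eq_intros)
      have "norm (g t - g 0) \<le> p t - p 0"
      proof (rule differentiable_bound_general[where f'=g' and \<phi>'="\<lambda>s. b + c * exp (K * s)"])
        show "continuous_on {0..t} g" "continuous_on {0..t} p"
          using g p by (meson continuous_at_imp_continuous_on has_vector_derivative_continuous)+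
        show "norm (g' x) \<le> b + c * exp (K * x)" if "0 < x" for x
          using g(3)[of x] that by simp
      qed (use g p that in auto)
      then show ?thesis using g K \<open>c \<ge> 0\<close> by (simp add: p_def) (smt (verit) divide_nonneg_pos)
    qed
    consider "t = 0" | "t > 0" | "t < 0" by linarith
    then show ?thesis
    proof cases
      case 3
      have "norm ((\<lambda>s. g (- s)) (- t)) \<le> b * (- t) + c / K * exp (K * (- t))"
      proof (rule half)
        show "norm (- g' (- s)) \<le> b + c * exp (K * \<bar>s\<bar>)" for s
          using that(3)[of "- s"] by simp
      qed (use 3 that in \<open>auto intro: has_vector_derivative_reflect\<close>)
      then show ?thesis using 3 by simp
    qed (use that half[of g g' t] K in auto)
  qed
  \<comment> \<open>The linear term stems from \<open>f t x0\<close>, which is bounded but carries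
    no weight; it is absorbed by \<open>u * exp (- u) \<le> 1\<close>.\<close>
  have weight: "exp (- (K * \<bar>t\<bar>)) * (b * \<bar>t\<bar> + c / K * exp (K * \<bar>t\<bar>)) \<le> b / K + c / K"
    if "b \<ge> 0" for b c t
  proof -
    have "K * \<bar>t\<bar> \<le> exp (K * \<bar>t\<bar>)" using exp_ge_add_one_self[of "K * \<bar>t\<bar>"] by linarith
    then have "exp (- (K * \<bar>t\<bar>)) * \<bar>t\<bar> \<le> 1 / K"
      using K by (simp add: exp_minus field_simps)
    then have "b * (exp (- (K * \<bar>t\<bar>)) * \<bar>t\<bar>) \<le> b * (1 / K)"
      using that mult_left_mono by blast
    then show ?thesis by (simp add: exp_minus field_simps)
  qed
  define Q where "Q z t = exp (- (K * \<bar>t\<bar>)) *\<^sub>R P z t" for z t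
  have cP: "continuous_on UNIV (P z)" for z
    using P by (meson continuous_at_imp_continuous_on has_vector_derivative_continuous)
  have Q: "Q z \<in> bcontfun" for z
  proof (rule bcontfun_normI)
    show "continuous_on UNIV (Q z)" unfolding Q_def by (intro continuous_intros cP)
    fix t
    have "norm (f s (X z s)) \<le> B + (\<bar>L\<bar> * norm z) * exp (K * \<bar>s\<bar>)" for s
    proof -
      have "norm (f s (X z s)) \<le> norm (f s x0) + norm (f s (X z s) - f s x0)"
        by (metis add.commute norm_diff_triangle_ineq diff_add_cancel norm_triangle_ineq)
      also have "\<dots> \<le> B + \<bar>L\<bar> * norm (X z s - x0)" using bdd lip' add_mono by blast
      also have "B + \<bar>L\<bar> * norm (X z s - x0) \<le> B + \<bar>L\<bar> * (exp (K * \<bar>s\<bar>) * norm z)"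
        by (intro add_left_mono mult_left_mono) (auto simp: X_def norm_bounded)
      finally show ?thesis by (simp add: mult_ac)
    qed
    then have "norm (P z t) \<le> B * \<bar>t\<bar> + (\<bar>L\<bar> * norm z) / K * exp (K * \<bar>t\<bar>)"
      using P0 P by (intro growth) auto
    then have "norm (Q z t) \<le> exp (- (K * \<bar>t\<bar>)) * (B * \<bar>t\<bar> + (\<bar>L\<bar> * norm z) / K * exp (K * \<bar>t\<bar>))"
      by (simp add: Q_def)
    also have "\<dots> \<le> B / K + \<bar>L\<bar> * norm z / K" using weight B by blast
    finally show "norm (Q z t) \<le> B / K + \<bar>L\<bar> * norm z / K" .
  qed
  have contr: "dist (Bcontfun (Q z)) (Bcontfun (Q w)) \<le> \<bar>L\<bar> / K * dist z w" for z w
  proof (rule dist_bound)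
    fix t
    have "norm (f s (X z s) - f s (X w s)) \<le> 0 + (\<bar>L\<bar> * dist z w) * exp (K * \<bar>s\<bar>)" for s
    proof -
      have "norm (f s (X z s) - f s (X w s)) \<le> \<bar>L\<bar> * norm (X z s - X w s)" by (rule lip')
      also have "norm (X z s - X w s) = exp (K * \<bar>s\<bar>) * dist (apply_bcontfun z s) (apply_bcontfun w s)"
        by (simp add: X_def dist_norm flip: scaleR_diff_right)
      also have "\<bar>L\<bar> * \<dots> \<le> \<bar>L\<bar> * (exp (K * \<bar>s\<bar>) * dist z w)"
        by (intro mult_left_mono) (auto simp: dist_bounded)
      finally show ?thesis by (simp add: mult_ac)
    qed
    then have "norm (P z t - P w t) \<le> 0 * \<bar>t\<bar> + (\<bar>L\<bar> * dist z w) / K * exp (K * \<bar>t\<bar>)"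
      using P0 P by (intro growth[where g="\<lambda>t. P z t - P w t"]) (auto intro: has_vector_derivative_diff)
    then have "exp (- (K * \<bar>t\<bar>)) * norm (P z t - P w t) \<le> exp (- (K * \<bar>t\<bar>)) *
        (0 * \<bar>t\<bar> + (\<bar>L\<bar> * dist z w) / K * exp (K * \<bar>t\<bar>))"
      by (intro mult_left_mono) auto
    also have "\<dots> \<le> 0 / K + \<bar>L\<bar> * dist z w / K" using weight by blast
    finally show "dist (apply_bcontfun (Bcontfun (Q z)) t) (apply_bcontfun (Bcontfun (Q w)) t)
        \<le> \<bar>L\<bar> / K * dist z w"
      by (simp add: Bcontfun_inverse[OF Q] Q_def dist_norm flip: scaleR_diff_right)
  qed
  obtain z where z: "Bcontfun (Q z) = z"
    using banach_fix_type[of "\<bar>L\<bar> / K" "\<lambda>z. Bcontfun (Q z)"] contr K by metis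
  then have zt: "apply_bcontfun z t = exp (- (K * \<bar>t\<bar>)) *\<^sub>R P z t" for t
    by (metis Bcontfun_inverse Q Q_def)
  have Xz: "X z t = x0 + P z t" for t
    by (simp add: X_def zt flip: exp_add)
  have "(X z has_vector_derivative f t (X z t)) (at t)" for t
    unfolding Xz[abs_def] using P[of z t] by (auto intro!: derivative_eq_intros simp: Xz)
  moreover have "X z 0 = x0" using P0 by (simp add: Xz)
  ultimately show ?thesis using that by blast
qed

section \<open>The global flow of a Lipschitz field\<close>

locale lipschitz_field =
  fixes F :: "'a::euclidean_space \<Rightarrow> 'a" and L :: real
  assumes lip: "norm (F x - F y) \<le> L * norm (x - y)" and L_pos: "L > 0"
begin

lemma F_cont: "continuous_on A F"
proof -
  have "L-lipschitz_on A F"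
    using lip L_pos by (auto simp: lipschitz_on_def dist_norm)
  then show ?thesis by (rule lipschitz_on_continuous_on)
qed

text \<open>With \<open>SOME\<close>, existence alone characterises \<open>phi\<close>; uniqueness
  is supplied later by Gronwall.\<close>

definition phi :: "real \<Rightarrow> 'a \<Rightarrow> 'a" where
  "phi t x = (SOME y. y 0 = x \<and> (\<forall>t. (y has_vector_derivative F (y t)) (at t))) t"

lemma phi_spec: "phi 0 x = x \<and> (\<forall>t. ((\<lambda>t. phi t x) has_vector_derivative F (phi t x)) (at t))"
proof -
  have "\<exists>y. y 0 = x \<and> (\<forall>t. (y has_vector_derivative F (y t)) (at t))"
  proof (rule ode_existence[of "\<lambda>_. F" L x "norm (F x)"])
    show "continuous_on UNIV (\<lambda>t. F (y t))" if "continuous_on UNIV y" for y :: "real \<Rightarrow> 'a"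
      using that by (intro continuous_on_compose2[OF F_cont[of UNIV]]) auto
  qed (use lip in auto)
  from someI_ex[OF this] show ?thesis
    unfolding phi_def .
qed

lemma phi_0 [simp]: "phi 0 x = x"
  using phi_spec by blast

lemma phi_deriv: "((\<lambda>t. phi t x) has_vector_derivative F (phi t x)) (at t)"
  using phi_spec by blast

lemma phi_cont: "continuous_on A (\<lambda>t. phi t x)"
  using phi_deriv by (meson continuous_at_imp_continuous_on has_vector_derivative_continuous)

lemma solution_dist:
  assumes x: "\<And>t. (x has_vector_derivative F (x t)) (at t)"
    and y: "\<And>t. (y has_vector_derivative F (y t)) (at t)"
  shows "norm (x t - y t) \<le> norm (x 0 - y 0) * exp (L * \<bar>t\<bar>)"
proof -
  have "norm (x t - y t) \<le> (norm (x 0 - y 0) + 0 * \<bar>t\<bar>) * exp (L * \<bar>t\<bar>)"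
  proof (rule gronwall[where u = "\<lambda>t. x t - y t" and u' = "\<lambda>t. F (x t) - F (y t)"])
    show "((\<lambda>t. x t - y t) has_vector_derivative F (x t) - F (y t)) (at t)" for t
      by (intro has_vector_derivative_diff x y)
  qed (use lip L_pos in auto)
  then show ?thesis by simp
qed

lemma solution_unique:
  assumes "\<And>t. (x has_vector_derivative F (x t)) (at t)"
  shows "x t = phi t (x 0)"
  using solution_dist[OF assms phi_deriv[of "x 0"], of t] by simp

lemma phi_dist: "norm (phi t x - phi t y) \<le> norm (x - y) * exp (L * \<bar>t\<bar>)"
  using solution_dist[OF phi_deriv[of x] phi_deriv[of y], of t] by simp

lemma phi_add: "phi (s + t) x = phi s (phi t x)"
proof -
  have "((\<lambda>s. phi (s + t) x) has_vector_derivative F (phi (s + t) x)) (at s)" for s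
  proof -
    have "((\<lambda>s. s + t) has_vector_derivative 1) (at s)" by (auto intro!: derivative_eq_intros)
    from vector_diff_chain_at[OF this phi_deriv[of x "s + t"]]
    show ?thesis by (simp add: o_def)
  qed
  from solution_unique[OF this, of s] show ?thesis by simp
qed

lemma phi_neg [simp]: "phi (- t) (phi t x) = x" "phi t (phi (- t) x) = x"
  using phi_add[of "- t" t x] phi_add[of t "- t" x] by simp_all

lemma phi_equilibrium:
  assumes "F x = 0" shows "phi t x = x"
  using solution_unique[of "\<lambda>_. x" t] assms by (simp add: has_vector_derivative_const)

lemma phi_not_equilibrium:
  assumes "F x \<noteq> 0" shows "F (phi t x) \<noteq> 0"
  using assms phi_equilibrium[of "phi t x" "- t"] by auto

text \<open>Only the velocity at the starting point enters: elsewhere on the orbit the Lipschitz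
  bound controls the velocity by the displacement itself.\<close>

lemma phi_displacement: "norm (phi t y - y) \<le> norm (F y) * \<bar>t\<bar> * exp (L * \<bar>t\<bar>)"
proof -
  have "norm (phi t y - y) \<le> (norm (phi 0 y - y) + norm (F y) * \<bar>t\<bar>) * exp (L * \<bar>t\<bar>)"
  proof (rule gronwall[where u = "\<lambda>t. phi t y - y" and u' = "\<lambda>t. F (phi t y)"])
    show "((\<lambda>t. phi t y - y) has_vector_derivative F (phi t y)) (at t)" for t
      using phi_deriv by (auto intro!: derivative_eq_intros)
    fix s
    have "norm (F (phi s y)) \<le> norm (F (phi s y) - F y) + norm (F y)"
      by (metis diff_add_cancel norm_triangle_ineq)
    then show "norm (F (phi s y)) \<le> L * norm (phi s y - y) + norm (F y)"
      using lip[of "phi s y" y] by linarith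
  qed (use L_pos in auto)
  then show ?thesis by simp
qed

text \<open>The reference velocity is taken at a fixed \<open>z\<close> instead of \<open>y\<close>.
  Orbits from a whole neighbourhood are thus compared with motion in one direction, as is needed
  both for finding return times and for differentiating them.\<close>

lemma phi_linear_approx:
  "norm (phi t y - y - t *\<^sub>R F z)
     \<le> L * (norm (F y) * \<bar>t\<bar> * exp (L * \<bar>t\<bar>) + norm (y - z)) * \<bar>t\<bar>"
proof -
  let ?b = "L * (norm (F y) * \<bar>t\<bar> * exp (L * \<bar>t\<bar>) + norm (y - z))"
  have "norm (phi t y - y - t *\<^sub>R F z) \<le> (norm (phi 0 y - y - 0 *\<^sub>R F z) + ?b * \<bar>t\<bar>) * exp (0 * \<bar>t\<bar>)"
  proof (rule gronwall[where u = "\<lambda>t. phi t y - y - t *\<^sub>R F z" and u' = "\<lambda>t. F (phi t y) - F z"])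
    show "((\<lambda>t. phi t y - y - t *\<^sub>R F z) has_vector_derivative F (phi t y) - F z) (at t)" for t
      using phi_deriv by (auto intro!: derivative_eq_intros)
    fix s :: real assume s: "\<bar>s\<bar> \<le> \<bar>t\<bar>"
    have "norm (phi s y - y) \<le> norm (F y) * \<bar>s\<bar> * exp (L * \<bar>s\<bar>)" by (rule phi_displacement)
    also have "\<dots> \<le> norm (F y) * \<bar>t\<bar> * exp (L * \<bar>t\<bar>)"
      using s L_pos by (intro mult_mono) auto
    finally have "norm (phi s y - z) \<le> norm (F y) * \<bar>t\<bar> * exp (L * \<bar>t\<bar>) + norm (y - z)"
      using norm_triangle_ineq[of "phi s y - y" "y - z"] by simp
    then show "norm (F (phi s y) - F z) \<le> 0 * norm (phi s y - y - s *\<^sub>R F z) + ?b"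
      using lip[of "phi s y" z] L_pos by (smt (verit) mult_left_mono mult_zero_left)
  qed (use L_pos in auto)
  then show ?thesis by simp
qed

lemma phi_periodic_shift:
  assumes "phi T x = x"
  shows "phi (s + T) x = phi s x" "phi (s - T) x = phi s x" "phi T (phi s x) = phi s x"
proof -
  show 1: "phi (s + T) x = phi s x" for s using phi_add[of s T x] assms by simp
  from 1[of "s - T"] show "phi (s - T) x = phi s x" by simp
  show "phi T (phi s x) = phi s x"
    using 1[of s] phi_add[of T s x] by (simp add: add.commute)
qed

text \<open>At the fastest point of a closed orbit, Rolle's theorem gives a later time when the velocity is
  orthogonal to the initial one; the velocity has then changed by at least its maximal norm.\<close>

lemma return_time_ge:
  assumes "t > 0" "phi t x = x" "F x \<noteq> 0"
  shows "t \<ge> 1 / L"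
proof -
  have "continuous_on {0..t} (\<lambda>s. norm (F (phi s x)))"
    by (intro continuous_intros continuous_on_compose2[OF F_cont[of UNIV]] phi_cont) auto
  then obtain s0 where s0: "s0 \<in> {0..t}"
    and max: "\<And>s. s \<in> {0..t} \<Longrightarrow> norm (F (phi s x)) \<le> norm (F (phi s0 x))"
    using continuous_attains_sup[of "{0..t}" "\<lambda>s. norm (F (phi s x))"] \<open>t > 0\<close> by fastforce
  define y where "y = phi s0 x"
  define e where "e = F y"
  have "e \<noteq> 0" unfolding e_def y_def using assms phi_not_equilibrium by blast
  \<comment> \<open>Times beyond \<open>t\<close> are folded back by periodicity, so the speed at
    \<open>y\<close> is maximal over a full period that starts at \<open>y\<close>.\<close>
  have speed: "norm (F (phi s y)) \<le> norm e" if "s \<in> {0..t}" for s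
  proof -
    have eq: "phi s y = phi (s + s0) x" by (simp add: y_def phi_add)
    show ?thesis
    proof (cases "s + s0 \<le> t")
      case True then show ?thesis using max[of "s + s0"] that s0 eq by (simp add: e_def y_def)
    next
      case False
      have "phi s y = phi (s + s0 - t) x"
        using phi_periodic_shift(2)[OF assms(2)] eq by simp
      then show ?thesis using max[of "s + s0 - t"] that s0 False by (simp add: e_def y_def)
    qed
  qed
  have yt: "phi t y = y" unfolding y_def by (rule phi_periodic_shift(3)[OF assms(2)])
  define g where "g s = phi s y \<bullet> e" for s
  have g: "(g has_real_derivative F (phi s y) \<bullet> e) (at s)" for s
    unfolding g_def has_real_derivative_iff_has_vector_derivative
    using bounded_linear.has_vector_derivative[OF bounded_linear_inner_left phi_deriv] .
  obtain z where z: "0 < z" "z < t" "F (phi z y) \<bullet> e = 0"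
  proof -
    have "\<exists>z. 0 < z \<and> z < t \<and> (\<lambda>h. h * (F (phi z y) \<bullet> e)) = (\<lambda>_. 0)"
    proof (rule Rolle_deriv[where f = g and f' = "\<lambda>z h. h * (F (phi z y) \<bullet> e)"])
      show "g 0 = g t" using yt by (simp add: g_def)
      show "continuous_on {0..t} g"
        using g by (meson DERIV_isCont continuous_at_imp_continuous_on)
      show "(g has_derivative (\<lambda>h. h * (F (phi s y) \<bullet> e))) (at s)" for s
        using g[of s] by (simp add: has_field_derivative_def mult.commute[of _ "_ \<bullet> _"] mult_commute_abs)
    qed fact
    then show ?thesis using that by (metis mult_1)
  qed
  have "norm (phi z y - y) \<le> norm e * z"
  proof -
    have "norm (phi z y - phi 0 y) \<le> (\<lambda>s. norm e * s) z - (\<lambda>s. norm e * s) 0"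
    proof (rule differentiable_bound_general[where f' = "\<lambda>s. F (phi s y)" and \<phi>' = "\<lambda>_. norm e"])
      show "((\<lambda>s. norm e * s) has_vector_derivative norm e) (at s)" for s
        unfolding has_real_derivative_iff_has_vector_derivative[symmetric]
        by (auto intro!: derivative_eq_intros)
    qed (use z speed phi_deriv phi_cont in \<open>auto intro!: continuous_intros\<close>)
    then show ?thesis by simp
  qed
  then have "norm (F (phi z y) - e) \<le> L * (norm e * z)"
    unfolding e_def using lip[of "phi z y" y] L_pos by (smt (verit) mult_left_mono)
  moreover have "norm e * norm e \<le> norm (F (phi z y) - e) * norm e"
  proof -
    have "norm e * norm e = - ((F (phi z y) - e) \<bullet> e)"
      using z(3) by (simp add: inner_diff_left power2_norm_eq_inner flip: power2_eq_square)
    also have "\<dots> \<le> norm (F (phi z y) - e) * norm e"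
      using Cauchy_Schwarz_ineq2[of "F (phi z y) - e" e] by linarith
    finally show ?thesis .
  qed
  then have "norm e \<le> norm (F (phi z y) - e)"
    using \<open>e \<noteq> 0\<close> mult_right_le_imp_le zero_less_norm_iff by blast
  ultimately have "1 * norm e \<le> (L * z) * norm e" by (simp only: mult_ac mult_1)
  then have "1 \<le> L * z" using \<open>e \<noteq> 0\<close> mult_right_le_imp_le zero_less_norm_iff by blast
  then have "1 / L \<le> z" using L_pos by (simp add: field_simps)
  then show ?thesis using z by linarith
qed

definition least_period :: "'a \<Rightarrow> real \<Rightarrow> bool" where
  "least_period x T \<longleftrightarrow> T > 0 \<and> phi T x = x \<and> (\<forall>t. 0 < t \<and> phi t x = x \<longrightarrow> T \<le> t)"

lemma least_period_exists:
  assumes "F x \<noteq> 0" "t > 0" "phi t x = x"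
  obtains T where "least_period x T" "T \<le> t"
proof -
  \<comment> \<open>Replacing \<open>s > 0\<close> by \<open>s \<ge> 1 / L\<close> loses no return
    time of a nonequilibrium and makes the set closed, so its infimum is attained.\<close>
  define S where "S = {s. s \<ge> 1 / L \<and> phi s x = x}"
  have mem: "s \<in> S \<longleftrightarrow> s > 0 \<and> phi s x = x" for s
    using return_time_ge[of s x] assms(1) L_pos by (auto simp: S_def) (smt (verit) divide_pos_pos)
  have "closed S"
    unfolding S_def Collect_conj_eq
    by (intro closed_Int closed_Collect_le closed_Collect_eq continuous_intros phi_cont)
  moreover have "bdd_below S" unfolding S_def by (intro bdd_belowI[of _ "1 / L"]) auto
  ultimately have "Inf S \<in> S" using closed_contains_Inf[of S] mem assms by blast
  then have "least_period x (Inf S)"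
    unfolding least_period_def using mem \<open>bdd_below S\<close> by (auto intro: cInf_lower)
  then show ?thesis using that mem assms least_period_def by blast
qed

lemma least_period_phi:
  assumes "least_period x T" shows "least_period (phi s x) T"
proof -
  have "phi t (phi s x) = phi s x \<longleftrightarrow> phi t x = x" for t
  proof
    assume "phi t (phi s x) = phi s x"
    from phi_periodic_shift(3)[OF this, of "- s"] show "phi t x = x" by simp
  qed (rule phi_periodic_shift(3))
  then show ?thesis using assms unfolding least_period_def by simp
qed

end

section \<open>Differentiability of the flow in the initial point\<close>

lemma uniform_linear_approx:
  fixes f :: "'a::euclidean_space \<Rightarrow> 'b::real_normed_vector"
  assumes "compact K" "open U" "K \<subseteq> U"
    and f: "\<And>x. x \<in> U \<Longrightarrow> (f has_derivative blinfun_apply (f' x)) (at x)"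
    and f': "continuous_on U f'" and "e > 0"
  obtains d where "d > 0"
    "\<And>z v. z \<in> K \<Longrightarrow> norm v < d \<Longrightarrow> norm (f (z + v) - f z - f' z v) \<le> e * norm v"
proof -
  obtain r where r: "r > 0" "(\<Union>x\<in>K. cball x r) \<subseteq> U"
    using compact_subset_open_imp_cball_epsilon_subset[OF assms(1-3)] .
  \<comment> \<open>The perturbed points may leave \<open>K\<close>, so uniform continuity of
    \<open>f'\<close> is used on a compact thickening that still lies in \<open>U\<close>; this
    makes \<open>d\<close> independent of \<open>z\<close>.\<close>
  define N where "N = {x + y | x y. x \<in> K \<and> y \<in> cball 0 r}"
  have "compact N" unfolding N_def by (intro compact_sums assms compact_cball)
  have "N \<subseteq> U" using r by (force simp: N_def dist_norm)
  have "uniformly_continuous_on N f'"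
    using \<open>compact N\<close> \<open>N \<subseteq> U\<close> f' by (meson compact_uniformly_continuous continuous_on_subset)
  then obtain d where d: "d > 0"
    "\<And>x y. x \<in> N \<Longrightarrow> y \<in> N \<Longrightarrow> dist y x < d \<Longrightarrow> dist (f' y) (f' x) < e"
    unfolding uniformly_continuous_on_def using \<open>e > 0\<close> by metis
  show ?thesis
  proof (rule that[of "min d r"])
    show "min d r > 0" using d r by simp
    fix z v :: 'a assume z: "z \<in> K" and v: "norm v < min d r"
    let ?S = "ball z (min d r)"
    have S: "?S \<subseteq> N"
    proof
      fix x assume "x \<in> ?S"
      then have "x = z + (x - z) \<and> z \<in> K \<and> x - z \<in> cball 0 r"
        using z by (auto simp: dist_norm norm_minus_commute)
      then show "x \<in> N" unfolding N_def by blast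
    qed
    have "norm (f (z + v) - f z - f' z (z + v - z)) \<le> norm (z + v - z) * e"
    proof (rule differentiable_bound_linearization[where S = ?S and f' = "\<lambda>x. blinfun_apply (f' x)"])
      show "z + t *\<^sub>R (z + v - z) \<in> ?S" if "t \<in> {0..1}" for t
      proof -
        have "t * norm v \<le> norm v" using that by (simp add: mult_left_le_one_le)
        then show ?thesis using v that by (simp add: dist_norm)
      qed
      show "(f has_derivative f' x) (at x within ?S)" if "x \<in> ?S" for x
        using f S \<open>N \<subseteq> U\<close> that by (meson has_derivative_at_withinI subsetD)
      show "onorm (blinfun_apply (f' x) - blinfun_apply (f' z)) \<le> e" if "x \<in> ?S" for x
      proof -
        have "z \<in> N" using S d r by force
        then have "norm (f' x - f' z) < e"
          using d(2)[of z x] that S by (simp add: dist_norm norm_minus_commute subsetD)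
        moreover have "onorm (blinfun_apply (f' x) - blinfun_apply (f' z)) = norm (f' x - f' z)"
          by (simp add: norm_blinfun.rep_eq minus_blinfun.rep_eq fun_diff_def)
        ultimately show ?thesis by simp
      qed
      show "z \<in> ?S" using d r by simp
    qed
    then show "norm (f (z + v) - f z - f' z v) \<le> e * norm v"
      by (simp add: mult.commute)
  qed
qed

text \<open>Continuous differentiability is asked for only near an invariant compact set, since the
  field to which this is applied is merely known to be Lipschitz elsewhere.\<close>

locale smooth_flow = lipschitz_field F L for F :: "'a::euclidean_space \<Rightarrow> 'a" and L +
  fixes U K :: "'a set" and F' :: "'a \<Rightarrow> 'a \<Rightarrow>\<^sub>L 'a"
  assumes U: "open U" and K: "compact K" "K \<subseteq> U"
    and F': "\<And>x. x \<in> U \<Longrightarrow> (F has_derivative blinfun_apply (F' x)) (at x)"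
    and F'_cont: "continuous_on U F'"
    and phi_in: "\<And>x t. x \<in> K \<Longrightarrow> phi t x \<in> K"
begin

text \<open>The variational equation is solved as a linear equation in the Banach space of
  operators, so its solution is linear in \<open>w\<close> without further argument.\<close>

lemma variational_solution:
  assumes "x \<in> K"
  obtains J :: "real \<Rightarrow> 'a \<Rightarrow>\<^sub>L 'a" where
    "\<And>w. blinfun_apply (J 0) w = w"
    "\<And>t w. ((\<lambda>t. J t w) has_vector_derivative F' (phi t x) (J t w)) (at t)"
proof -
  have "bounded (F' ` K)"
    using K F'_cont by (intro compact_imp_bounded compact_continuous_image continuous_on_subset[OF F'_cont])
  then obtain N where N: "\<And>z. z \<in> K \<Longrightarrow> norm (F' z) \<le> N"
    by (auto simp: bounded_iff)
  have cont: "continuous_on UNIV (\<lambda>t. F' (phi t x))"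
    by (rule continuous_on_compose2[OF F'_cont phi_cont]) (use phi_in[OF assms] K in auto)
  obtain J :: "real \<Rightarrow> 'a \<Rightarrow>\<^sub>L 'a" where J0: "J 0 = id_blinfun"
    and J: "\<And>t. (J has_vector_derivative F' (phi t x) o\<^sub>L J t) (at t)"
  proof (rule ode_existence[of "\<lambda>t X. F' (phi t x) o\<^sub>L X" N "id_blinfun" N])
    show "continuous_on UNIV (\<lambda>t. F' (phi t x) o\<^sub>L X t)" if "continuous_on UNIV X"
      for X :: "real \<Rightarrow> 'a \<Rightarrow>\<^sub>L 'a"
      using cont that by (intro continuous_intros)
    show "norm ((F' (phi t x) o\<^sub>L X) - (F' (phi t x) o\<^sub>L Y)) \<le> N * norm (X - Y)"
      for t and X Y :: "'a \<Rightarrow>\<^sub>L 'a"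
    proof -
      have "(F' (phi t x) o\<^sub>L X) - (F' (phi t x) o\<^sub>L Y) = F' (phi t x) o\<^sub>L (X - Y)"
        by (rule blinfun_eqI) (simp add: blinfun.bilinear_simps)
      then show ?thesis
        using norm_blinfun_compose[of "F' (phi t x)" "X - Y"] N[OF phi_in[OF assms], of t]
        by (smt (verit) mult_right_mono norm_ge_zero)
    qed
    show "norm (F' (phi t x) o\<^sub>L id_blinfun) \<le> N" for t
      using N[OF phi_in[OF assms], of t] norm_blinfun_compose[of "F' (phi t x)" id_blinfun]
        norm_blinfun_id_le[where 'a='a] by (smt (verit) mult_left_le norm_ge_zero)
  qed auto
  show ?thesis
  proof (rule that[of J])
    show "((\<lambda>t. J t w) has_vector_derivative F' (phi t x) (J t w)) (at t)" for t w
      using bounded_linear.has_vector_derivative[OF blinfun.bounded_linear_left J, of w t] by simp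
  qed (simp add: J0)
qed

lemma phi_has_derivative:
  assumes "x \<in> K"
  obtains J :: "real \<Rightarrow> 'a \<Rightarrow>\<^sub>L 'a" where
    "\<And>t. (phi t has_derivative blinfun_apply (J t)) (at x)"
    "\<And>t M w. (\<And>s. norm (F' (phi s x)) \<le> M) \<Longrightarrow> norm (J t w) \<le> exp (M * \<bar>t\<bar>) * norm w"
proof -
  obtain J :: "real \<Rightarrow> 'a \<Rightarrow>\<^sub>L 'a" where J0: "\<And>w. J 0 w = w"
    and J: "\<And>t w. ((\<lambda>t. J t w) has_vector_derivative F' (phi t x) (J t w)) (at t)"
    using variational_solution[OF assms] by blast
  have J_bound: "norm (J t w) \<le> exp (M * \<bar>t\<bar>) * norm w" if "\<And>s. norm (F' (phi s x)) \<le> M" for t M w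
  proof -
    have "norm (J t w) \<le> (norm (J 0 w) + 0 * \<bar>t\<bar>) * exp (M * \<bar>t\<bar>)"
    proof (rule gronwall[OF J])
      show "norm (F' (phi s x) (J s w)) \<le> M * norm (J s w) + 0" for s
        using norm_blinfun[of "F' (phi s x)" "J s w"] that[of s]
        by (smt (verit) mult_right_mono norm_ge_zero)
      show "M \<ge> 0" using that[of 0] norm_ge_zero order_trans by blast
    qed simp
    then show ?thesis by (simp add: J0 mult.commute)
  qed
  have "bounded (F' ` K)"
    using K F'_cont by (intro compact_imp_bounded compact_continuous_image continuous_on_subset[OF F'_cont])
  then obtain N where N: "\<And>z. z \<in> K \<Longrightarrow> norm (F' z) \<le> N"
    by (auto simp: bounded_iff)
  have N0: "N \<ge> 0" using N[OF assms] norm_ge_zero order_trans by blast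
  have "(phi t has_derivative J t) (at x)" for t
    unfolding has_derivative_at_alt
  proof (intro conjI allI impI)
    show "bounded_linear (J t)" by (rule blinfun.bounded_linear_right)
    fix e :: real assume "e > 0"
    \<comment> \<open>\<open>c - 1\<close> is the factor by which Gronwall amplifies the
      linearization error, so accuracy \<open>e / c\<close> along the orbit gives a final error of
      at most \<open>e * norm (y - x)\<close>.\<close>
    define c where "c = exp (L * \<bar>t\<bar>) * \<bar>t\<bar> * exp (N * \<bar>t\<bar>) + 1"
    have "c \<ge> 1" by (simp add: c_def)
    obtain d where d: "d > 0"
      "\<And>z v. z \<in> K \<Longrightarrow> norm v < d \<Longrightarrow> norm (F (z + v) - F z - F' z v) \<le> e / c * norm v"
      by (rule uniform_linear_approx[OF K(1) U K(2) F' F'_cont, of "e / c"])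
        (use \<open>e > 0\<close> \<open>c \<ge> 1\<close> in auto)
    show "\<exists>d>0. \<forall>y. norm (y - x) < d \<longrightarrow> norm (phi t y - phi t x - J t (y - x)) \<le> e * norm (y - x)"
    \<comment> \<open>The exponential factor keeps the two orbits within distance \<open>d\<close>
      of each other up to time \<open>t\<close>.\<close>
    proof (intro exI[of _ "d * exp (- (L * \<bar>t\<bar>))"] conjI allI impI)
      fix y assume "norm (y - x) < d * exp (- (L * \<bar>t\<bar>))"
      then have y: "norm (y - x) * exp (L * \<bar>t\<bar>) < d" by (simp add: exp_minus field_simps)
      define w where "w = y - x"
      let ?b = "e / c * (norm w * exp (L * \<bar>t\<bar>))"
      have "norm (phi t y - phi t x - J t w)
          \<le> (norm (phi 0 y - phi 0 x - J 0 w) + ?b * \<bar>t\<bar>) * exp (N * \<bar>t\<bar>)"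
      proof (rule gronwall[where u = "\<lambda>t. phi t y - phi t x - J t w"])
        show "((\<lambda>t. phi t y - phi t x - J t w) has_vector_derivative
            F (phi t y) - F (phi t x) - F' (phi t x) (J t w)) (at t)" for t
          by (intro has_vector_derivative_diff phi_deriv J)
        fix s assume s: "\<bar>s\<bar> \<le> \<bar>t\<bar>"
        define v where "v = phi s y - phi s x"
        have "norm v \<le> norm w * exp (L * \<bar>s\<bar>)" unfolding v_def w_def by (rule phi_dist)
        also have "\<dots> \<le> norm w * exp (L * \<bar>t\<bar>)" using s L_pos by (intro mult_left_mono) auto
        finally have v: "norm v \<le> norm w * exp (L * \<bar>t\<bar>)" .
        then have "norm v < d" using y by (simp add: w_def)
        from d(2)[OF phi_in[OF assms] this, of s]
        have "norm (F (phi s y) - F (phi s x) - F' (phi s x) v) \<le> e / c * norm v"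
          by (simp add: v_def)
        also have "\<dots> \<le> ?b" using v \<open>e > 0\<close> \<open>c \<ge> 1\<close> by (intro mult_left_mono) auto
        finally have 1: "norm (F (phi s y) - F (phi s x) - F' (phi s x) v) \<le> ?b" .
        have "norm (F' (phi s x) (v - J s w)) \<le> N * norm (v - J s w)"
          using norm_blinfun[of "F' (phi s x)" "v - J s w"] N[OF phi_in[OF assms], of s]
          by (smt (verit) mult_right_mono norm_ge_zero)
        moreover have "F (phi s y) - F (phi s x) - F' (phi s x) (J s w) =
            F' (phi s x) (v - J s w) + (F (phi s y) - F (phi s x) - F' (phi s x) v)"
          by (simp add: blinfun.bilinear_simps)
        ultimately show "norm (F (phi s y) - F (phi s x) - F' (phi s x) (J s w))
            \<le> N * norm (phi s y - phi s x - J s w) + ?b"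
          using 1 norm_triangle_ineq[of "F' (phi s x) (v - J s w)"
              "F (phi s y) - F (phi s x) - F' (phi s x) v"]
          unfolding v_def by (smt (verit))
      qed (use N0 \<open>e > 0\<close> \<open>c \<ge> 1\<close> in auto)
      also have "\<dots> = e * norm w * ((c - 1) / c)"
        by (simp add: J0 w_def c_def)
      also have "\<dots> \<le> e * norm w * 1"
        using \<open>e > 0\<close> \<open>c \<ge> 1\<close> by (intro mult_left_mono) auto
      finally show "norm (phi t y - phi t x - J t (y - x)) \<le> e * norm (y - x)"
        by (simp add: w_def)
    qed (use d in auto)
  qed
  then show ?thesis using that J_bound by blast
qed

end

section \<open>Closed orbits of a smooth flow\<close>

context smooth_flow begin

definition dphi :: "real \<Rightarrow> 'a \<Rightarrow> 'a \<Rightarrow> 'a" where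
  "dphi t x = frechet_derivative (phi t) (at x)"

lemma dphi: "x \<in> K \<Longrightarrow> (phi t has_derivative dphi t x) (at x)"
  unfolding dphi_def using phi_has_derivative
  by (metis differentiable_def frechet_derivative_works)

lemma dphi_bound:
  assumes "x \<in> K" "\<And>s. norm (F' (phi s x)) \<le> M"
  shows "norm (dphi t x w) \<le> exp (M * \<bar>t\<bar>) * norm w"
proof -
  obtain J :: "real \<Rightarrow> 'a \<Rightarrow>\<^sub>L 'a" where
    "\<And>t. (phi t has_derivative blinfun_apply (J t)) (at x)"
    "\<And>t M w. (\<And>s. norm (F' (phi s x)) \<le> M) \<Longrightarrow> norm (J t w) \<le> exp (M * \<bar>t\<bar>) * norm w"
    using phi_has_derivative[OF assms(1)] by blast
  then show ?thesis using dphi[OF assms(1)] assms(2) by (metis has_derivative_unique)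
qed

lemma dphi_linear: "x \<in> K \<Longrightarrow> linear (dphi t x)"
  using dphi has_derivative_linear by blast

lemma dphi_add:
  assumes "x \<in> K"
  shows "dphi (s + t) x w = dphi s (phi t x) (dphi t x w)"
proof -
  have "(phi s \<circ> phi t has_derivative dphi s (phi t x) \<circ> dphi t x) (at x)"
    by (rule diff_chain_at) (use dphi assms phi_in in auto)
  moreover have "phi s \<circ> phi t = phi (s + t)" by (auto simp: phi_add)
  ultimately show ?thesis using has_derivative_unique[OF dphi[OF assms, of "s + t"]] by simp
qed

lemma dphi_0:
  assumes "x \<in> K" shows "dphi 0 x w = w"
  using has_derivative_unique[OF dphi[OF assms, of 0], of id]
  by (metis eq_id_iff has_derivative_id phi_0 ext)

lemma dphi_neg:
  assumes "x \<in> K" shows "dphi (- t) (phi t x) (dphi t x w) = w"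
  using dphi_add[OF assms, of "- t" t w] dphi_0[OF assms] by simp

text \<open>Differentiate \<open>phi t (phi s x) = phi s (phi t x)\<close> at
  \<open>s = 0\<close>.\<close>

lemma dphi_field:
  assumes "x \<in> K" shows "dphi t x (F x) = F (phi t x)"
proof -
  have "((\<lambda>s. phi s x) has_vector_derivative F x) (at 0)"
    using phi_deriv[of x 0] by simp
  moreover have "(phi t has_derivative dphi t x) (at (phi 0 x))" using dphi[OF assms] by simp
  ultimately have "((\<lambda>s. phi t (phi s x)) has_vector_derivative dphi t x (F x)) (at 0)"
    unfolding has_vector_derivative_def
    using diff_chain_at[of "\<lambda>s. phi s x" "\<lambda>h. h *\<^sub>R F x" 0 "phi t" "dphi t x"]
      dphi_linear[OF assms, of t]
    by (simp add: o_def linear_cmul)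
  moreover have "phi t (phi s x) = phi s (phi t x)" for s
    by (metis add.commute phi_add)
  ultimately show ?thesis
    using phi_deriv[of "phi t x" 0] vector_derivative_unique_at by (metis (no_types, lifting) ext phi_0)
qed

text \<open>\<open>rigid\<close> is the effect of a first integral: an orbit that comes back to the normal line through its
  starting point comes back to the starting point.\<close>

lemma nearby_return:
  assumes x0: "x0 \<in> K" "F x0 \<noteq> 0" "phi T x0 = x0" "T > 0"
    and "\<rho> > 0" and rigid: "\<And>x t. x \<in> K \<Longrightarrow> norm (x - x0) < \<rho> \<Longrightarrow> norm (phi t x - x0) < \<rho> \<Longrightarrow>
      (phi t x - x) \<bullet> F x0 = 0 \<Longrightarrow> phi t x = x"
    and "\<eta> > 0"
  obtains \<delta> where "\<delta> > 0"
    "\<And>x. x \<in> K \<Longrightarrow> norm (x - x0) < \<delta> \<Longrightarrow> \<exists>s. \<bar>s\<bar> \<le> \<eta> \<and> phi (T + s) x = x"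
proof -
  define n where "n = norm (F x0)"
  have n: "n > 0" using x0 by (simp add: n_def)
  \<comment> \<open>The bound \<open>1 / (16 * L * exp L)\<close> keeps the error of the linear
    approximation small against \<open>n * h\<close>; the bound with \<open>\<rho>\<close> keeps the
    orbit in the ball where \<open>rigid\<close> applies.\<close>
  define h where "h = min (min \<eta> 1) (min (1 / (16 * L * exp L)) (\<rho> / (8 * n * exp L)))"
  have hp: "h > 0" "h \<le> \<eta>" "h \<le> 1"
    using n \<open>\<eta> > 0\<close> \<open>\<rho> > 0\<close> L_pos by (auto simp: h_def)
  have "h \<le> 1 / (16 * L * exp L)" "h \<le> \<rho> / (8 * n * exp L)"
    unfolding h_def by linarith+
  then have h: "h > 0" "h \<le> \<eta>" "h \<le> 1" "16 * L * exp L * h \<le> 1" "8 * n * exp L * h \<le> \<rho>"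
    using n L_pos hp by (simp_all add: field_simps)
  define d where "d = min (n / (8 * L)) (min (h * n / 8) (\<rho> / 2))"
  have "d \<le> n / (8 * L)" unfolding d_def by linarith
  then have "d * (8 * L) \<le> n" using L_pos by (simp add: field_simps)
  then have d: "d > 0" "d * (8 * L) \<le> n" "d \<le> h * n / 8" "d \<le> \<rho> / 2"
    using n h L_pos \<open>\<rho> > 0\<close> by (auto simp: d_def)
  show ?thesis
  \<comment> \<open>Up to time \<open>T\<close> distances grow by at most
    \<open>exp (L * T)\<close>, so \<open>phi T x\<close> lands within \<open>d\<close> of
    \<open>x0\<close>.\<close>
  proof (rule that[of "d * exp (- (L * T))"])
    show "d * exp (- (L * T)) > 0" using d by simp
    fix x assume x: "x \<in> K" "norm (x - x0) < d * exp (- (L * T))"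
    define y where "y = phi T x"
    have "norm (y - x0) \<le> norm (x - x0) * exp (L * T)"
      unfolding y_def using phi_dist[of T x x0] x0 by simp
    also have "\<dots> < d" using x by (simp add: exp_minus field_simps)
    finally have y: "norm (y - x0) < d" .
    have "exp (- (L * T)) \<le> 1" using L_pos x0 by simp
    then have "d * exp (- (L * T)) \<le> d * 1" using d by (intro mult_left_mono) auto
    then have xd: "norm (x - x0) < d" using x by linarith
    have yx: "norm (y - x) \<le> 2 * d"
      using y xd norm_triangle_ineq4[of "y - x0" "x - x0"] by simp
    have "norm (F y) \<le> n + L * norm (y - x0)"
      unfolding n_def using lip[of y x0] norm_triangle_ineq2[of "F y" "F x0"] by linarith
    also have "L * norm (y - x0) \<le> L * d" using y L_pos by (intro mult_left_mono) auto
    also have "n + L * d \<le> 2 * n"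
    proof -
      have "L * d * 8 \<le> n" using d(2) by (simp add: mult_ac)
      then show ?thesis using n by linarith
    qed
    finally have Fy: "norm (F y) \<le> 2 * n" by simp
    have disp: "norm (F y) * \<bar>s\<bar> * exp (L * \<bar>s\<bar>) \<le> 2 * n * h * exp L" if "\<bar>s\<bar> \<le> h" for s
    proof -
      have "L * \<bar>s\<bar> \<le> L * 1" using that h L_pos by (intro mult_left_mono) auto
      then have "exp (L * \<bar>s\<bar>) \<le> exp L" by simp
      moreover have "norm (F y) * \<bar>s\<bar> \<le> 2 * n * h" using Fy that n by (intro mult_mono) auto
      ultimately show ?thesis using n h by (intro mult_mono[of _ "2 * n * h"]) auto
    qed
    have approx: "norm (phi s y - y - s *\<^sub>R F x0) \<le> n / 4 * h" if s: "\<bar>s\<bar> \<le> h" for s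
    proof -
      have "norm (phi s y - y - s *\<^sub>R F x0)
          \<le> L * (norm (F y) * \<bar>s\<bar> * exp (L * \<bar>s\<bar>) + norm (y - x0)) * \<bar>s\<bar>"
        by (rule phi_linear_approx)
      also have "\<dots> \<le> L * (2 * n * h * exp L + d) * h"
      proof -
        have "norm (F y) * \<bar>s\<bar> * exp (L * \<bar>s\<bar>) + norm (y - x0) \<le> 2 * n * h * exp L + d"
          using disp[OF s] y by linarith
        moreover have "0 \<le> 2 * n * h * exp L + d" using n h d by simp
        ultimately show ?thesis using s L_pos h by (simp add: mult_mono)
      qed
      also have "L * (2 * n * h * exp L + d) = n / 8 * (16 * L * exp L * h) + (d * (8 * L)) / 8"
        by (simp add: algebra_simps)
      also have "(n / 8 * (16 * L * exp L * h) + (d * (8 * L)) / 8) * h \<le> (n / 8 * 1 + n / 8) * h"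
        using h(1,4) d n by (intro mult_right_mono add_mono mult_left_mono) auto
      finally show ?thesis by simp
    qed
    \<comment> \<open>\<open>g\<close> measures the displacement along \<open>F x0\<close>. It is
      close to \<open>s * (n * n)\<close> and hence changes sign on \<open>{- h..h}\<close>; at a
      zero, \<open>rigid\<close> applies.\<close>
    define g where "g s = (phi s y - x) \<bullet> F x0" for s
    have g: "\<bar>g s - s * (n * n)\<bar> \<le> h * (n * n) / 2" if "\<bar>s\<bar> \<le> h" for s
    proof -
      have "g s - s * (n * n) = (phi s y - y - s *\<^sub>R F x0) \<bullet> F x0 + (y - x) \<bullet> F x0"
        by (simp add: g_def n_def inner_diff_left norm_eq_sqrt_inner)
      also have "\<bar>\<dots>\<bar> \<le> n / 4 * h * n + 2 * d * n"
      proof -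
        have "\<bar>(phi s y - y - s *\<^sub>R F x0) \<bullet> F x0\<bar> \<le> n / 4 * h * n"
          using Cauchy_Schwarz_ineq2[of "phi s y - y - s *\<^sub>R F x0" "F x0"] approx[OF that] n
          unfolding n_def[symmetric] by (smt (verit) mult_right_mono)
        moreover have "\<bar>(y - x) \<bullet> F x0\<bar> \<le> 2 * d * n"
          using Cauchy_Schwarz_ineq2[of "y - x" "F x0"] yx n
          unfolding n_def[symmetric] by (smt (verit) mult_right_mono)
        ultimately show ?thesis by linarith
      qed
      also have "2 * d * n \<le> 2 * (h * n / 8) * n" using d n by (intro mult_right_mono mult_left_mono) auto
      finally show ?thesis by (simp add: algebra_simps)
    qed
    have hn: "h * (n * n) > 0" using h n by simp
    have "g (- h) \<le> 0" "0 \<le> g h" using g[of h] g[of "- h"] h(1) hn unfolding abs_le_iff by simp_all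
    moreover have "continuous_on {- h..h} g"
      unfolding g_def by (intro continuous_intros phi_cont)
    ultimately obtain s where s: "- h \<le> s" "s \<le> h" "g s = 0"
      using IVT'[of g "- h" 0 h] h by auto
    have eq: "phi s y = phi (T + s) x"
      unfolding y_def by (simp add: add.commute flip: phi_add)
    have "phi (T + s) x = x"
    proof (rule rigid[OF x(1)])
      show "norm (x - x0) < \<rho>" using xd d \<open>\<rho> > 0\<close> by linarith
      have "norm (phi s y - y) \<le> 2 * n * h * exp L"
        using phi_displacement[of s y] disp[of s] s by linarith
      also have "\<dots> \<le> \<rho> / 4" using h(5) by (simp add: algebra_simps)
      finally have "norm (phi s y - y) \<le> \<rho> / 4" .
      then show "norm (phi (T + s) x - x0) < \<rho>"
        using y d \<open>\<rho> > 0\<close> norm_triangle_ineq[of "phi s y - y" "y - x0"] by (simp add: eq)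
      show "(phi (T + s) x - x) \<bullet> F x0 = 0" using s(3) by (simp add: g_def eq)
    qed
    then show "\<exists>s. \<bar>s\<bar> \<le> \<eta> \<and> phi (T + s) x = x" using s h by (intro exI[of _ s]) auto
  qed
qed

text \<open>A return near \<open>T\<close> bounds the least period from above. From below, times
  under \<open>1 / L\<close> are excluded by the minimal return time, and on the remaining compact
  interval the orbit of \<open>x0\<close> keeps a positive distance from \<open>x0\<close>, so
  nearby orbits cannot close there either.\<close>

lemma least_period_continuous:
  assumes x0: "x0 \<in> K" "F x0 \<noteq> 0" "least_period x0 T"
    and "\<rho> > 0" and rigid: "\<And>x t. x \<in> K \<Longrightarrow> norm (x - x0) < \<rho> \<Longrightarrow> norm (phi t x - x0) < \<rho> \<Longrightarrow>
      (phi t x - x) \<bullet> F x0 = 0 \<Longrightarrow> phi t x = x"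
    and "\<eta> > 0"
  obtains \<delta> where "\<delta> > 0"
    "\<And>x. x \<in> K \<Longrightarrow> norm (x - x0) < \<delta> \<Longrightarrow> \<exists>T'. least_period x T' \<and> \<bar>T' - T\<bar> \<le> \<eta>"
proof -
  have T: "T > 0" "phi T x0 = x0" "\<And>t. 0 < t \<Longrightarrow> t < T \<Longrightarrow> phi t x0 \<noteq> x0"
    using x0(3) unfolding least_period_def by force+
  define \<eta>' where "\<eta>' = min \<eta> (T / 2)"
  have \<eta>': "\<eta>' > 0" "\<eta>' \<le> \<eta>" "\<eta>' < T" using T \<open>\<eta> > 0\<close> by (auto simp: \<eta>'_def)
  obtain d1 where d1: "d1 > 0"
    "\<And>x. x \<in> K \<Longrightarrow> norm (x - x0) < d1 \<Longrightarrow> \<exists>s. \<bar>s\<bar> \<le> \<eta>' \<and> phi (T + s) x = x"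
    using nearby_return[OF x0(1,2) T(2,1) \<open>\<rho> > 0\<close> rigid \<eta>'(1)] by blast
  have "\<exists>\<kappa>>0. \<forall>t\<in>{1 / L..T - \<eta>'}. \<kappa> \<le> norm (phi t x0 - x0)"
  proof (cases "{1 / L..T - \<eta>'} = {}")
    case False
    then obtain t0 where t0: "t0 \<in> {1 / L..T - \<eta>'}"
      "\<And>t. t \<in> {1 / L..T - \<eta>'} \<Longrightarrow> norm (phi t0 x0 - x0) \<le> norm (phi t x0 - x0)"
      using continuous_attains_inf[of "{1 / L..T - \<eta>'}" "\<lambda>t. norm (phi t x0 - x0)"]
      by (force intro!: continuous_intros phi_cont)
    moreover have "t0 > 0" using t0(1) L_pos by (auto intro: less_le_trans[of 0 "1 / L"])
    ultimately show ?thesis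
      using T(3)[of t0] \<eta>' by (intro exI[of _ "norm (phi t0 x0 - x0)"]) auto
  qed (auto intro: exI[of _ 1])
  then obtain \<kappa> where \<kappa>: "\<kappa> > 0" "\<And>t. 1 / L \<le> t \<Longrightarrow> t \<le> T - \<eta>' \<Longrightarrow> \<kappa> \<le> norm (phi t x0 - x0)"
    by auto
  define c where "c = norm (F x0) / (2 * L)"
  have c: "c > 0" using x0 L_pos by (simp add: c_def)
  \<comment> \<open>The three bounds secure a return near \<open>T\<close>, keep \<open>x\<close>
    away from equilibria, and prevent the orbit of \<open>x\<close> from closing before
    \<open>T - \<eta>'\<close>.\<close>
  define d where "d = min (min d1 c) (\<kappa> / (1 + exp (L * T)))"
  show ?thesis
  proof (rule that[of d])
    show "d > 0" unfolding d_def using d1 c \<kappa> by (auto intro!: divide_pos_pos simp: add_pos_pos)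
    fix x assume x: "x \<in> K" "norm (x - x0) < d"
    have "F x \<noteq> 0"
    proof
      assume "F x = 0"
      then have "norm (F x0) \<le> L * norm (x - x0)" using lip[of x x0] by simp
      also have "\<dots> < L * c" using x L_pos by (simp add: d_def)
      also have "\<dots> < norm (F x0)" using x0 L_pos by (simp add: c_def)
      finally show False .
    qed
    obtain s where s: "\<bar>s\<bar> \<le> \<eta>'" "phi (T + s) x = x" using d1(2)[of x] x by (auto simp: d_def)
    have "T + s > 0" using s(1) \<eta>' by linarith
    from least_period_exists[OF \<open>F x \<noteq> 0\<close> this s(2)]
    obtain T' where T': "least_period x T'" "T' \<le> T + s" by blast
    have "T' \<ge> T - \<eta>'"
    proof (rule ccontr)
      assume less: "\<not> T' \<ge> T - \<eta>'"
      have T'0: "T' > 0" "phi T' x = x" using T'(1) by (auto simp: least_period_def)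
      then have "T' \<ge> 1 / L" using return_time_ge \<open>F x \<noteq> 0\<close> by blast
      then have "\<kappa> \<le> norm (phi T' x0 - x0)" using \<kappa> less by simp
      also have "\<dots> = norm ((phi T' x0 - phi T' x) + (x - x0))" using T'0 by simp
      also have "\<dots> \<le> norm (x0 - x) * exp (L * T') + norm (x - x0)"
        using norm_triangle_ineq[of "phi T' x0 - phi T' x" "x - x0"] phi_dist[of T' x0 x] T'0 by simp
      also have "\<dots> \<le> norm (x - x0) * exp (L * T) + norm (x - x0)"
        using less \<eta>' L_pos by (intro add_mono mult_mono) (auto simp: norm_minus_commute)
      also have "\<dots> = norm (x - x0) * (1 + exp (L * T))" by (simp add: algebra_simps)
      also have "\<dots> < \<kappa>" using x
        by (auto simp: d_def field_simps add_pos_pos)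
      finally show False by simp
    qed
    then show "\<exists>T'. least_period x T' \<and> \<bar>T' - T\<bar> \<le> \<eta>" using T' s \<eta>' by (intro exI[of _ T']) auto
  qed
qed

text \<open>With \<open>\<sigma> = \<tau> x - T\<close> and \<open>y = phi T x\<close>, the return condition reads \<open>x - y = phi \<sigma> y - y\<close>, and
  the right-hand side is \<open>\<sigma> *\<^sub>R F x0\<close> up to \<open>o(\<sigma>)\<close>.\<close>

lemma return_time_has_derivative:
  assumes x0: "x0 \<in> K" "F x0 \<noteq> 0" "phi T x0 = x0" "\<tau> x0 = T"
    and ret: "\<forall>\<^sub>F x in at x0 within K. phi (\<tau> x) x = x"
    and cont: "(\<tau> \<longlongrightarrow> T) (at x0 within K)"
    and unique: "\<And>(f::'a \<Rightarrow> 'a) A B. (f has_derivative A) (at x0 within K) \<Longrightarrow>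
      (f has_derivative B) (at x0 within K) \<Longrightarrow> A = B"
  obtains D where "(\<tau> has_derivative D) (at x0 within K)"
    "\<And>w. dphi T x0 w = w - D w *\<^sub>R F x0"
proof -
  define n where "n = norm (F x0)"
  have n: "n > 0" using x0 by (simp add: n_def)
  define h where "h x = x - phi T x" for x
  define \<sigma> where "\<sigma> x = \<tau> x - T" for x
  define e where "e x = h x - \<sigma> x *\<^sub>R F x0" for x
  define A where "A w = w - dphi T x0 w" for w
  have phiT: "(phi T has_derivative dphi T x0) (at x0 within K)"
    using dphi[OF x0(1)] has_derivative_at_withinI by blast
  have h: "(h has_derivative A) (at x0 within K)"
    unfolding h_def A_def by (intro has_derivative_diff has_derivative_ident phiT)
  have blA: "bounded_linear A" using h has_derivative_bounded_linear by blast
  \<comment> \<open>This is the error bound of \<open>phi_linear_approx\<close> after time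
    \<open>\<sigma> x\<close>, divided by \<open>\<bar>\<sigma> x\<bar>\<close>; continuity of the
    return time makes it tend to 0.\<close>
  define \<theta> where "\<theta> x = L * (norm (F (phi T x)) * \<bar>\<sigma> x\<bar> * exp (L * \<bar>\<sigma> x\<bar>) + norm (phi T x - x0))" for x
  have e_le: "\<forall>\<^sub>F x in at x0 within K. norm (e x) \<le> \<theta> x * \<bar>\<sigma> x\<bar>"
    using ret
  proof eventually_elim
    case (elim x)
    have "phi (\<sigma> x) (phi T x) = x" using elim by (simp add: \<sigma>_def flip: phi_add)
    then show ?case using phi_linear_approx[of "\<sigma> x" "phi T x" x0] by (simp add: e_def h_def \<theta>_def)
  qed
  have phiT_lim: "(phi T \<longlongrightarrow> x0) (at x0 within K)"
    using has_derivative_continuous[OF phiT] x0(3) by (simp add: continuous_within)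
  have \<sigma>_lim: "(\<sigma> \<longlongrightarrow> 0) (at x0 within K)"
    unfolding \<sigma>_def using tendsto_diff[OF cont tendsto_const[of T]] by simp
  have F_lim: "((\<lambda>x. F (phi T x)) \<longlongrightarrow> F x0) (at x0 within K)"
    by (rule continuous_on_tendsto_compose[OF F_cont[of UNIV] phiT_lim]) auto
  have "(\<theta> \<longlongrightarrow> L * (norm (F x0) * \<bar>0\<bar> * exp (L * \<bar>0\<bar>) + norm (x0 - x0))) (at x0 within K)"
    unfolding \<theta>_def by (intro tendsto_intros \<sigma>_lim F_lim phiT_lim)
  then have \<theta>_lim: "(\<theta> \<longlongrightarrow> 0) (at x0 within K)" by simp
  have \<theta>_small: "\<forall>\<^sub>F x in at x0 within K. \<theta> x < c" if "c > 0" for c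
    using order_tendstoD(2)[OF \<theta>_lim that] .
  obtain a where a: "a > 0" "\<And>w. norm (A w) \<le> a * norm w"
    using bounded_linear.pos_bounded[OF blA] by (auto simp: mult.commute)
  have h_le: "\<forall>\<^sub>F x in at x0 within K. norm (h x) \<le> (a + 1) * norm (x - x0)"
  proof -
    have "\<forall>\<^sub>F x in at x0 within K. norm (h x - h x0 - A (x - x0)) \<le> 1 * norm (x - x0)"
      using h unfolding has_derivative_within_alt2 by (metis zero_less_one)
    then show ?thesis
    proof eventually_elim
      case (elim x)
      then have "norm (h x - A (x - x0)) \<le> norm (x - x0)" using x0 by (simp add: h_def)
      then show ?case using a(2)[of "x - x0"] norm_triangle_ineq[of "h x - A (x - x0)" "A (x - x0)"]
        by (simp add: algebra_simps)
    qed
  qed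
  \<comment> \<open>Half of the left-hand side is absorbed, which upgrades continuity of the return
    time at \<open>x0\<close> to a Lipschitz bound there.\<close>
  have \<sigma>_le: "\<forall>\<^sub>F x in at x0 within K. \<bar>\<sigma> x\<bar> \<le> 2 / n * (a + 1) * norm (x - x0)"
    using e_le h_le \<theta>_small[OF half_gt_zero[OF n]]
  proof eventually_elim
    case (elim x)
    have "\<bar>\<sigma> x\<bar> * n = norm (h x - e x)" by (simp add: e_def n_def)
    also have "\<dots> \<le> (a + 1) * norm (x - x0) + n / 2 * \<bar>\<sigma> x\<bar>"
      using norm_triangle_ineq4[of "h x" "e x"] elim n
      by (smt (verit) mult_right_mono abs_ge_zero half_gt_zero)
    finally show ?case using n by (simp add: field_simps)
  qed
  have e: "(e has_derivative (\<lambda>_. 0)) (at x0 within K)"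
    unfolding has_derivative_within_alt2
  proof (intro conjI allI impI)
    fix c :: real assume "c > 0"
    have e0: "e x0 = 0" using x0 by (simp add: e_def h_def \<sigma>_def)
    have pos: "2 / n * (a + 1) > 0" using n a by (simp add: add_pos_pos)
    have "\<forall>\<^sub>F x in at x0 within K. \<theta> x < c / (2 / n * (a + 1))"
      using \<open>c > 0\<close> pos by (intro \<theta>_small divide_pos_pos)
    then show "\<forall>\<^sub>F y in at x0 within K. norm (e y - e x0 - 0) \<le> c * norm (y - x0)"
      using e_le \<sigma>_le
    proof eventually_elim
      case (elim x)
      have "norm (e x) \<le> c / (2 / n * (a + 1)) * \<bar>\<sigma> x\<bar>"
        using elim by (smt (verit) mult_right_mono abs_ge_zero)
      also have "\<dots> \<le> c / (2 / n * (a + 1)) * (2 / n * (a + 1) * norm (x - x0))"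
        using elim(3) divide_pos_pos[OF \<open>c > 0\<close> pos] by (intro mult_left_mono) linarith+
      also have "\<dots> = c * norm (x - x0)" using pos by (metis less_irrefl mult.assoc nonzero_eq_divide_eq times_divide_eq_left)
      finally show ?case by (simp add: e0)
    qed
  qed simp
  have "((\<lambda>x. h x - e x) has_derivative (\<lambda>w. A w - 0)) (at x0 within K)"
    by (rule has_derivative_diff[OF h e])
  then have \<sigma>V: "((\<lambda>x. \<sigma> x *\<^sub>R F x0) has_derivative A) (at x0 within K)" by (simp add: e_def)
  define D where "D w = A w \<bullet> F x0 / n\<^sup>2" for w
  have "((\<lambda>x. ((\<sigma> x *\<^sub>R F x0) \<bullet> F x0) / n\<^sup>2) has_derivative D) (at x0 within K)"
    unfolding D_def
    by (rule bounded_linear.has_derivative[OF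
          bounded_linear_compose[OF bounded_linear_divide bounded_linear_inner_left] \<sigma>V])
  moreover have "((\<sigma> x *\<^sub>R F x0) \<bullet> F x0) / n\<^sup>2 = \<sigma> x" for x
    using n by (simp add: n_def power2_norm_eq_inner)
  ultimately have D: "(\<sigma> has_derivative D) (at x0 within K)" by simp
  have "((\<lambda>x. \<sigma> x *\<^sub>R F x0) has_derivative (\<lambda>w. D w *\<^sub>R F x0)) (at x0 within K)"
    using D by (auto intro!: derivative_eq_intros)
  \<comment> \<open>Both maps are derivatives of the same function within \<open>K\<close>. As
    \<open>x0\<close> may be a boundary point, their equality needs the assumption
    \<open>unique\<close>.\<close>
  from unique[OF \<sigma>V this] have "A w = D w *\<^sub>R F x0" for w by meson
  moreover have "(\<tau> has_derivative D) (at x0 within K)"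
    using has_derivative_add_const[OF D, of T] by (simp add: \<sigma>_def)
  ultimately show ?thesis using that[of D] by (simp add: A_def algebra_simps)
qed

text \<open>By \<open>DT\<close>, the expression inside the norm is periodic in \<open>t\<close> with period \<open>T\<close>, so it only has to
  be bounded on one period.\<close>

lemma corrected_derivative_bound:
  assumes x: "x \<in> K" "phi T x = x" "T > 0"
    and M: "\<And>s. norm (F' (phi s x)) \<le> M" and MT: "M * T \<le> B"
    and DT: "\<And>w. dphi T x w = w - D w *\<^sub>R F x"
  shows "norm (dphi t x w + (t / T * D w) *\<^sub>R F (phi t x)) \<le> exp B * (2 + exp B) * norm w"
    and "norm (D w *\<^sub>R F (phi t x)) \<le> exp B * (1 + exp B) * norm w"
proof -
  define E where "E t = dphi t x w + (t / T * D w) *\<^sub>R F (phi t x)" for t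
  note lin = dphi_linear[OF x(1)]
  have E: "E (t + T) = E t" for t
  proof -
    have "dphi (t + T) x w = dphi t x (dphi T x w)" using dphi_add[OF x(1), of t T w] x by simp
    also have "\<dots> = dphi t x w - D w *\<^sub>R F (phi t x)"
      using lin[of t] by (simp add: DT linear_diff linear_cmul dphi_field x)
    finally show ?thesis
      using x phi_periodic_shift(1)[OF x(2), of t] by (simp add: E_def algebra_simps add_divide_distrib)
  qed
  have En: "E (t + real n * T) = E t" for t n
  proof (induction n)
    case (Suc n)
    then show ?case using E[of "t + real n * T"] by (simp add: algebra_simps)
  qed simp
  have Ei: "E (t + of_int k * T) = E t" for t k
  proof (cases "k \<ge> 0")
    case True then show ?thesis using En[of t "nat k"] by simp
  next
    case False then show ?thesis using En[of "t + of_int k * T" "nat (- k)"] by simp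
  qed
  have M0: "M \<ge> 0" using M[of 0] norm_ge_zero order_trans by blast
  have one: "norm (dphi s x v) \<le> exp B * norm v" if "s \<in> {0..T}" for s v
  proof -
    have "M * \<bar>s\<bar> \<le> M * T" using that M0 by (intro mult_left_mono) auto
    then have "exp (M * \<bar>s\<bar>) \<le> exp B" using MT by simp
    then show ?thesis using dphi_bound[OF x(1) M, of s v] by (smt (verit) mult_right_mono norm_ge_zero)
  qed
  \<comment> \<open>The term with \<open>D\<close> is the image of \<open>w - dphi T x w\<close>
    under the flow derivative, so no separate bound on the gradient of the period is
    required.\<close>
  have two: "norm (D w *\<^sub>R F (phi s x)) \<le> exp B * (1 + exp B) * norm w" if "s \<in> {0..T}" for s
  proof -
    have "D w *\<^sub>R F (phi s x) = dphi s x (w - dphi T x w)"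
      using lin[of s] by (simp add: DT linear_cmul dphi_field x)
    also have "norm \<dots> \<le> exp B * norm (w - dphi T x w)" by (rule one[OF that])
    also have "\<dots> \<le> exp B * (norm w + exp B * norm w)"
      using norm_triangle_ineq4[of w "dphi T x w"] one[of T w] x(3) by (intro mult_left_mono) auto
    finally show ?thesis by (simp add: algebra_simps)
  qed
  \<comment> \<open>Reduction to one period; with the floor it covers negative times too.\<close>
  define k where "k = \<lfloor>t / T\<rfloor>"
  define s where "s = t - of_int k * T"
  have "of_int k * T \<le> t" "t < (of_int k + 1) * T"
    unfolding k_def using x(3) by (metis of_int_floor_le pos_le_divide_eq, metis floor_correct pos_divide_less_eq of_int_1 of_int_add)
  then have s: "s \<in> {0..T}" by (auto simp: s_def algebra_simps)
  have ts: "t = s + of_int k * T" by (simp add: s_def)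
  have "norm (E t) = norm (E s)" using Ei ts by metis
  also have "\<dots> \<le> norm (dphi s x w) + \<bar>s / T\<bar> * norm (D w *\<^sub>R F (phi s x))"
    unfolding E_def using norm_triangle_ineq[of "dphi s x w" "(s / T * D w) *\<^sub>R F (phi s x)"]
    by (simp add: abs_mult mult.assoc)
  also have "\<dots> \<le> exp B * norm w + 1 * (exp B * (1 + exp B) * norm w)"
    using one[OF s] two[OF s] s x(3) by (intro add_mono mult_mono) auto
  finally show "norm (dphi t x w + (t / T * D w) *\<^sub>R F (phi t x)) \<le> exp B * (2 + exp B) * norm w"
    by (simp add: E_def algebra_simps)
  have shift: "phi (s + real n * T) x = phi s x" for s n
  proof (induction n)
    case (Suc n)
    then show ?case using phi_periodic_shift(1)[OF x(2), of "s + real n * T"] by (simp add: algebra_simps)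
  qed simp
  have "phi t x = phi s x"
  proof (cases "k \<ge> 0")
    case True then show ?thesis using shift[of s "nat k"] ts by simp
  next
    case False then show ?thesis using shift[of t "nat (- k)"] ts by simp
  qed
  then show "norm (D w *\<^sub>R F (phi t x)) \<le> exp B * (1 + exp B) * norm w" using two[OF s] by simp
qed

end

section \<open>Planar Hamiltonian flows\<close>

text \<open>Rotation by a right angle, so that a Hamiltonian field is \<open>perp\<close> of the
  gradient of its stream function.\<close>

definition perp :: "real^2 \<Rightarrow> real^2" where
  "perp v = vector [v $ 2, - (v $ 1)]"

lemma perp_nth [simp]: "perp v $ 1 = v $ 2" "perp v $ 2 = - (v $ 1)"
  by (simp_all add: perp_def)

lemma inner_real2: "(v::real^2) \<bullet> w = v $ 1 * w $ 1 + v $ 2 * w $ 2"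
  by (simp add: inner_vec_def sum_2)

lemma norm_perp [simp]: "norm (perp v) = norm v"
  by (simp add: norm_eq_sqrt_inner inner_real2 algebra_simps)

lemma linear_perp: "linear perp"
  by (rule linearI) (simp_all add: vec_eq_iff forall_2)

lemma bounded_linear_perp: "bounded_linear perp"
  using linear_perp by (rule linear_conv_bounded_linear[THEN iffD1])

lemma perp_diff: "perp v - perp w = perp (v - w)"
  by (simp add: linear_diff[OF linear_perp])

lemma perp_eq_0_iff [simp]: "perp v = 0 \<longleftrightarrow> v = 0"
  by (metis norm_eq_zero norm_perp)

lemma inner_perp_self [simp]: "v \<bullet> perp v = 0" "perp v \<bullet> v = 0"
  by (simp_all add: inner_real2)

lemma orthogonal_perp_decomp: "(g \<bullet> g) *\<^sub>R v = (v \<bullet> g) *\<^sub>R g + (v \<bullet> perp g) *\<^sub>R perp g"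
  by (simp add: vec_eq_iff forall_2 inner_real2 algebra_simps)

lemma orthonormal_decomp:
  fixes e1 e2 :: "real^2"
  assumes "norm e1 = 1" "norm e2 = 1" "e1 \<bullet> e2 = 0"
  shows "v = (v \<bullet> e1) *\<^sub>R e1 + (v \<bullet> e2) *\<^sub>R e2"
proof -
  have 1: "e1 \<bullet> e1 = 1" "e2 \<bullet> e2 = 1" using assms by (simp_all add: norm_eq_1)
  define w where "w = v - (v \<bullet> e1) *\<^sub>R e1 - (v \<bullet> e2) *\<^sub>R e2"
  have w: "w \<bullet> e1 = 0" "w \<bullet> e2 = 0"
    using 1 assms(3) by (simp_all add: w_def inner_diff_left inner_commute[of e2 e1])
  define D where "D = e1 $ 1 * e2 $ 2 - e1 $ 2 * e2 $ 1"
  have "D * D = (e1 \<bullet> e1) * (e2 \<bullet> e2) - (e1 \<bullet> e2) * (e1 \<bullet> e2)"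
    by (simp add: inner_real2 D_def algebra_simps)
  then have "D \<noteq> 0" using 1 assms(3) by auto
  moreover have "w $ 1 * D = (w \<bullet> e1) * e2 $ 2 - (w \<bullet> e2) * e1 $ 2"
    "w $ 2 * D = (w \<bullet> e2) * e1 $ 1 - (w \<bullet> e1) * e2 $ 1"
    by (simp_all add: inner_real2 D_def algebra_simps)
  ultimately have "w = 0" using w by (simp add: vec_eq_iff forall_2)
  then show ?thesis by (simp add: w_def algebra_simps)
qed

lemma gradient_inner:
  fixes f :: "real^'n \<Rightarrow> real"
  assumes "linear (frechet_derivative f net)"
  shows "gradient f net \<bullet> v = frechet_derivative f net v"
proof -
  have "frechet_derivative f net v = frechet_derivative f net (\<Sum>i\<in>UNIV. v $ i *\<^sub>R axis i 1)"
    by (simp add: basis_expansion flip: scalar_mult_eq_scaleR)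
  also have "\<dots> = (\<Sum>i\<in>UNIV. v $ i * frechet_derivative f net (axis i 1))"
    by (simp add: linear_sum[OF assms] linear_cmul[OF assms])
  finally show ?thesis by (simp add: gradient_def inner_vec_def mult.commute)
qed

lemma has_derivative_gradient:
  fixes f :: "real^'n \<Rightarrow> real"
  assumes "f differentiable net"
  shows "(f has_derivative (\<lambda>v. gradient f net \<bullet> v)) net"
proof -
  have "(f has_derivative frechet_derivative f net) net"
    using assms frechet_derivative_works by blast
  then show ?thesis
    using gradient_inner[of f net] has_derivative_linear by (metis (no_types, lifting) ext)
qed

lemma gradient_mvt:
  fixes f :: "real^'n \<Rightarrow> real"
  assumes "\<And>x. x \<in> closed_segment a b \<Longrightarrow> f differentiable at x"
  obtains c where "c \<in> closed_segment a b" "f b - f a = gradient f (at c) \<bullet> (b - a)"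
proof -
  define p where "p s = a + s *\<^sub>R (b - a)" for s :: real
  have seg: "p s \<in> closed_segment a b" if "0 \<le> s" "s \<le> 1" for s
    using that unfolding p_def closed_segment_def
    by (intro CollectI exI[of _ s]) (simp add: algebra_simps)
  have p: "(p has_derivative (\<lambda>h. h *\<^sub>R (b - a))) (at s within {0..1})" for s
    unfolding p_def by (auto intro!: derivative_eq_intros)
  have "((\<lambda>s. f (p s)) has_derivative (\<lambda>h. gradient f (at (p s)) \<bullet> (h *\<^sub>R (b - a)))) (at s within {0..1})"
    if "0 \<le> s" "s \<le> 1" for s
    using has_derivative_compose[OF p has_derivative_gradient[OF assms[OF seg[OF that]]]] .
  from mvt_very_simple[OF zero_le_one this]
  obtain s where "s \<in> {0..1}" "f (p 1) - f (p 0) = gradient f (at (p s)) \<bullet> (b - a)" by auto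
  then show ?thesis using that[of "p s"] seg by (simp add: p_def)
qed

section \<open>Lipschitz charts and derivatives up to the boundary\<close>

lemma chart_frontier_graph:
  assumes chart: "lipschitz_chart \<Omega> p e1 e2 r \<gamma>" and p: "p \<in> frontier \<Omega>" and "open \<Omega>"
  shows "\<gamma> 0 = 0"
    and "p + u *\<^sub>R e1 + \<gamma> u *\<^sub>R e2 \<in> ball p r \<Longrightarrow> p + u *\<^sub>R e1 + \<gamma> u *\<^sub>R e2 \<in> frontier \<Omega>"
proof -
  have e: "e1 \<bullet> e1 = 1" "e2 \<bullet> e2 = 1" "e1 \<bullet> e2 = 0" "e2 \<bullet> e1 = 0" "norm e1 = 1" "norm e2 = 1" "r > 0"
    using chart by (auto simp: lipschitz_chart_def norm_eq_1 inner_commute)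
  obtain l where l: "l-lipschitz_on UNIV \<gamma>" using chart by (auto simp: lipschitz_chart_def)
  then have l0: "l \<ge> 0" and l': "\<bar>\<gamma> a - \<gamma> b\<bar> \<le> l * \<bar>a - b\<bar>" for a b
    by (auto simp: lipschitz_on_def dist_real_def)
  have mem: "x \<in> \<Omega> \<longleftrightarrow> (x - p) \<bullet> e2 > \<gamma> ((x - p) \<bullet> e1)" if "x \<in> ball p r" for x
  proof -
    have "\<Omega> \<inter> ball p r = {x \<in> ball p r. (x - p) \<bullet> e2 > \<gamma> ((x - p) \<bullet> e1)}"
      using chart by (simp add: lipschitz_chart_def)
    then show ?thesis using that by blast
  qed
  have pc: "p \<in> closure \<Omega>" "p \<notin> \<Omega>" using p \<open>open \<Omega>\<close> by (auto simp: frontier_def interior_open)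
  \<comment> \<open>A chart describes \<open>\<Omega>\<close> only inside a ball. That its graph
    passes through \<open>p\<close> follows since \<open>p \<notin> \<Omega>\<close> while points of
    \<open>\<Omega>\<close> accumulate at \<open>p\<close>.\<close>
  show \<gamma>0: "\<gamma> 0 = 0"
  proof (rule antisym)
    show "\<gamma> 0 \<ge> 0" using mem[of p] pc e by auto
    show "\<gamma> 0 \<le> 0"
    proof (rule field_le_epsilon)
      fix d :: real assume "d > 0"
      then have "min r (d / (1 + l)) > 0" using e l0 by auto
      then obtain x where x: "x \<in> \<Omega>" "dist x p < min r (d / (1 + l))"
        using pc(1) unfolding closure_approachable by blast
      have "\<gamma> ((x - p) \<bullet> e1) < (x - p) \<bullet> e2"
        using mem[of x] x by (simp add: dist_commute)
      moreover have "\<bar>(x - p) \<bullet> e2\<bar> \<le> dist x p" "\<bar>(x - p) \<bullet> e1\<bar> \<le> dist x p"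
        using Cauchy_Schwarz_ineq2[of "x - p" e2] Cauchy_Schwarz_ineq2[of "x - p" e1] e
        by (simp_all add: dist_norm)
      moreover have "l * \<bar>(x - p) \<bullet> e1\<bar> \<le> l * dist x p"
        using calculation l0 by (intro mult_left_mono)
      ultimately have "\<gamma> 0 \<le> (1 + l) * dist x p"
        using l'[of 0 "(x - p) \<bullet> e1"] by (simp add: distrib_right)
      also have "(1 + l) * dist x p \<le> d"
        using x l0 by (simp add: pos_less_divide_eq mult.commute)
      finally show "\<gamma> 0 \<le> 0 + d" by simp
    qed
  qed
  assume in_ball: "p + u *\<^sub>R e1 + \<gamma> u *\<^sub>R e2 \<in> ball p r"
  let ?g = "p + u *\<^sub>R e1 + \<gamma> u *\<^sub>R e2"
  have "?g \<notin> \<Omega>" using mem[OF in_ball] e by (simp add: inner_add_left)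
  \<comment> \<open>A small shift along \<open>e2\<close> moves a graph point into
    \<open>\<Omega>\<close>.\<close>
  moreover have "?g \<in> closure \<Omega>"
    unfolding closure_approachable
  proof (intro allI impI)
    fix d :: real assume "d > 0"
    define s where "s = min d (r - dist p ?g) / 2"
    have s: "s > 0" "s < d" "s < r - dist p ?g" using \<open>d > 0\<close> in_ball by (auto simp: s_def)
    have "dist p (?g + s *\<^sub>R e2) < r"
      using s e dist_triangle[of p "?g + s *\<^sub>R e2" ?g] by (simp add: dist_norm)
    then have "?g + s *\<^sub>R e2 \<in> \<Omega>"
      using mem[of "?g + s *\<^sub>R e2"] e s by (simp add: inner_add_left)
    moreover have "dist (?g + s *\<^sub>R e2) ?g < d" using s e by (simp add: dist_norm)
    ultimately show "\<exists>y\<in>\<Omega>. dist y ?g < d" by blast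
  qed
  ultimately show "?g \<in> frontier \<Omega>" using \<open>open \<Omega>\<close> by (simp add: frontier_def interior_open)
qed

text \<open>A linear map that is small compared with the distance along a ray vanishes, by
  homogeneity, on the direction of that ray.\<close>

lemma has_derivative_within_ray_unique:
  fixes f :: "'a::real_normed_vector \<Rightarrow> 'b::real_normed_vector"
  assumes f: "(f has_derivative A) (at x within S)" "(f has_derivative B) (at x within S)"
    and "d > 0" and ray: "\<And>s. 0 < s \<Longrightarrow> s < d \<Longrightarrow> x + s *\<^sub>R v \<in> S"
  shows "A v = B v"
proof (cases "v = 0")
  case True
  then show ?thesis using f has_derivative_linear linear_0 by metis
next
  case False
  have h: "((\<lambda>_. 0) has_derivative (\<lambda>w. A w - B w)) (at x within S)"
    using has_derivative_diff[OF f] by simp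
  have lin: "linear (\<lambda>w. A w - B w)" using h has_derivative_linear by blast
  have "norm (A v - B v) \<le> 0 + e" if "e > 0" for e
  proof -
    have "e / norm v > 0" using that False by simp
    then obtain \<delta> where \<delta>: "\<delta> > 0" "\<And>y. y \<in> S \<Longrightarrow> norm (y - x) < \<delta> \<Longrightarrow>
        norm (A (y - x) - B (y - x)) \<le> e / norm v * norm (y - x)"
      using h unfolding has_derivative_within_alt by (auto simp: norm_minus_commute)
    define c where "c = \<delta> / norm v"
    have c: "c > 0" "c * norm v = \<delta>" using \<delta> False by (simp_all add: c_def)
    define s where "s = min d c / 2"
    have s: "s > 0" "s < d" "s < c" using \<open>d > 0\<close> c by (auto simp: s_def min_def)
    then have "s * norm v < c * norm v" using False by simp
    then have s_v: "s * norm v < \<delta>" using c by simp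
    have "norm (A (s *\<^sub>R v) - B (s *\<^sub>R v)) \<le> e / norm v * norm (s *\<^sub>R v)"
      using \<delta>(2)[of "x + s *\<^sub>R v"] ray[OF s(1,2)] s s_v by simp
    also have "A (s *\<^sub>R v) - B (s *\<^sub>R v) = s *\<^sub>R (A v - B v)"
      using linear_cmul[OF lin] by simp
    finally show ?thesis using s False by simp
  qed
  then show ?thesis using field_le_epsilon[of "norm (A v - B v)" 0] by auto
qed

text \<open>At a boundary point, the directions \<open>e2\<close> and \<open>e2 + c *\<^sub>R e1\<close> of a chart point into \<open>\<Omega>\<close> for
  small \<open>c\<close>.\<close>

lemma has_derivative_within_closure_unique:
  fixes f :: "real^2 \<Rightarrow> 'b::real_normed_vector"
  assumes dom: "bounded_lipschitz_domain \<Omega>" and x: "x \<in> closure \<Omega>"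
    and f: "(f has_derivative A) (at x within closure \<Omega>)" "(f has_derivative B) (at x within closure \<Omega>)"
  shows "A = B"
proof (cases "x \<in> \<Omega>")
  case True
  have "open \<Omega>" using dom by (simp add: bounded_lipschitz_domain_def)
  then have "x \<in> interior (closure \<Omega>)"
    using True by (meson closure_subset interior_maximal subsetD)
  then show ?thesis using f has_derivative_unique by (metis at_within_interior)
next
  case False
  have "open \<Omega>" using dom by (simp add: bounded_lipschitz_domain_def)
  then have fr: "x \<in> frontier \<Omega>" using False x by (simp add: frontier_def interior_open)
  then obtain e1 e2 r \<gamma> where chart: "lipschitz_chart \<Omega> x e1 e2 r \<gamma>"
    using dom unfolding bounded_lipschitz_domain_def by blast
  then have e: "e1 \<bullet> e1 = 1" "e2 \<bullet> e2 = 1" "e1 \<bullet> e2 = 0" "e2 \<bullet> e1 = 0" "norm e1 = 1" "norm e2 = 1" "r > 0"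
    by (auto simp: lipschitz_chart_def norm_eq_1 inner_commute)
  obtain l where l: "l-lipschitz_on UNIV \<gamma>" using chart by (auto simp: lipschitz_chart_def)
  then have l0: "l \<ge> 0" and l': "\<bar>\<gamma> a - \<gamma> b\<bar> \<le> l * \<bar>a - b\<bar>" for a b
    by (auto simp: lipschitz_on_def dist_real_def)
  \<comment> \<open>The slope condition \<open>l * \<bar>c\<bar> < 1\<close> keeps the ray strictly
    above the graph.\<close>
  have dir: "A (e2 + c *\<^sub>R e1) = B (e2 + c *\<^sub>R e1)" if "l * \<bar>c\<bar> < 1" for c
  proof (rule has_derivative_within_ray_unique[OF f])
    let ?v = "e2 + c *\<^sub>R e1"
    have v: "norm ?v \<le> 1 + \<bar>c\<bar>" using norm_triangle_ineq[of e2 "c *\<^sub>R e1"] e by simp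
    show "r / (1 + \<bar>c\<bar>) > 0" using e by (simp add: add_pos_nonneg)
    fix s :: real assume s: "0 < s" "s < r / (1 + \<bar>c\<bar>)"
    have "norm (s *\<^sub>R ?v) \<le> s * (1 + \<bar>c\<bar>)" using v s by simp
    also have "\<dots> < r" using s by (simp add: field_simps)
    finally have inb: "x + s *\<^sub>R ?v \<in> ball x r" by (simp add: dist_norm)
    have "\<gamma> (s * c) \<le> l * (s * \<bar>c\<bar>)"
      using l'[of "s * c" 0] chart_frontier_graph(1)[OF chart fr \<open>open \<Omega>\<close>] s by (simp add: abs_mult)
    also have "\<dots> < s" using that s by (simp add: mult.left_commute)
    finally have "x + s *\<^sub>R ?v \<in> {y \<in> ball x r. (y - x) \<bullet> e2 > \<gamma> ((y - x) \<bullet> e1)}"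
      using inb e by (simp add: inner_add_left)
    then have "x + s *\<^sub>R ?v \<in> \<Omega>" using chart unfolding lipschitz_chart_def by blast
    then show "x + s *\<^sub>R ?v \<in> closure \<Omega>" using closure_subset by blast
  qed
  define c where "c = 1 / (2 * (l + 1))"
  have c: "c > 0" "l * \<bar>c\<bar> < 1" using l0 by (auto simp: c_def field_simps)
  have linA: "linear A" and linB: "linear B" using f has_derivative_linear by auto
  have 2: "A e2 = B e2" using dir[of 0] by simp
  then have "c *\<^sub>R A e1 = c *\<^sub>R B e1"
    using dir[OF c(2)] linA linB by (simp add: linear_add linear_cmul)
  then have 1: "A e1 = B e1" using c by simp
  show ?thesis
  proof
    fix w
    obtain a b where "w = a *\<^sub>R e1 + b *\<^sub>R e2" using orthonormal_decomp e by blast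
    then show "A w = B w" using 1 2 linA linB by (simp add: linear_add linear_cmul)
  qed
qed

text \<open>\<open>frechet_derivative\<close> picks some derivative; uniqueness within
  \<open>closure \<Omega>\<close> identifies it with one found by other means.\<close>

lemma gradient_within_closure:
  assumes dom: "bounded_lipschitz_domain \<Omega>" and x: "x \<in> closure \<Omega>"
    and f: "(f has_derivative A) (at x within closure \<Omega>)"
  shows "gradient f (at x within closure \<Omega>) \<bullet> w = A w"
proof -
  have "(f has_derivative frechet_derivative f (at x within closure \<Omega>)) (at x within closure \<Omega>)"
    using f frechet_derivative_works differentiable_def by blast
  then have "frechet_derivative f (at x within closure \<Omega>) = A"
    by (rule has_derivative_within_closure_unique[OF dom x _ f])
  with f gradient_inner[of f "at x within closure \<Omega>" w] show ?thesis
    by (simp add: has_derivative_linear)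
qed

lemma jacobian_within_closure:
  fixes f :: "real^2 \<Rightarrow> real^'n"
  assumes dom: "bounded_lipschitz_domain \<Omega>" and x: "x \<in> closure \<Omega>"
    and f: "(f has_derivative A) (at x within closure \<Omega>)"
  shows "jacobian f (at x within closure \<Omega>) *v w = A w"
proof -
  have "(f has_derivative (\<lambda>h. jacobian f (at x within closure \<Omega>) *v h)) (at x within closure \<Omega>)"
    using f jacobian_works differentiable_def by blast
  from has_derivative_within_closure_unique[OF dom x this f] show ?thesis by meson
qed

text \<open>The Hamiltonian field \<open>perp (gradient H)\<close> need not be globally Lipschitz, so \<open>F\<close> agrees with it only
  on a ball containing \<open>closure \<Omega>\<close>.\<close>

locale planar_flow = lipschitz_field F L for F :: "real^2 \<Rightarrow> real^2" and L +
  fixes \<Omega> :: "(real^2) set" and H :: "real^2 \<Rightarrow> real" and R :: real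
    and A :: "real^2 \<Rightarrow> ((real^2) \<Rightarrow>\<^sub>L (real^2))"
  assumes dom: "bounded_lipschitz_domain \<Omega>"
    and sub: "closure \<Omega> \<subseteq> ball 0 R"
    and C2: "C2_on UNIV H"
    and F_eq: "x \<in> ball 0 R \<Longrightarrow> F x = perp (gradient H (at x))"
    and F_der: "x \<in> ball 0 R \<Longrightarrow> (F has_derivative blinfun_apply (A x)) (at x)"
    and A_cont: "continuous_on (ball 0 R) A"
    and H_frontier: "x \<in> frontier \<Omega> \<Longrightarrow> H x = 0"
begin

abbreviation grad :: "real^2 \<Rightarrow> real^2" where
  "grad x \<equiv> gradient H (at x)"

lemma open_dom: "open \<Omega>"
  using dom by (simp add: bounded_lipschitz_domain_def)

lemma closure_ball: "x \<in> closure \<Omega> \<Longrightarrow> x \<in> ball 0 R"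
  using sub by blast

lemma H_differentiable: "H differentiable at x"
  using C2 unfolding C2_on_def C1_on_def differentiable_def by blast

lemmas H_deriv = has_derivative_gradient[OF H_differentiable]

lemma grad_cont: "continuous_on S grad"
proof -
  have "C1_on UNIV grad" using C2 by (simp add: C2_on_def)
  then show ?thesis unfolding C1_on_def
    by (metis UNIV_I continuous_at_imp_continuous_on has_derivative_continuous)
qed

lemma H_phi_deriv:
  assumes "phi t x \<in> ball 0 R"
  shows "((\<lambda>t. H (phi t x)) has_real_derivative 0) (at t)"
proof -
  have "((\<lambda>t. H (phi t x)) has_derivative (\<lambda>h. grad (phi t x) \<bullet> (h *\<^sub>R F (phi t x)))) (at t)"
    using has_derivative_compose[OF phi_deriv[unfolded has_vector_derivative_def] H_deriv] .
  moreover have "(\<lambda>h. grad (phi t x) \<bullet> (h *\<^sub>R F (phi t x))) = (*) 0"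
    using F_eq[OF assms] by auto
  ultimately show ?thesis unfolding has_field_derivative_def by simp
qed

lemma phi_near:
  assumes "d > 0" obtains e where "e > 0" "\<And>t. \<bar>t\<bar> < e \<Longrightarrow> norm (phi t x - x) < d"
proof -
  have "isCont (\<lambda>t. phi t x) 0" using phi_cont[of UNIV] by (simp add: continuous_on_eq_continuous_at)
  then obtain e where "e > 0" "\<And>t. dist t 0 < e \<Longrightarrow> dist (phi t x) (phi 0 x) < d"
    unfolding continuous_at_eps_delta using assms by (metis dist_commute)
  then show ?thesis using that[of e] by (simp add: dist_norm)
qed

text \<open>Conservation for short times only: that orbits remain in the ball where \<open>F\<close>
  is Hamiltonian is not known yet, and its proof relies on this lemma.\<close>

lemma H_phi_local:
  assumes "x \<in> ball 0 R"
  obtains e where "e > 0" "\<And>t. \<bar>t\<bar> < e \<Longrightarrow> H (phi t x) = H x"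
proof -
  obtain d where d: "d > 0" "ball x d \<subseteq> ball 0 R" using assms open_ball openE by blast
  obtain e where e: "e > 0" "\<And>t. \<bar>t\<bar> < e \<Longrightarrow> norm (phi t x - x) < d" using phi_near[OF d(1)] by blast
  have "H (phi t x) = H x" if "\<bar>t\<bar> < e" for t
  proof -
    have "((\<lambda>t. H (phi t x)) has_real_derivative 0) (at s within {- e<..<e})" if "s \<in> {- e<..<e}" for s
    proof -
      have "phi s x \<in> ball x d"
        using e(2)[of s] that by (auto simp: dist_norm norm_minus_commute)
      then have "phi s x \<in> ball 0 R" using d(2) by blast
      then show ?thesis using H_phi_deriv has_field_derivative_at_within by blast
    qed
    then obtain c where "\<And>s. s \<in> {- e<..<e} \<Longrightarrow> H (phi s x) = c"
      using has_field_derivative_zero_constant[of "{- e<..<e}" "\<lambda>t. H (phi t x)"] convex_real_interval(8) by metis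
    from this[of t] this[of 0] show ?thesis using that e(1) by (simp add: abs_less_iff)
  qed
  then show ?thesis using that e by blast
qed

text \<open>The last condition makes \<open>a - b\<close> parallel to \<open>grad p\<close>, and
  near \<open>p\<close> the function \<open>H\<close> is strictly monotone in that direction. This
  takes the place of the implicit function theorem for level sets.\<close>

lemma level_set_rigid:
  assumes "grad p \<noteq> 0"
  obtains \<rho> where "\<rho> > 0"
    "\<And>a b. norm (a - p) < \<rho> \<Longrightarrow> norm (b - p) < \<rho> \<Longrightarrow> H a = H b \<Longrightarrow> (a - b) \<bullet> perp (grad p) = 0 \<Longrightarrow> a = b"
proof -
  have "isCont grad p" using grad_cont[of UNIV] by (simp add: continuous_on_eq_continuous_at)
  then have "isCont (\<lambda>x. grad x \<bullet> grad p) p" by (intro continuous_intros)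
  moreover have "grad p \<bullet> grad p > 0" using assms by simp
  ultimately have "\<forall>\<^sub>F x in nhds p. grad x \<bullet> grad p > 0"
    unfolding isCont_def
    using order_tendstoD(1) tendsto_at_iff_tendsto_nhds by blast
  then obtain \<rho> where \<rho>: "\<rho> > 0" "\<And>x. dist x p < \<rho> \<Longrightarrow> grad x \<bullet> grad p > 0"
    unfolding eventually_nhds_metric by blast
  show ?thesis
  proof (rule that[OF \<rho>(1)])
    fix a b assume ab: "norm (a - p) < \<rho>" "norm (b - p) < \<rho>" "H a = H b" "(a - b) \<bullet> perp (grad p) = 0"
    obtain c where c: "c \<in> closed_segment b a" "H a - H b = grad c \<bullet> (a - b)"
      using gradient_mvt[of b a H] H_differentiable by blast
    have "closed_segment b a \<subseteq> ball p \<rho>"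
      using ab by (intro closed_segment_subset) (auto simp: dist_norm norm_minus_commute)
    then have "grad c \<bullet> grad p > 0" using c \<rho>(2)[of c] by (auto simp: dist_commute)
    moreover have "(grad p \<bullet> grad p) *\<^sub>R (a - b) = ((a - b) \<bullet> grad p) *\<^sub>R grad p"
      using orthogonal_perp_decomp[of "grad p" "a - b"] ab(4) by simp
    moreover from this have "((a - b) \<bullet> grad p) * (grad c \<bullet> grad p) = 0"
      using c(2) ab(3) by (metis diff_self inner_scaleR_right mult_zero_right)
    ultimately show "a = b" using assms by auto
  qed
qed

text \<open>Both the boundary graph and the orbit of \<open>p\<close> lie in \<open>{H = 0}\<close>, so they agree as soon as they have
  the same component along \<open>F p\<close>; by the intermediate value theorem the graph attains all small values
  of this component.\<close>

lemma frontier_invariant_local: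
  assumes p: "p \<in> frontier \<Omega>"
  obtains e where "e > 0" "\<And>t. \<bar>t\<bar> < e \<Longrightarrow> phi t p \<in> frontier \<Omega>"
proof (cases "grad p = 0")
  case True
  have "p \<in> ball 0 R" using p closure_ball by (auto simp: frontier_def)
  then have "F p = 0" using F_eq True by simp
  then show ?thesis using that[of 1] phi_equilibrium p by simp
next
  case False
  have pR: "p \<in> ball 0 R" using p closure_ball by (auto simp: frontier_def)
  have Fp: "F p = perp (grad p)" using F_eq pR by simp
  obtain \<rho> where \<rho>: "\<rho> > 0" "\<And>a b. norm (a - p) < \<rho> \<Longrightarrow> norm (b - p) < \<rho> \<Longrightarrow> H a = H b \<Longrightarrow>
      (a - b) \<bullet> F p = 0 \<Longrightarrow> a = b"
    using level_set_rigid[OF False] Fp by metis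
  obtain e1 e2 r \<gamma> where chart: "lipschitz_chart \<Omega> p e1 e2 r \<gamma>"
    using dom p unfolding bounded_lipschitz_domain_def by blast
  then have e: "e1 \<bullet> e1 = 1" "norm e1 = 1" "norm e2 = 1" "e2 \<bullet> e1 = 0" "r > 0"
    by (auto simp: lipschitz_chart_def norm_eq_1 inner_commute)
  obtain l where l: "l-lipschitz_on UNIV \<gamma>" using chart by (auto simp: lipschitz_chart_def)
  then have \<gamma>_cont: "continuous_on S \<gamma>" for S
    using lipschitz_on_continuous_on lipschitz_on_subset by blast
  have l0: "l \<ge> 0" and l': "\<bar>\<gamma> a - \<gamma> b\<bar> \<le> l * \<bar>a - b\<bar>" for a b
    using l by (auto simp: lipschitz_on_def dist_real_def)
  define g where "g u = p + u *\<^sub>R e1 + \<gamma> u *\<^sub>R e2" for u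
  note graph = chart_frontier_graph[OF chart p open_dom]
  \<comment> \<open>With the slope bound \<open>l\<close>, the graph over \<open>{- h..h}\<close>
    stays inside both the chart ball and the ball of rigidity.\<close>
  define h where "h = min r \<rho> / (2 * (1 + l))"
  have h: "h > 0" using e \<rho> l0 by (simp add: h_def)
  have g_near: "norm (g u - p) < min r \<rho>" if "\<bar>u\<bar> \<le> h" for u
  proof -
    have "norm (g u - p) \<le> \<bar>u\<bar> + \<bar>\<gamma> u\<bar>"
      using norm_triangle_ineq[of "u *\<^sub>R e1" "\<gamma> u *\<^sub>R e2"] e by (simp add: g_def add.assoc)
    also have "\<dots> \<le> (1 + l) * \<bar>u\<bar>" using l'[of u 0] graph(1) by (simp add: algebra_simps)
    also have "\<dots> \<le> (1 + l) * h" using that l0 by (intro mult_left_mono) auto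
    also have "\<dots> = min r \<rho> / 2" using l0 by (simp add: h_def divide_simps)
    also have "\<dots> < min r \<rho>" using e(5) \<rho>(1) by (simp add: min_def)
    finally show ?thesis .
  qed
  have g_fr: "g u \<in> frontier \<Omega>" if "\<bar>u\<bar> \<le> h" for u
  proof -
    have "g u \<in> ball p r" using g_near[OF that] by (simp add: dist_norm norm_minus_commute)
    then show ?thesis using graph(2)[of u] by (simp add: g_def)
  qed
  have g_inj: "inj g"
  proof (rule injI)
    fix u v assume "g u = g v"
    then have "(g u - p) \<bullet> e1 = (g v - p) \<bullet> e1" by simp
    then show "u = v" using e by (simp add: g_def inner_add_left)
  qed
  define q where "q u = (g u - p) \<bullet> F p" for u
  have q_cont: "continuous_on S q" for S
    unfolding q_def g_def by (intro continuous_intros \<gamma>_cont)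
  have q_inj: "inj_on q {- h..h}"
  proof (rule inj_onI)
    fix u v assume uv: "u \<in> {- h..h}" "v \<in> {- h..h}" "q u = q v"
    have "g u = g v"
    proof (rule \<rho>(2))
      show "norm (g u - p) < \<rho>" "norm (g v - p) < \<rho>" using uv g_near by (auto simp: abs_le_iff)
      show "H (g u) = H (g v)"
        using uv H_frontier[OF g_fr[of u]] H_frontier[OF g_fr[of v]] by (auto simp: abs_le_iff)
      show "(g u - g v) \<bullet> F p = 0" using uv(3) by (simp add: q_def inner_diff_left)
    qed
    then show "u = v" using g_inj by (simp add: injD)
  qed
  have q0: "q 0 = 0" using graph(1) by (simp add: q_def g_def)
  \<comment> \<open>A continuous injective function on an interval is strictly monotone, so
    \<open>q\<close> changes sign at 0 and its range contains a neighbourhood of 0.\<close>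
  have sides: "(q (- h) < 0 \<and> 0 < q h) \<or> (q h < 0 \<and> 0 < q (- h))"
    using continuous_inj_imp_mono[of "- h" 0 h q] q_cont q_inj q0 h by simp
  define d where "d = min \<bar>q h\<bar> \<bar>q (- h)\<bar>"
  have d: "d > 0" using sides by (auto simp: d_def)
  have hit: "\<exists>u. \<bar>u\<bar> \<le> h \<and> q u = y" if "\<bar>y\<bar> < d" for y
  proof -
    from sides consider "q (- h) \<le> y" "y \<le> q h" | "q h \<le> y" "y \<le> q (- h)"
      using \<open>\<bar>y\<bar> < d\<close> by (auto simp: d_def abs_less_iff)
    then show ?thesis
    proof cases
      case 1 then show ?thesis using IVT'[of q "- h" y h] q_cont h by (auto simp: abs_le_iff)
    next
      case 2 then show ?thesis using IVT2'[of q h y "- h"] q_cont h by (auto simp: abs_le_iff)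
    qed
  qed
  have nFp: "norm (F p) > 0" using False Fp by simp
  obtain t1 where t1: "t1 > 0" "\<And>t. \<bar>t\<bar> < t1 \<Longrightarrow> norm (phi t p - p) < min \<rho> (d / norm (F p))"
    using phi_near[of "min \<rho> (d / norm (F p))"] \<rho> d nFp by auto
  obtain t2 where t2: "t2 > 0" "\<And>t. \<bar>t\<bar> < t2 \<Longrightarrow> H (phi t p) = H p" using H_phi_local[OF pR] by blast
  show ?thesis
  proof (rule that[of "min t1 t2"])
    fix t assume t: "\<bar>t\<bar> < min t1 t2"
    have n: "norm (phi t p - p) < \<rho>" "norm (phi t p - p) < d / norm (F p)" using t1(2)[of t] t by auto
    have "\<bar>(phi t p - p) \<bullet> F p\<bar> \<le> norm (phi t p - p) * norm (F p)" by (rule Cauchy_Schwarz_ineq2)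
    also have "\<dots> < d" using n(2) nFp by (simp add: field_simps)
    finally obtain u where u: "\<bar>u\<bar> \<le> h" "q u = (phi t p - p) \<bullet> F p" using hit by blast
    have "phi t p = g u"
    proof (rule \<rho>(2)[OF n(1)])
      show "norm (g u - p) < \<rho>" using g_near[OF u(1)] by simp
      show "H (phi t p) = H (g u)" using t2(2)[of t] t H_frontier[OF p] H_frontier[OF g_fr[OF u(1)]] by simp
      show "(phi t p - g u) \<bullet> F p = 0" using u(2) by (simp add: q_def inner_diff_left)
    qed
    then show "phi t p \<in> frontier \<Omega>" using g_fr[OF u(1)] by simp
  qed (use t1 t2 in auto)
qed

text \<open>The set of times spent in \<open>closure \<Omega>\<close> is closed; it is open because
  of the interior case and the local invariance of the frontier. Hence it is the whole line.\<close>

lemma phi_in_closure: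
  assumes "x \<in> closure \<Omega>" shows "phi t x \<in> closure \<Omega>"
proof -
  define S where "S = {t. phi t x \<in> closure \<Omega>}"
  have "closed S" unfolding S_def
    using continuous_closed_vimage[of "closure \<Omega>" "\<lambda>t. phi t x"] phi_cont[of UNIV]
    by (simp add: vimage_def continuous_on_eq_continuous_at)
  moreover have "open S"
    unfolding open_dist
  proof
    fix t assume "t \<in> S"
    then have pc: "phi t x \<in> closure \<Omega>" by (simp add: S_def)
    obtain e where e: "e > 0" "\<And>s. \<bar>s\<bar> < e \<Longrightarrow> phi s (phi t x) \<in> closure \<Omega>"
    proof (cases "phi t x \<in> \<Omega>")
      case True
      then obtain d where "d > 0" "ball (phi t x) d \<subseteq> \<Omega>" using open_dom openE by blast
      moreover then obtain e where "e > 0" "\<And>s. \<bar>s\<bar> < e \<Longrightarrow> norm (phi s (phi t x) - phi t x) < d"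
        using phi_near by blast
      moreover have "\<Omega> \<subseteq> closure \<Omega>" by (rule closure_subset)
      ultimately show ?thesis using that[of e]
        by (metis (no_types, lifting) dist_norm dist_commute mem_ball subsetD)
    next
      case False
      then have "phi t x \<in> frontier \<Omega>" using pc open_dom by (simp add: frontier_def interior_open)
      then show ?thesis using frontier_invariant_local that by (metis DiffD1 frontier_def)
    qed
    show "\<exists>e>0. \<forall>s. dist s t < e \<longrightarrow> s \<in> S"
    proof (intro exI[of _ e] conjI allI impI e(1))
      fix s assume "dist s t < e"
      then have "phi (s - t) (phi t x) \<in> closure \<Omega>" using e(2)[of "s - t"] by (simp add: dist_real_def)
      then show "s \<in> S" by (simp add: S_def flip: phi_add)
    qed
  qed
  moreover have "0 \<in> S" using assms by (simp add: S_def)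
  ultimately have "S = UNIV" using clopen[of S] by auto
  then show ?thesis by (auto simp: S_def)
qed

end

sublocale planar_flow \<subseteq> smooth_flow F L "ball 0 R" "closure \<Omega>" A
proof unfold_locales
  show "compact (closure \<Omega>)"
    using dom by (simp add: bounded_lipschitz_domain_def compact_closure)
qed (use sub F_der A_cont phi_in_closure in auto)

context planar_flow begin

lemma H_phi:
  assumes "x \<in> closure \<Omega>" shows "H (phi t x) = H x"
proof -
  have "((\<lambda>t. H (phi t x)) has_real_derivative 0) (at s)" for s
    using assms by (intro H_phi_deriv closure_ball phi_in_closure)
  from DERIV_isconst_all[of "\<lambda>t. H (phi t x)" t 0] this show ?thesis by simp
qed

text \<open>A point and its image under the flow lie on one level set, so rigidity of level sets
  provides the hypothesis \<open>rigid\<close> of the lemmas on closed orbits.\<close>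

lemma return_rigid:
  assumes x0: "x0 \<in> closure \<Omega>" "F x0 \<noteq> 0"
  obtains \<rho> where "\<rho> > 0"
    "\<And>x t. x \<in> closure \<Omega> \<Longrightarrow> norm (x - x0) < \<rho> \<Longrightarrow> norm (phi t x - x0) < \<rho> \<Longrightarrow>
      (phi t x - x) \<bullet> F x0 = 0 \<Longrightarrow> phi t x = x"
proof -
  have F: "F x0 = perp (grad x0)" using F_eq closure_ball x0 by blast
  then have "grad x0 \<noteq> 0" using x0 by auto
  from level_set_rigid[OF this] that show ?thesis using F H_phi by metis
qed

end

section \<open>Identification with the flow and the period of the statement\<close>

locale planar_field = planar_flow F L \<Omega> H R A
  for F :: "real^2 \<Rightarrow> real^2" and L \<Omega> H R A +
  fixes V :: "real^2 \<Rightarrow> real^2"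
  assumes V_eq: "x \<in> closure \<Omega> \<Longrightarrow> V x = F x"
begin

lemma flow_eq:
  assumes "x \<in> closure \<Omega>" shows "flow \<Omega> V t x = phi t x"
proof -
  have "(THE y. trajectory \<Omega> V x y) = (\<lambda>t. phi t x)"
  proof (rule the_equality)
    show "trajectory \<Omega> V x (\<lambda>t. phi t x)"
      unfolding trajectory_def using phi_in_closure[OF assms] phi_deriv V_eq by simp
    fix y assume "trajectory \<Omega> V x y"
    then have "y 0 = x" "\<And>t. (y has_vector_derivative F (y t)) (at t)"
      unfolding trajectory_def using V_eq by (blast, metis)
    then show "y = (\<lambda>t. phi t x)" using solution_unique by blast
  qed
  then show ?thesis by (simp add: flow_def)
qed

lemma flow_jacobian_eq:
  assumes "x \<in> closure \<Omega>" shows "flow_jacobian \<Omega> V t x *v w = dphi t x w"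
proof -
  have "(flow \<Omega> V t has_derivative dphi t x) (at x within closure \<Omega>)"
    by (rule has_derivative_transform[OF assms _ has_derivative_at_withinI[OF dphi[OF assms]]])
      (rule flow_eq)
  then show ?thesis
    unfolding flow_jacobian_def by (rule jacobian_within_closure[OF dom assms])
qed

lemma period_eq:
  assumes "x \<in> closure \<Omega>" "least_period x T" shows "period \<Omega> V x = ereal T"
  unfolding period_def
proof (rule antisym)
  show "Inf {ereal t |t. t > 0 \<and> flow \<Omega> V t x = x} \<le> ereal T"
    using assms by (intro Inf_lower) (auto simp: flow_eq least_period_def)
  show "ereal T \<le> Inf {ereal t |t. t > 0 \<and> flow \<Omega> V t x = x}"
    using assms by (intro Inf_greatest) (auto simp: flow_eq least_period_def)
qed

text \<open>The infimum is infinite exactly when there is no return time. In particular an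
  equilibrium, which returns at all times, is not aperiodic.\<close>

lemma aperiodic_iff:
  assumes "x \<in> closure \<Omega>"
  shows "x \<in> aperiodic_set \<Omega> V \<longleftrightarrow> (\<forall>t>0. phi t x \<noteq> x)"
proof -
  have "period \<Omega> V x = \<infinity> \<longleftrightarrow> {ereal t |t. t > 0 \<and> flow \<Omega> V t x = x} \<subseteq> {\<infinity>}"
    unfolding period_def by (simp add: Inf_top_conv[where 'a=ereal, unfolded top_ereal_def] subset_iff)
  also have "\<dots> \<longleftrightarrow> (\<forall>t>0. phi t x \<noteq> x)" using flow_eq[OF assms] by auto
  finally show ?thesis using assms by (simp add: aperiodic_set_def)
qed

lemma periodic_least_period:
  assumes "x \<in> closure \<Omega>" "x \<notin> aperiodic_set \<Omega> V" "F x \<noteq> 0"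
  obtains T where "least_period x T"
  using assms aperiodic_iff least_period_exists by metis

text \<open>Near \<open>x0\<close> the least period is a return time that is continuous at
  \<open>x0\<close>. It is therefore differentiable there, and its derivative is the
  \<open>D\<close> of the first identity; the logarithm divides it by \<open>T\<close>.\<close>

lemma grad_ln_period_eq:
  assumes x0: "x0 \<in> closure \<Omega>" "F x0 \<noteq> 0" "least_period x0 T"
  obtains D where "\<And>w. dphi T x0 w = w - D w *\<^sub>R F x0"
    "\<And>w. w \<bullet> grad_ln_period \<Omega> V x0 = D w / T"
proof -
  have T: "T > 0" "phi T x0 = x0" using x0(3) by (auto simp: least_period_def)
  define \<tau> where "\<tau> x = real_of_ereal (period \<Omega> V x)" for x
  have \<tau>: "\<tau> x = T'" if "x \<in> closure \<Omega>" "least_period x T'" for x T'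
    using period_eq[OF that] by (simp add: \<tau>_def)
  obtain \<rho> where \<rho>: "\<rho> > 0"
    "\<And>x t. x \<in> closure \<Omega> \<Longrightarrow> norm (x - x0) < \<rho> \<Longrightarrow> norm (phi t x - x0) < \<rho> \<Longrightarrow>
      (phi t x - x) \<bullet> F x0 = 0 \<Longrightarrow> phi t x = x"
    using return_rigid[OF x0(1,2)] by blast
  have near: "\<forall>\<^sub>F x in at x0 within closure \<Omega>. least_period x (\<tau> x) \<and> \<bar>\<tau> x - T\<bar> \<le> \<eta>" if \<eta>: "\<eta> > 0" for \<eta>
  proof -
    obtain \<delta> where "\<delta> > 0" "\<And>x. x \<in> closure \<Omega> \<Longrightarrow> norm (x - x0) < \<delta> \<Longrightarrow>
        \<exists>T'. least_period x T' \<and> \<bar>T' - T\<bar> \<le> \<eta>"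
      using least_period_continuous[OF x0 \<rho> \<eta>] by blast
    then show ?thesis using \<tau> unfolding eventually_at dist_norm by metis
  qed
  have lim: "(\<tau> \<longlongrightarrow> T) (at x0 within closure \<Omega>)"
  proof (rule tendstoI)
    fix e :: real assume "e > 0"
    then have "e / 2 > 0" by simp
    from near[OF this] show "\<forall>\<^sub>F x in at x0 within closure \<Omega>. dist (\<tau> x) T < e"
      by eventually_elim (use \<open>e > 0\<close> in \<open>auto simp: dist_real_def\<close>)
  qed
  have ret: "\<forall>\<^sub>F x in at x0 within closure \<Omega>. phi (\<tau> x) x = x"
    using near[OF zero_less_one] by eventually_elim (simp add: least_period_def)
  obtain D where D: "(\<tau> has_derivative D) (at x0 within closure \<Omega>)"
    "\<And>w. dphi T x0 w = w - D w *\<^sub>R F x0"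
  proof (rule return_time_has_derivative[OF x0(1,2) T(2) \<tau>[OF x0(1,3)] ret lim])
    show "A' = B'" if "(f has_derivative A') (at x0 within closure \<Omega>)"
      "(f has_derivative B') (at x0 within closure \<Omega>)" for f :: "real^2 \<Rightarrow> real^2" and A' B'
      by (rule has_derivative_within_closure_unique[OF dom x0(1) that])
  qed blast
  have "\<tau> x0 = T" by (rule \<tau>[OF x0(1,3)])
  then have "((\<lambda>x. ln (\<tau> x)) has_derivative (\<lambda>w. D w * inverse T)) (at x0 within closure \<Omega>)"
    using has_derivative_ln[OF _ D(1)] T by simp
  then have "w \<bullet> grad_ln_period \<Omega> V x0 = D w / T" for w
    unfolding grad_ln_period_def \<tau>_def[symmetric] inner_commute[of w]
    using gradient_within_closure[OF dom x0(1)] by (simp add: divide_inverse)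
  then show ?thesis using that D(2) by blast
qed

text \<open>\<open>M * T\<close> bounds the integral of \<open>norm (A _)\<close> over one period, so \<open>exp B\<close> bounds the derivative of
  the flow over one period.\<close>

definition controlled :: "real \<Rightarrow> real^2 \<Rightarrow> bool" where
  "controlled B x \<longleftrightarrow> x \<in> closure \<Omega> \<and> F x \<noteq> 0 \<and>
     (\<exists>T M. least_period x T \<and> (\<forall>s. norm (A (phi s x)) \<le> M) \<and> M * T \<le> B)"

text \<open>Control is a property of the orbit, which allows the estimates to be run backwards from
  \<open>phi t x\<close>.\<close>

lemma controlled_phi:
  assumes "controlled B x" shows "controlled B (phi t x)"
proof -
  obtain T M where *: "least_period x T" "\<And>s. norm (A (phi s x)) \<le> M" "M * T \<le> B"
    "x \<in> closure \<Omega>" "F x \<noteq> 0"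
    using assms unfolding controlled_def by blast
  then have "least_period (phi t x) T \<and> (\<forall>s. norm (A (phi s (phi t x))) \<le> M) \<and> M * T \<le> B"
    using least_period_phi by (simp flip: phi_add)
  then show ?thesis
    unfolding controlled_def using * phi_in_closure phi_not_equilibrium by blast
qed

text \<open>The least period is at least \<open>1 / L\<close>, so the correction term grows at most
  linearly in \<open>t\<close>, at a rate that does not depend on the orbit except through
  \<open>B\<close>.\<close>

lemma controlled_estimate:
  assumes "controlled B x"
  shows "norm (flow_jacobian \<Omega> V t x *v w + (t * (w \<bullet> grad_ln_period \<Omega> V x)) *\<^sub>R V (flow \<Omega> V t x))
      \<le> exp B * (2 + exp B) * norm w" (is ?th1)
    and "norm (dphi t x w) \<le> (1 + L) * (exp B * (2 + exp B)) * (1 + \<bar>t\<bar>) * norm w" (is ?th2)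
proof -
  obtain T M where *: "least_period x T" "\<And>s. norm (A (phi s x)) \<le> M" "M * T \<le> B"
    "x \<in> closure \<Omega>" "F x \<noteq> 0"
    using assms unfolding controlled_def by blast
  have T: "T > 0" "phi T x = x" using *(1) by (auto simp: least_period_def)
  obtain D where D: "\<And>w. dphi T x w = w - D w *\<^sub>R F x"
    "\<And>w. w \<bullet> grad_ln_period \<Omega> V x = D w / T"
    using grad_ln_period_eq[OF *(4,5,1)] by blast
  let ?C = "exp B * (2 + exp B)"
  note bounds = corrected_derivative_bound[OF *(4) T(2,1) *(2,3) D(1)]
  have V: "V (flow \<Omega> V t x) = F (phi t x)" using *(4) V_eq phi_in_closure by (simp add: flow_eq)
  show ?th1
    using bounds(1)[of t w] unfolding flow_jacobian_eq[OF *(4)] V D(2) by (simp add: algebra_simps)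
  have "1 / T \<le> L"
    using return_time_ge[OF T *(5)] T(1) L_pos by (simp add: field_simps)
  then have tT: "\<bar>t\<bar> / T \<le> L * \<bar>t\<bar>"
    using mult_right_mono[of "1 / T" L "\<bar>t\<bar>"] by simp
  have "norm (dphi t x w) \<le> norm (dphi t x w + (t / T * D w) *\<^sub>R F (phi t x)) + \<bar>t\<bar> / T * norm (D w *\<^sub>R F (phi t x))"
    using norm_triangle_ineq4[of "dphi t x w + (t / T * D w) *\<^sub>R F (phi t x)" "(t / T * D w) *\<^sub>R F (phi t x)"] T(1)
    by (simp add: abs_mult mult.assoc)
  also have "\<dots> \<le> ?C * norm w + (L * \<bar>t\<bar>) * (?C * norm w)"
  proof (intro add_mono mult_mono bounds(1) tT)
    have "exp B * (1 + exp B) * norm w \<le> ?C * norm w" by (intro mult_right_mono mult_left_mono) auto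
    then show "norm (D w *\<^sub>R F (phi t x)) \<le> ?C * norm w" using bounds(2)[of w t] by linarith
  qed (use L_pos in auto)
  also have "\<dots> \<le> (1 + L) * ?C * (1 + \<bar>t\<bar>) * norm w"
  proof -
    have "(1 + L * \<bar>t\<bar>) * (?C * norm w) \<le> ((1 + L) * (1 + \<bar>t\<bar>)) * (?C * norm w)"
      using L_pos by (intro mult_right_mono) (auto simp: algebra_simps add_pos_pos less_imp_le)
    then show ?thesis by (simp add: algebra_simps)
  qed
  finally show ?th2 .
qed

lemma controlled_imp_estimates:
  assumes "\<And>x. x \<in> Omega_ge \<Omega> V \<epsilon> \<Longrightarrow> F x \<noteq> 0 \<Longrightarrow> controlled B x"
  shows "(\<exists>C>0. \<forall>x0\<in>Omega_ge \<Omega> V \<epsilon>. V x0 \<noteq> 0 \<longrightarrow>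
            (\<forall>w0 :: real^2.
               (SUP t. ereal (norm (flow_jacobian \<Omega> V t x0 *v w0
                  + (t * (w0 \<bullet> grad_ln_period \<Omega> V x0)) *\<^sub>R V (flow \<Omega> V t x0))))
               \<le> ereal (C * norm w0)))
       \<and> (\<exists>C>0. \<forall>x0\<in>Omega_ge \<Omega> V \<epsilon>. V x0 \<noteq> 0 \<longrightarrow>
            (\<forall>(t::real) (w0 :: real^2).
               inverse C * inverse (1 + \<bar>t\<bar>) * norm w0 \<le> norm (flow_jacobian \<Omega> V t x0 *v w0) \<and>
               norm (flow_jacobian \<Omega> V t x0 *v w0) \<le> C * (1 + \<bar>t\<bar>) * norm w0))"
proof (intro conjI exI ballI allI impI)
  show "exp B * (2 + exp B) > 0" "(1 + L) * (exp B * (2 + exp B)) > 0"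
    using L_pos by (auto simp: add_pos_pos)
  let ?C = "(1 + L) * (exp B * (2 + exp B))"
  fix x assume x: "x \<in> Omega_ge \<Omega> V \<epsilon>" "V x \<noteq> 0"
  then have xc: "x \<in> closure \<Omega>" by (simp add: Omega_ge_def)
  then have c: "controlled B x" using assms x V_eq by simp
  fix w :: "real^2"
  show "(SUP t. ereal (norm (flow_jacobian \<Omega> V t x *v w
          + (t * (w \<bullet> grad_ln_period \<Omega> V x)) *\<^sub>R V (flow \<Omega> V t x))))
      \<le> ereal (exp B * (2 + exp B) * norm w)"
    using controlled_estimate(1)[OF c] by (intro SUP_least) simp
  fix t :: real
  show "norm (flow_jacobian \<Omega> V t x *v w) \<le> ?C * (1 + \<bar>t\<bar>) * norm w"
    using controlled_estimate(2)[OF c] flow_jacobian_eq[OF xc] by simp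
  \<comment> \<open>The upper estimate from the point \<open>phi t x\<close>, run for the time
    \<open>- t\<close>, inverts the flow derivative.\<close>
  have "norm w \<le> ?C * (1 + \<bar>t\<bar>) * norm (dphi t x w)"
    using controlled_estimate(2)[OF controlled_phi[OF c], of "- t" t "dphi t x w"] dphi_neg[OF xc] by simp
  moreover have pos: "?C * (1 + \<bar>t\<bar>) > 0" using L_pos by (auto simp: add_pos_pos add_pos_nonneg)
  ultimately have "inverse (?C * (1 + \<bar>t\<bar>)) * norm w
      \<le> inverse (?C * (1 + \<bar>t\<bar>)) * (?C * (1 + \<bar>t\<bar>) * norm (dphi t x w))"
    by (intro mult_left_mono less_imp_le[OF positive_imp_inverse_positive])
  also have "\<dots> = norm (dphi t x w)"
  proof -
    have "inverse c * (c * d) = d" if "c > 0" for c d :: real using that by simp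
    from this[OF pos] show ?thesis .
  qed
  finally show "inverse ?C * inverse (1 + \<bar>t\<bar>) * norm w \<le> norm (flow_jacobian \<Omega> V t x *v w)"
    unfolding flow_jacobian_eq[OF xc] inverse_mult_distrib .
qed

text \<open>The least period is locally bounded by its continuity, and the derivative of the field
  is bounded on the compact set \<open>closure \<Omega>\<close>; away from equilibria this already
  bounds the product.\<close>

lemma controlled_near_regular:
  assumes y: "y \<in> closure \<Omega>" "F y \<noteq> 0" "y \<notin> aperiodic_set \<Omega> V"
  obtains \<delta> B where "\<delta> > 0"
    "\<And>x. x \<in> closure \<Omega> \<Longrightarrow> norm (x - y) < \<delta> \<Longrightarrow> F x \<noteq> 0 \<Longrightarrow> controlled B x"
proof -
  obtain T where T: "least_period y T" using periodic_least_period y by blast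
  obtain \<rho> where \<rho>: "\<rho> > 0"
    "\<And>x t. x \<in> closure \<Omega> \<Longrightarrow> norm (x - y) < \<rho> \<Longrightarrow> norm (phi t x - y) < \<rho> \<Longrightarrow>
      (phi t x - x) \<bullet> F y = 0 \<Longrightarrow> phi t x = x"
    using return_rigid[OF y(1,2)] by blast
  obtain \<delta> where \<delta>: "\<delta> > 0" "\<And>x. x \<in> closure \<Omega> \<Longrightarrow> norm (x - y) < \<delta> \<Longrightarrow>
      \<exists>T'. least_period x T' \<and> \<bar>T' - T\<bar> \<le> 1"
    using least_period_continuous[OF y(1,2) T \<rho> zero_less_one] by blast
  have "bounded (A ` closure \<Omega>)"
    using K by (intro compact_imp_bounded compact_continuous_image continuous_on_subset[OF A_cont])
  then obtain N where N: "\<And>z. z \<in> closure \<Omega> \<Longrightarrow> norm (A z) \<le> N"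
    by (auto simp: bounded_iff)
  have N0: "N \<ge> 0" using N[OF y(1)] norm_ge_zero order_trans by blast
  show ?thesis
  proof (rule that[OF \<delta>(1)])
    fix x assume x: "x \<in> closure \<Omega>" "norm (x - y) < \<delta>" "F x \<noteq> 0"
    then obtain T' where T': "least_period x T'" "\<bar>T' - T\<bar> \<le> 1" using \<delta> by blast
    have "N * T' \<le> N * (T + 1)" using T' N0 by (intro mult_left_mono) auto
    then show "controlled (N * (T + 1)) x"
      unfolding controlled_def using x T' N phi_in_closure by blast
  qed
qed

lemma controlled_mono: "controlled B x \<Longrightarrow> B \<le> B' \<Longrightarrow> controlled B' x"
  unfolding controlled_def by (meson order_trans)

lemma set_distance_le: "a \<in> S \<Longrightarrow> set_distance x S \<le> ereal (dist x a)"
  unfolding set_distance_def by (rule INF_lower)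

text \<open>The covering is of all of \<open>closure \<Omega>\<close>: a point outside
  \<open>Omega_ge\<close> has a neighbourhood disjoint from it, so closedness of
  \<open>Omega_ge\<close> does not have to be shown beforehand.\<close>

lemma controlled_on_Omega_ge:
  assumes "\<epsilon> > 0"
    and crit: "\<And>y. y \<in> Omega_ge \<Omega> V \<epsilon> \<Longrightarrow> F y = 0 \<Longrightarrow>
      \<exists>\<delta>>0. \<exists>B. \<forall>x\<in>closure \<Omega>. norm (x - y) < \<delta> \<longrightarrow> F x \<noteq> 0 \<longrightarrow> controlled B x"
  obtains B where "\<And>x. x \<in> Omega_ge \<Omega> V \<epsilon> \<Longrightarrow> F x \<noteq> 0 \<Longrightarrow> controlled B x"
proof -
  have "\<exists>\<delta>>0. \<exists>B. \<forall>x\<in>Omega_ge \<Omega> V \<epsilon>. norm (x - y) < \<delta> \<longrightarrow> F x \<noteq> 0 \<longrightarrow> controlled B x"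
    if y: "y \<in> closure \<Omega>" for y
  proof (cases "y \<in> Omega_ge \<Omega> V \<epsilon>")
    case True
    have "y \<notin> aperiodic_set \<Omega> V"
    proof
      assume "y \<in> aperiodic_set \<Omega> V"
      then have "set_distance y (aperiodic_set \<Omega> V) \<le> 0"
        using set_distance_le[of y _ y] by (simp add: zero_ereal_def)
      moreover have "ereal \<epsilon> \<le> set_distance y (aperiodic_set \<Omega> V)"
        using True by (simp add: Omega_ge_def)
      ultimately have "ereal \<epsilon> \<le> 0" by (rule order_trans[rotated])
      then show False using \<open>\<epsilon> > 0\<close> by simp
    qed
    then obtain \<delta> B where \<delta>: "\<delta> > 0"
      and B: "\<And>x. x \<in> closure \<Omega> \<Longrightarrow> norm (x - y) < \<delta> \<Longrightarrow> F x \<noteq> 0 \<Longrightarrow> controlled B x"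
    proof (cases "F y = 0")
      case True
      obtain \<delta> B where "\<delta> > 0"
        "\<forall>x\<in>closure \<Omega>. norm (x - y) < \<delta> \<longrightarrow> F x \<noteq> 0 \<longrightarrow> controlled B x"
        using crit[OF \<open>y \<in> Omega_ge \<Omega> V \<epsilon>\<close> True] by blast
      then show ?thesis by (intro that[of \<delta> B]) auto
    next
      case False
      then show ?thesis using controlled_near_regular[OF y False] \<open>y \<notin> _\<close> that by blast
    qed
    have "\<forall>x\<in>Omega_ge \<Omega> V \<epsilon>. norm (x - y) < \<delta> \<longrightarrow> F x \<noteq> 0 \<longrightarrow> controlled B x"
      using B by (auto simp: Omega_ge_def)
    then show ?thesis using \<delta> by blast
  next
    case False
    then have "set_distance y (aperiodic_set \<Omega> V) < ereal \<epsilon>" using y by (auto simp: Omega_ge_def)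
    then obtain a where a: "a \<in> aperiodic_set \<Omega> V" "dist y a < \<epsilon>"
      unfolding set_distance_def INF_less_iff by auto
    have "x \<notin> Omega_ge \<Omega> V \<epsilon>" if "norm (x - y) < \<epsilon> - dist y a" for x
    proof
      assume "x \<in> Omega_ge \<Omega> V \<epsilon>"
      then have "ereal \<epsilon> \<le> set_distance x (aperiodic_set \<Omega> V)" by (simp add: Omega_ge_def)
      from order_trans[OF this set_distance_le[OF a(1)]] have "\<epsilon> \<le> dist x a" by simp
      then show False using that dist_triangle[of x a y] by (simp add: dist_norm)
    qed
    then show ?thesis using a by (intro exI[of _ "\<epsilon> - dist y a"]) auto
  qed
  then obtain \<delta> B where \<delta>: "\<And>y. y \<in> closure \<Omega> \<Longrightarrow> \<delta> y > 0"
    and B: "\<And>y x. y \<in> closure \<Omega> \<Longrightarrow> x \<in> Omega_ge \<Omega> V \<epsilon> \<Longrightarrow> norm (x - y) < \<delta> y \<Longrightarrow> F x \<noteq> 0 \<Longrightarrow>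
      controlled (B y) x"
    by metis
  obtain Y where Y: "Y \<subseteq> closure \<Omega>" "finite Y" "closure \<Omega> \<subseteq> (\<Union>y\<in>Y. ball y (\<delta> y))"
    by (rule compactE_image[OF K(1), of "closure \<Omega>" "\<lambda>y. ball y (\<delta> y)"]) (use \<delta> in auto)
  show ?thesis
  proof (rule that)
    fix x assume x: "x \<in> Omega_ge \<Omega> V \<epsilon>" "F x \<noteq> 0"
    then have "x \<in> closure \<Omega>" by (simp add: Omega_ge_def)
    then obtain y where y: "y \<in> Y" "x \<in> ball y (\<delta> y)" using Y by blast
    then have "controlled (B y) x"
      using B[of y x] x Y by (auto simp: dist_norm norm_minus_commute)
    moreover have "B y \<le> Max (B ` Y)" using y Y by (intro Max_ge) auto
    ultimately show "controlled (Max (B ` Y)) x" by (rule controlled_mono)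
  qed
qed

end

section \<open>Critical points\<close>

lemma norm_matrix_vector_mult_le: "norm (M *v v) \<le> norm M * norm v"
  for M :: "real^'n^'m"
proof -
  have "norm (M *v v) = L2_set (\<lambda>i. \<bar>M $ i \<bullet> v\<bar>) UNIV"
    by (simp add: norm_vec_def matrix_vector_mul_component)
  also have "\<dots> \<le> L2_set (\<lambda>i. norm (M $ i) * norm v) UNIV"
    by (intro L2_set_mono Cauchy_Schwarz_ineq2) auto
  also have "\<dots> = norm M * norm v"
    by (simp add: norm_vec_def[of M] L2_set_left_distrib)
  finally show ?thesis .
qed

section \<open>The homogeneous model at a critical point\<close>

lemma has_derivative_norm_powr:
  fixes y :: "'a::real_inner"
  assumes "y \<noteq> 0"
  shows "((\<lambda>y. norm y powr k) has_derivative (\<lambda>v. k * norm y powr (k - 2) * (y \<bullet> v))) (at y)"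
proof -
  have n: "norm y > 0" using assms by simp
  have "((\<lambda>x. x powr k) has_derivative (\<lambda>h. (k * norm y powr (k - 1)) * h)) (at (norm y))"
    using has_real_derivative_powr[OF n, of k] by (simp add: has_field_derivative_def)
  from has_derivative_compose[OF has_derivative_norm[OF assms] this]
  have *: "((\<lambda>y. norm y powr k) has_derivative (\<lambda>v. k * norm y powr (k - 1) * (v \<bullet> sgn y))) (at y)"
    by (simp add: inner_commute)
  have "norm y powr (k - 1) = norm y powr (k - 2) * norm y"
    using n powr_add[of "norm y" "k - 2" 1] by (simp add: algebra_simps)
  then have "(\<lambda>v. k * norm y powr (k - 1) * (v \<bullet> sgn y)) = (\<lambda>v. k * norm y powr (k - 2) * (y \<bullet> v))"
    using n by (intro ext) (simp add: sgn_div_norm inner_commute)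
  with * show ?thesis by (simp only:)
qed

text \<open>\<open>Q\<close> stands for the symmetric matrix of the expansion, seen as a linear map;
  \<open>N\<close> is kept positive so that one can divide by it.\<close>

locale homogeneous_form =
  fixes m N :: real and Q :: "real^2 \<Rightarrow> real^2"
  assumes m: "m \<ge> 1" and Q: "bounded_linear Q" and sym: "Q u \<bullet> v = u \<bullet> Q v"
    and N: "N > 0" "norm (Q v) \<le> N * norm v"
begin

definition P :: "real^2 \<Rightarrow> real" where
  "P y = 1/2 * norm y powr (m - 1) * (y \<bullet> Q y)"

text \<open>The gradient of \<open>P\<close> away from the origin, written out by the product
  rule.\<close>

definition gP :: "real^2 \<Rightarrow> real^2" where
  "gP y = ((m - 1) / 2 * norm y powr (m - 3) * (y \<bullet> Q y)) *\<^sub>R y + norm y powr (m - 1) *\<^sub>R Q y"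

lemma Q_deriv: "(Q has_derivative Q) (at y)"
  using Q by (simp add: bounded_linear_imp_has_derivative)

lemma form_deriv: "((\<lambda>y. y \<bullet> Q y) has_derivative (\<lambda>v. 2 * (Q y \<bullet> v))) (at y)"
proof -
  have "((\<lambda>y. y \<bullet> Q y) has_derivative (\<lambda>v. y \<bullet> Q v + v \<bullet> Q y)) (at y)"
    by (intro has_derivative_inner has_derivative_ident Q_deriv)
  moreover have "(\<lambda>v. y \<bullet> Q v + v \<bullet> Q y) = (\<lambda>v. 2 * (Q y \<bullet> v))"
  proof
    show "y \<bullet> Q v + v \<bullet> Q y = 2 * (Q y \<bullet> v)" for v
      using sym[of y v] inner_commute[of v "Q y"] by simp
  qed
  ultimately show ?thesis by (simp only:)
qed

lemma P_deriv:
  assumes "y \<noteq> 0" shows "(P has_derivative (\<lambda>v. gP y \<bullet> v)) (at y)"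
proof -
  have "((\<lambda>y. (1/2 * norm y powr (m - 1)) * (y \<bullet> Q y)) has_derivative
      (\<lambda>v. (1/2 * norm y powr (m - 1)) * (2 * (Q y \<bullet> v)) +
        (1/2 * ((m - 1) * norm y powr (m - 1 - 2) * (y \<bullet> v))) * (y \<bullet> Q y))) (at y)"
    by (intro has_derivative_mult form_deriv has_derivative_mult_right has_derivative_norm_powr assms)
  moreover have "(\<lambda>v. (1/2 * norm y powr (m - 1)) * (2 * (Q y \<bullet> v)) +
        (1/2 * ((m - 1) * norm y powr (m - 1 - 2) * (y \<bullet> v))) * (y \<bullet> Q y)) = (\<lambda>v. gP y \<bullet> v)"
    by (rule ext) (simp add: gP_def inner_add_left field_simps)
  ultimately show ?thesis unfolding P_def[abs_def] by simp
qed

lemma powr_shift: "norm y powr (m - 3) * (norm y)\<^sup>2 = norm y powr (m - 1)"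
  if "y \<noteq> 0" for y :: "real^2"
  using that powr_add[of "norm y" "m - 3" 2] by simp

text \<open>Euler's identity for a function that is homogeneous of degree
  \<open>m + 1\<close>.\<close>

lemma inner_gP_self: "y \<bullet> gP y = (m + 1) * P y" if "y \<noteq> 0"
proof -
  have "y \<bullet> gP y = (m - 1) / 2 * (norm y powr (m - 3) * (norm y)\<^sup>2) * (y \<bullet> Q y)
      + norm y powr (m - 1) * (y \<bullet> Q y)"
    by (simp add: gP_def inner_add_right power2_norm_eq_inner)
  then show ?thesis unfolding powr_shift[OF that] P_def by (simp add: field_simps)
qed

text \<open>The radial part of \<open>gP\<close> is orthogonal to \<open>perp y\<close>, so the
  angular component sees only \<open>Q\<close>.\<close>

lemma inner_gP_perp: "gP y \<bullet> perp y = norm y powr (m - 1) * (Q y \<bullet> perp y)"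
  by (simp add: gP_def inner_add_left)

lemma Q_inner_le: "\<bar>u \<bullet> Q v\<bar> \<le> N * norm u * norm v"
  using Cauchy_Schwarz_ineq2[of u "Q v"] N(2)[of v] mult_left_mono[of "norm (Q v)" "N * norm v" "norm u"]
  by (simp add: mult_ac)

lemma gP_deriv:
  assumes "y \<noteq> 0"
  obtains D where "(gP has_derivative D) (at y)"
    "\<And>v. norm (D v) \<le> N * (1 + (m - 1) * (3 + \<bar>m - 3\<bar>)) * norm y powr (m - 1) * norm v"
proof -
  define s where "s = norm y"
  have s: "s > 0" using assms by (simp add: s_def)
  \<comment> \<open>The lowest power that occurs. The others are \<open>a * s\<^sup>2\<close> and
    \<open>a * s ^ 4\<close>, which turns the estimates into polynomial arithmetic.\<close>
  define a where "a = s powr (m - 5)"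
  have a: "a > 0" using s by (simp add: a_def)
  have p3: "s powr (m - 3) = a * s\<^sup>2" and p1: "s powr (m - 1) = a * s ^ 4"
    using s powr_add[of s "m - 5" 2] powr_add[of s "m - 5" 4] by (simp_all add: a_def)
  let ?c' = "\<lambda>v. ((m - 1) / 2 * norm y powr (m - 3)) * (2 * (Q y \<bullet> v)) +
        ((m - 1) / 2 * ((m - 3) * norm y powr (m - 3 - 2) * (y \<bullet> v))) * (y \<bullet> Q y)"
  have c: "((\<lambda>y. ((m - 1) / 2 * norm y powr (m - 3)) * (y \<bullet> Q y)) has_derivative ?c') (at y)"
    by (intro has_derivative_mult form_deriv has_derivative_mult_right has_derivative_norm_powr assms)
  let ?D = "\<lambda>v. (((m - 1) / 2 * norm y powr (m - 3)) * (y \<bullet> Q y)) *\<^sub>R v + ?c' v *\<^sub>R y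
      + (norm y powr (m - 1) *\<^sub>R Q v + ((m - 1) * norm y powr (m - 1 - 2) * (y \<bullet> v)) *\<^sub>R Q y)"
  have D: "(gP has_derivative ?D) (at y)"
    unfolding gP_def[abs_def]
    by (intro has_derivative_add has_derivative_scaleR c has_derivative_ident Q_deriv
        has_derivative_norm_powr assms)
  have "norm (?D v) \<le> N * (1 + (m - 1) * (3 + \<bar>m - 3\<bar>)) * norm y powr (m - 1) * norm v" for v
  proof -
    define V where "V = norm v"
    have V: "V \<ge> 0" by (simp add: V_def)
    have q: "\<bar>y \<bullet> Q y\<bar> \<le> N * s * s" and yv: "\<bar>y \<bullet> v\<bar> \<le> s * V" and Qv: "\<bar>Q y \<bullet> v\<bar> \<le> N * s * V"
      using Q_inner_le[of y y] Cauchy_Schwarz_ineq2[of y v] Q_inner_le[of v y]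
      by (simp_all add: s_def V_def inner_commute mult_ac)
    have "norm ((((m - 1) / 2 * norm y powr (m - 3)) * (y \<bullet> Q y)) *\<^sub>R v)
        = ((m - 1) / 2 * (a * s\<^sup>2)) * \<bar>y \<bullet> Q y\<bar> * V"
      using m a by (simp add: s_def[symmetric] p3 V_def abs_mult)
    also have "\<dots> \<le> ((m - 1) / 2 * (a * s\<^sup>2)) * (N * s * s) * V"
      using q m a s V by (intro mult_right_mono mult_left_mono) auto
    finally have t1: "norm ((((m - 1) / 2 * norm y powr (m - 3)) * (y \<bullet> Q y)) *\<^sub>R v)
        \<le> (m - 1) / 2 * (N * (a * s ^ 4) * V)"
      by (simp add: power2_eq_square power4_eq_xxxx mult_ac)
    have t2a: "\<bar>((m - 1) / 2 * norm y powr (m - 3)) * (2 * (Q y \<bullet> v))\<bar> \<le> (m - 1) * (a * s\<^sup>2) * (N * s * V)"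
    proof -
      have "\<bar>((m - 1) / 2 * norm y powr (m - 3)) * (2 * (Q y \<bullet> v))\<bar> = (m - 1) * (a * s\<^sup>2) * \<bar>Q y \<bullet> v\<bar>"
        using m a by (simp add: s_def[symmetric] p3 abs_mult)
      also have "\<dots> \<le> (m - 1) * (a * s\<^sup>2) * (N * s * V)"
        using Qv m a by (intro mult_left_mono) auto
      finally show ?thesis .
    qed
    have t2b: "\<bar>((m - 1) / 2 * ((m - 3) * norm y powr (m - 3 - 2) * (y \<bullet> v))) * (y \<bullet> Q y)\<bar>
        \<le> (m - 1) / 2 * \<bar>m - 3\<bar> * a * ((s * V) * (N * s * s))"
    proof -
      have "\<bar>((m - 1) / 2 * ((m - 3) * norm y powr (m - 3 - 2) * (y \<bullet> v))) * (y \<bullet> Q y)\<bar>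
          = (m - 1) / 2 * \<bar>m - 3\<bar> * a * (\<bar>y \<bullet> v\<bar> * \<bar>y \<bullet> Q y\<bar>)"
        using m a by (simp add: s_def[symmetric] a_def abs_mult)
      also have "\<dots> \<le> (m - 1) / 2 * \<bar>m - 3\<bar> * a * ((s * V) * (N * s * s))"
        using q yv m a s V by (intro mult_left_mono mult_mono) auto
      finally show ?thesis .
    qed
    have "norm (?c' v *\<^sub>R y) \<le> ((m - 1) * (a * s\<^sup>2) * (N * s * V) +
        (m - 1) / 2 * \<bar>m - 3\<bar> * a * ((s * V) * (N * s * s))) * s"
    proof -
      have "norm (?c' v *\<^sub>R y) = \<bar>?c' v\<bar> * s" by (simp add: s_def)
      then show ?thesis using t2a t2b s by (auto intro!: mult_right_mono order_trans[OF abs_triangle_ineq] add_mono)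
    qed
    then have t2: "norm (?c' v *\<^sub>R y) \<le> (m - 1) * (N * (a * s ^ 4) * V) + (m - 1) / 2 * \<bar>m - 3\<bar> * (N * (a * s ^ 4) * V)"
      by (simp add: power2_eq_square power4_eq_xxxx algebra_simps)
    have "norm (norm y powr (m - 1) *\<^sub>R Q v) \<le> (a * s ^ 4) * (N * V)"
      using N(2)[of v] a s by (simp add: s_def[symmetric] p1 V_def mult_left_mono)
    then have t3: "norm (norm y powr (m - 1) *\<^sub>R Q v) \<le> N * (a * s ^ 4) * V"
      by (simp add: mult_ac)
    have "norm (((m - 1) * norm y powr (m - 1 - 2) * (y \<bullet> v)) *\<^sub>R Q y) \<le> (m - 1) * (a * s\<^sup>2) * (s * V) * (N * s)"
    proof -
      have "norm (((m - 1) * norm y powr (m - 1 - 2) * (y \<bullet> v)) *\<^sub>R Q y)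
          = (m - 1) * (a * s\<^sup>2) * \<bar>y \<bullet> v\<bar> * norm (Q y)"
        using m a by (simp add: s_def[symmetric] p3 abs_mult)
      also have "\<dots> \<le> (m - 1) * (a * s\<^sup>2) * (s * V) * (N * s)"
        using yv N(2)[of y] m a s V N(1) by (intro mult_mono) (auto simp: s_def)
      finally show ?thesis .
    qed
    then have t4: "norm (((m - 1) * norm y powr (m - 1 - 2) * (y \<bullet> v)) *\<^sub>R Q y) \<le> (m - 1) * (N * (a * s ^ 4) * V)"
      by (simp add: power2_eq_square power4_eq_xxxx algebra_simps)
    let ?Z = "N * (a * s ^ 4) * V"
    have Z: "?Z \<ge> 0" using N a s V by auto
    have "norm (?D v) \<le> (m - 1) / 2 * ?Z + ((m - 1) * ?Z + (m - 1) / 2 * \<bar>m - 3\<bar> * ?Z) + (?Z + (m - 1) * ?Z)"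
      by (intro order_trans[OF norm_triangle_ineq] add_mono t1 t2 t3 t4)
    also have "\<dots> = (1 + (m - 1) * (5/2 + \<bar>m - 3\<bar> / 2)) * ?Z"
    proof -
      have "(m - 1) / 2 * z + ((m - 1) * z + (m - 1) / 2 * b * z) + (z + (m - 1) * z)
          = (1 + (m - 1) * (5/2 + b / 2)) * z" for b z :: real by (simp add: field_simps)
      then show ?thesis .
    qed
    also have "\<dots> \<le> (1 + (m - 1) * (3 + \<bar>m - 3\<bar>)) * ?Z"
    proof -
      have "5/2 + \<bar>m - 3\<bar> / 2 \<le> 3 + \<bar>m - 3\<bar>"
        using abs_ge_zero[of "m - 3"] by (simp add: field_simps del: abs_ge_zero)
      then show ?thesis using Z m by (intro mult_right_mono add_left_mono mult_left_mono) auto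
    qed
    finally show ?thesis by (simp add: s_def[symmetric] p1 V_def mult_ac)
  qed
  then show ?thesis using that D by blast
qed

end

text \<open>Extracts what is used near a critical point: the model and its gradient up to an
  arbitrarily small relative error, and a Hessian bound of the right order. Invertibility of the
  matrix enters through \<open>\<kappa>\<close>.\<close>

lemma critical_point_model:
  assumes C2: "C2_on UNIV H" and crit: "p \<in> critical_points \<Omega> H" and A2: "assumption_A2 \<Omega> H"
  obtains m N \<kappa> :: real and Q where "homogeneous_form m N Q" "\<kappa> > 0" "\<And>v. \<kappa> * norm v \<le> norm (Q v)"
    "\<And>\<eta>. \<eta> > 0 \<Longrightarrow> \<exists>r>0. \<forall>y. 0 < norm y \<and> norm y < r \<longrightarrow>
      \<bar>H (p + y) - H p - homogeneous_form.P m Q y\<bar> \<le> \<eta> * norm y powr (m + 1) \<and>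
      norm (gradient H (at (p + y)) - homogeneous_form.gP m Q y) \<le> \<eta> * norm y powr m"
    "\<exists>C>0. \<exists>r>0. \<forall>y. 0 < norm y \<and> norm y < r \<longrightarrow>
      (\<exists>D. ((\<lambda>x. gradient H (at x)) has_derivative D) (at (p + y)) \<and>
        (\<forall>v. norm (D v) \<le> C * norm y powr (m - 1) * norm v))"
proof -
  obtain m :: real and S :: "real^2^2" and R :: "real^2 \<Rightarrow> real" where
    m: "m \<ge> 1" and S: "transpose S = S" "invertible S" and R: "C2_on UNIV R"
    and exp: "\<forall>\<^sub>F y in nhds 0. H (p + y) - H p = 1/2 * norm y powr (m - 1) * (y \<bullet> (S *v y)) + R y"
    and o0: "R \<in> o[at 0](\<lambda>y. norm y powr (m + 1))"
    and o1: "(\<lambda>y. norm (gradient R (at y))) \<in> o[at 0](\<lambda>y. norm y powr m)"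
    and o2: "(\<lambda>y. norm (jacobian (\<lambda>z. gradient R (at z)) (at y))) \<in> o[at 0](\<lambda>y. norm y powr (m - 1))"
    using A2 crit unfolding assumption_A2_def by (elim conjE ballE[of _ _ p] exE) auto
  define N where "N = norm S + 1"
  define Q where "Q v = S *v v" for v
  have Qb: "norm (Q v) \<le> N * norm v" for v
    unfolding Q_def N_def using norm_matrix_vector_mult_le[of S v] by (simp add: distrib_right add_increasing2)
  have Qlin: "bounded_linear Q" unfolding Q_def by simp
  interpret homogeneous_form m N Q
  proof (rule homogeneous_form.intro)
    show "bounded_linear Q" by (rule Qlin)
    show "Q u \<bullet> v = u \<bullet> Q v" for u v
      unfolding Q_def by (metis S(1) dot_lmul_matrix vector_transpose_matrix)
  qed (use m Qb in \<open>auto simp: N_def add_nonneg_pos\<close>)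
  obtain S' where S': "S' ** S = mat 1" using S(2) by (auto simp: invertible_def)
  have inv: "norm v \<le> (norm S' + 1) * norm (Q v)" for v
  proof -
    have "v = S' *v Q v" by (simp add: Q_def matrix_vector_mul_assoc S')
    then have "norm v \<le> norm S' * norm (Q v)" by (metis norm_matrix_vector_mult_le)
    then show ?thesis by (simp add: algebra_simps) (smt (verit) norm_ge_zero)
  qed
  have Rdiff: "R differentiable at y" for y
    using R unfolding C2_on_def C1_on_def differentiable_def by blast
  note Rd = has_derivative_gradient[OF Rdiff]
  have Hdiff: "H differentiable at y" for y
    using C2 unfolding C2_on_def C1_on_def differentiable_def by blast
  note Hd = has_derivative_gradient[OF Hdiff]
  obtain r0 where r0: "r0 > 0" "\<And>y. norm y < r0 \<Longrightarrow> H (p + y) = H p + P y + R y"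
    using exp unfolding eventually_nhds_metric P_def Q_def by (auto simp: dist_norm algebra_simps)
  \<comment> \<open>The expansion holds on a whole ball, so it may be differentiated; the origin is
    left out because \<open>P_deriv\<close> covers only \<open>y \<noteq> 0\<close>.\<close>
  have grad_eq: "gradient H (at (p + y)) = gP y + gradient R (at y)" if "0 < norm y" "norm y < r0" for y
  proof -
    have "((\<lambda>y. H p + P y + R y) has_derivative (\<lambda>v. gP y \<bullet> v + gradient R (at y) \<bullet> v)) (at y)"
      using that has_derivative_add[OF has_derivative_add[OF has_derivative_const P_deriv] Rd, of y "H p"] by simp
    then have "((\<lambda>y. H (p + y)) has_derivative (\<lambda>v. (gP y + gradient R (at y)) \<bullet> v)) (at y)"
      unfolding inner_add_left
      by (rule has_derivative_transform_within_open[of _ _ _ _ "ball 0 r0"]) (use that r0 in auto)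
    moreover have "((\<lambda>y. p + y) has_derivative (\<lambda>h. h)) (at y)"
      by (auto intro!: derivative_eq_intros)
    from has_derivative_compose[OF this Hd]
    have "((\<lambda>y. H (p + y)) has_derivative (\<lambda>v. gradient H (at (p + y)) \<bullet> v)) (at y)" .
    ultimately have "(\<lambda>v. (gP y + gradient R (at y)) \<bullet> v) = (\<lambda>v. gradient H (at (p + y)) \<bullet> v)"
      by (rule has_derivative_unique)
    then show ?thesis by (metis vector_eq_rdot)
  qed
  have small: "\<exists>r>0. \<forall>y. 0 < norm y \<and> norm y < r \<longrightarrow> norm (f y) \<le> \<eta> * norm y powr k"
    if "f \<in> o[at 0](\<lambda>y. norm y powr k)" "\<eta> > 0" for f :: "real^2 \<Rightarrow> real" and \<eta> k
    using landau_o.smallD[OF that] unfolding eventually_at by (auto simp: dist_norm)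
  show ?thesis
  proof (rule that[of m N Q "1 / (norm S' + 1)"])
    show "homogeneous_form m N Q" by unfold_locales
    show "1 / (norm S' + 1) > 0" by (simp add: add_nonneg_pos)
    show "1 / (norm S' + 1) * norm v \<le> norm (Q v)" for v
    proof -
      have "norm S' + 1 > 0" by (simp add: add_nonneg_pos)
      then show ?thesis using inv[of v] by (simp add: divide_le_eq mult.commute)
    qed
    fix \<eta> :: real assume \<eta>: "\<eta> > 0"
    obtain r1 where r1: "r1 > 0" "\<And>y. 0 < norm y \<Longrightarrow> norm y < r1 \<Longrightarrow> \<bar>R y\<bar> \<le> \<eta> * norm y powr (m + 1)"
      using small[OF o0 \<eta>] by auto
    obtain r2 where r2: "r2 > 0" "\<And>y. 0 < norm y \<Longrightarrow> norm y < r2 \<Longrightarrow> norm (gradient R (at y)) \<le> \<eta> * norm y powr m"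
      using small[OF o1 \<eta>] by auto
    show "\<exists>r>0. \<forall>y. 0 < norm y \<and> norm y < r \<longrightarrow>
      \<bar>H (p + y) - H p - P y\<bar> \<le> \<eta> * norm y powr (m + 1) \<and>
      norm (gradient H (at (p + y)) - gP y) \<le> \<eta> * norm y powr m"
      by (rule exI[of _ "min r0 (min r1 r2)"]) (use r0 r1 r2 grad_eq in simp)
  next
    obtain r3 where r3: "r3 > 0" "\<And>y. 0 < norm y \<Longrightarrow> norm y < r3 \<Longrightarrow>
        norm (jacobian (\<lambda>z. gradient R (at z)) (at y)) \<le> 1 * norm y powr (m - 1)"
      using small[OF o2 zero_less_one] by auto
    define C where "C = N * (1 + (m - 1) * (3 + \<bar>m - 3\<bar>)) + 1"
    have C: "C > 0" unfolding C_def using N m by (simp add: add_nonneg_pos)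
    have "\<exists>D. ((\<lambda>x. gradient H (at x)) has_derivative D) (at (p + y)) \<and>
        (\<forall>v. norm (D v) \<le> C * norm y powr (m - 1) * norm v)" if y: "0 < norm y" "norm y < min r0 r3" for y
    proof -
      obtain D where D: "(gP has_derivative D) (at y)"
        "\<And>v. norm (D v) \<le> N * (1 + (m - 1) * (3 + \<bar>m - 3\<bar>)) * norm y powr (m - 1) * norm v"
        by (rule gP_deriv[of y]) (use y in auto)
      let ?J = "jacobian (\<lambda>z. gradient R (at z)) (at y)"
      have "(\<lambda>z. gradient R (at z)) differentiable at y"
        using R unfolding C2_on_def C1_on_def differentiable_def by blast
      then have "((\<lambda>z. gradient R (at z)) has_derivative (\<lambda>h. ?J *v h)) (at y)"
        using jacobian_works by blast
      then have sum: "((\<lambda>z. gP z + gradient R (at z)) has_derivative (\<lambda>h. D h + ?J *v h)) (at y)"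
        by (intro has_derivative_add D)
      have "((\<lambda>x. x - p) has_derivative (\<lambda>h. h)) (at (p + y))"
        by (auto intro!: derivative_eq_intros)
      from has_derivative_compose[OF this, of "\<lambda>z. gP z + gradient R (at z)"] sum
      have "((\<lambda>x. gP (x - p) + gradient R (at (x - p))) has_derivative (\<lambda>h. D h + ?J *v h)) (at (p + y))"
        by simp
      then have "((\<lambda>x. gradient H (at x)) has_derivative (\<lambda>h. D h + ?J *v h)) (at (p + y))"
      proof (rule has_derivative_transform_within_open[of _ _ _ _ "ball p r0 - {p}"])
        show "p + y \<in> ball p r0 - {p}" using y by (auto simp: dist_norm)
        fix x assume "x \<in> ball p r0 - {p}"
        then show "gP (x - p) + gradient R (at (x - p)) = gradient H (at x)"
          using grad_eq[of "x - p"] by (auto simp: dist_norm norm_minus_commute)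
      qed auto
      moreover have "norm (D v + ?J *v v) \<le> C * norm y powr (m - 1) * norm v" for v
      proof -
        have "norm (?J *v v) \<le> norm y powr (m - 1) * norm v"
          using r3(2)[OF y(1)] y(2) norm_matrix_vector_mult_le[of ?J v]
            mult_right_mono[of "norm ?J" "norm y powr (m - 1)" "norm v"] by simp
        then show ?thesis
          using D(2)[of v] norm_triangle_ineq[of "D v" "?J *v v"] by (simp add: C_def algebra_simps)
      qed
      ultimately show ?thesis by blast
    qed
    moreover have "min r0 r3 > 0" using r0 r3 by simp
    ultimately show "\<exists>C>0. \<exists>r>0. \<forall>y. 0 < norm y \<and> norm y < r \<longrightarrow>
      (\<exists>D. ((\<lambda>x. gradient H (at x)) has_derivative D) (at (p + y)) \<and>
        (\<forall>v. norm (D v) \<le> C * norm y powr (m - 1) * norm v))"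
      using C by blast
  qed
qed

text \<open>If the gradient were radial at a point of the critical level, both components of
  \<open>Q y\<close>, along \<open>y\<close> and along \<open>perp y\<close>, would be small
  compared with \<open>norm y\<close>. This contradicts the lower bound on \<open>Q\<close>.\<close>

lemma critical_level_set_transversal:
  assumes C2: "C2_on UNIV H" and crit: "p \<in> critical_points \<Omega> H" and A2: "assumption_A2 \<Omega> H"
  obtains r where "r > 0" "\<And>y. 0 < norm y \<Longrightarrow> norm y < r \<Longrightarrow> H (p + y) = H p \<Longrightarrow>
      gradient H (at (p + y)) \<bullet> perp y \<noteq> 0"
proof -
  obtain m N \<kappa> :: real and Q where form: "homogeneous_form m N Q" and \<kappa>: "\<kappa> > 0" "\<And>v. \<kappa> * norm v \<le> norm (Q v)"
    and approx: "\<And>\<eta>. \<eta> > 0 \<Longrightarrow> \<exists>r>0. \<forall>y. 0 < norm y \<and> norm y < r \<longrightarrow>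
      \<bar>H (p + y) - H p - homogeneous_form.P m Q y\<bar> \<le> \<eta> * norm y powr (m + 1) \<and>
      norm (gradient H (at (p + y)) - homogeneous_form.gP m Q y) \<le> \<eta> * norm y powr m"
    using critical_point_model[OF assms] by metis
  interpret homogeneous_form m N Q by (rule form)
  \<comment> \<open>The two components of \<open>Q y\<close> contribute \<open>2 * \<eta>\<close>
    and \<open>\<eta>\<close>, and \<open>3 * \<eta> < \<kappa>\<close>.\<close>
  define \<eta> where "\<eta> = \<kappa> / 4"
  have \<eta>: "\<eta> > 0" using \<kappa> by (simp add: \<eta>_def)
  obtain r where r: "r > 0" "\<And>y. 0 < norm y \<Longrightarrow> norm y < r \<Longrightarrow>
      \<bar>H (p + y) - H p - P y\<bar> \<le> \<eta> * norm y powr (m + 1)"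
    "\<And>y. 0 < norm y \<Longrightarrow> norm y < r \<Longrightarrow> norm (gradient H (at (p + y)) - gP y) \<le> \<eta> * norm y powr m"
    using approx[OF \<eta>] by blast
  show ?thesis
  proof (rule that[OF r(1)])
    fix y assume y: "0 < norm y" "norm y < r" and lev: "H (p + y) = H p"
    define s where "s = norm y"
    define k where "k = s powr (m - 1)"
    have s: "s > 0" and k: "k > 0" using y by (auto simp: s_def k_def)
    have pm: "norm y powr (m + 1) = k * s\<^sup>2" "norm y powr m = k * s"
      using s powr_add[of s "m - 1" 2] powr_add[of s "m - 1" 1]
      by (simp_all add: s_def[symmetric] k_def add.commute)
    show "gradient H (at (p + y)) \<bullet> perp y \<noteq> 0"
    proof
      assume 0: "gradient H (at (p + y)) \<bullet> perp y = 0"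
      have "\<bar>P y\<bar> \<le> \<eta> * (k * s\<^sup>2)" using r(2)[OF y] lev unfolding pm by simp
      then have "k * \<bar>y \<bullet> Q y\<bar> \<le> k * (2 * \<eta> * s\<^sup>2)"
        using k by (simp add: P_def s_def[symmetric] k_def[symmetric] abs_mult)
      then have q: "\<bar>y \<bullet> Q y\<bar> \<le> 2 * \<eta> * s\<^sup>2" using k by simp
      have "k * \<bar>Q y \<bullet> perp y\<bar> = \<bar>gP y \<bullet> perp y\<bar>"
        using k by (simp add: inner_gP_perp s_def[symmetric] k_def[symmetric] abs_mult)
      also have "\<dots> = \<bar>(gradient H (at (p + y)) - gP y) \<bullet> perp y\<bar>"
        using 0 by (simp add: inner_diff_left)
      also have "\<dots> \<le> norm (gradient H (at (p + y)) - gP y) * s"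
        using Cauchy_Schwarz_ineq2[of _ "perp y"] by (simp add: s_def)
      also have "\<dots> \<le> \<eta> * (k * s) * s" using r(3)[OF y] s unfolding pm by (intro mult_right_mono) auto
      finally have "k * \<bar>Q y \<bullet> perp y\<bar> \<le> k * (\<eta> * s\<^sup>2)" by (simp add: power2_eq_square mult_ac)
      then have q': "\<bar>Q y \<bullet> perp y\<bar> \<le> \<eta> * s\<^sup>2" using k by simp
      have "s\<^sup>2 * norm (Q y) = norm ((y \<bullet> y) *\<^sub>R Q y)" by (simp add: s_def power2_norm_eq_inner)
      also have "\<dots> = norm ((Q y \<bullet> y) *\<^sub>R y + (Q y \<bullet> perp y) *\<^sub>R perp y)"
        by (simp only: orthogonal_perp_decomp)
      also have "\<dots> \<le> \<bar>y \<bullet> Q y\<bar> * s + \<bar>Q y \<bullet> perp y\<bar> * s"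
        using norm_triangle_ineq[of "(Q y \<bullet> y) *\<^sub>R y" "(Q y \<bullet> perp y) *\<^sub>R perp y"]
        by (simp add: s_def inner_commute)
      also have "\<dots> \<le> (2 * \<eta> * s\<^sup>2) * s + (\<eta> * s\<^sup>2) * s"
        using q q' s by (intro add_mono mult_right_mono) auto
      also have "\<dots> = s\<^sup>2 * (3 * \<eta> * s)" by (simp add: algebra_simps)
      finally have "norm (Q y) \<le> 3 * \<eta> * s" using s by simp
      then have "4 * \<eta> * s \<le> 3 * \<eta> * s" using \<kappa>(2)[of y] by (simp add: \<eta>_def s_def)
      then show False using \<eta> s by simp
    qed
  qed
qed

text \<open>Testing semidefiniteness at \<open>y - (\<sigma> / N) *\<^sub>R Q y\<close> gives
  \<open>(norm (Q y))\<^sup>2 / N \<le> \<sigma> * (y \<bullet> Q y)\<close>. Nonsingularity then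
  yields an explicit constant without eigenvalues.\<close>

lemma (in homogeneous_form) definite_of_semidefinite:
  assumes \<kappa>: "\<kappa> > 0" "\<And>v. \<kappa> * norm v \<le> norm (Q v)"
    and pos: "\<And>y. \<sigma> * (y \<bullet> Q y) \<ge> 0" and \<sigma>: "\<bar>\<sigma>\<bar> = 1"
  shows "\<kappa>\<^sup>2 / N * (norm y)\<^sup>2 \<le> \<sigma> * (y \<bullet> Q y)"
proof -
  define v where "v = \<sigma> *\<^sub>R Q y"
  define \<tau> where "\<tau> = 1 / N"
  have \<tau>: "\<tau> > 0" "\<tau> * N = 1" using N by (auto simp: \<tau>_def)
  have \<sigma>2: "\<sigma> * \<sigma> = 1" using \<sigma> by (auto simp: abs_if split: if_splits)
  have lin: "linear Q" using Q bounded_linear.linear by blast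
  have nv: "norm v = norm (Q y)" using \<sigma> by (simp add: v_def)
  have "y \<bullet> Q v = Q y \<bullet> v" by (simp add: sym)
  then have cross: "\<sigma> * (y \<bullet> Q v) = (norm (Q y))\<^sup>2" "\<sigma> * (v \<bullet> Q y) = (norm (Q y))\<^sup>2"
    using \<sigma>2 by (simp_all add: v_def power2_norm_eq_inner flip: mult.assoc)
  have "\<sigma> * (v \<bullet> Q v) \<le> \<bar>v \<bullet> Q v\<bar>" using \<sigma> by (metis abs_ge_self abs_mult mult_1)
  also have "\<dots> \<le> N * (norm (Q y))\<^sup>2"
    using Q_inner_le[of v v] by (simp add: nv power2_eq_square mult_ac)
  finally have vv: "\<sigma> * (v \<bullet> Q v) \<le> N * (norm (Q y))\<^sup>2" .
  have "0 \<le> \<sigma> * ((y - \<tau> *\<^sub>R v) \<bullet> Q (y - \<tau> *\<^sub>R v))" by (rule pos)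
  also have "\<dots> = \<sigma> * (y \<bullet> Q y) - \<tau> * (\<sigma> * (y \<bullet> Q v)) - \<tau> * (\<sigma> * (v \<bullet> Q y)) + \<tau> * \<tau> * (\<sigma> * (v \<bullet> Q v))"
    by (simp add: linear_diff[OF lin] linear_cmul[OF lin] inner_diff_left inner_diff_right algebra_simps)
  also have "\<dots> \<le> \<sigma> * (y \<bullet> Q y) - \<tau> * (norm (Q y))\<^sup>2 - \<tau> * (norm (Q y))\<^sup>2 + \<tau> * \<tau> * (N * (norm (Q y))\<^sup>2)"
    unfolding cross using vv \<tau> by (intro add_left_mono mult_left_mono) auto
  also have "\<tau> * \<tau> * (N * (norm (Q y))\<^sup>2) = (\<tau> * N) * (\<tau> * (norm (Q y))\<^sup>2)" by (simp only: mult_ac)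
  finally have "\<tau> * (norm (Q y))\<^sup>2 \<le> \<sigma> * (y \<bullet> Q y)" using \<tau> by simp
  moreover have "(\<kappa> * norm y)\<^sup>2 \<le> (norm (Q y))\<^sup>2" using \<kappa> by (intro power_mono) auto
  then have "\<tau> * (\<kappa> * norm y)\<^sup>2 \<le> \<tau> * (norm (Q y))\<^sup>2" using \<tau> by (intro mult_left_mono) auto
  ultimately show ?thesis by (simp add: \<tau>_def power_mult_distrib)
qed

text \<open>An extremum forces the quadratic form to be semidefinite, since along a ray the model
  dominates the error; nonsingularity makes it definite. The bounds then carry over from the model,
  the radial one by Euler's identity.\<close>

lemma critical_extremum_bounds:
  assumes C2: "C2_on UNIV H" and crit: "p \<in> critical_points \<Omega> H" and A2: "assumption_A2 \<Omega> H"
    and "r0 > 0" and \<sigma>: "\<bar>\<sigma>\<bar> = 1"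
    and ext: "\<And>y. 0 < norm y \<Longrightarrow> norm y < r0 \<Longrightarrow> \<sigma> * (H (p + y) - H p) > 0"
  obtains m a b C r :: real where "m \<ge> 1" "0 < a" "a \<le> b" "0 < C" "0 < r"
    "\<And>y. 0 < norm y \<Longrightarrow> norm y < r \<Longrightarrow> a * norm y powr (m + 1) \<le> \<sigma> * (H (p + y) - H p)"
    "\<And>y. 0 < norm y \<Longrightarrow> norm y < r \<Longrightarrow> \<sigma> * (H (p + y) - H p) \<le> b * norm y powr (m + 1)"
    "\<And>y. 0 < norm y \<Longrightarrow> norm y < r \<Longrightarrow> a * norm y powr (m + 1) \<le> \<sigma> * (y \<bullet> gradient H (at (p + y)))"
    "\<And>y. 0 < norm y \<Longrightarrow> norm y < r \<Longrightarrow> \<exists>D. ((\<lambda>x. gradient H (at x)) has_derivative D) (at (p + y)) \<and>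
        (\<forall>v. norm (D v) \<le> C * norm y powr (m - 1) * norm v)"
proof -
  obtain m N \<kappa> :: real and Q where form: "homogeneous_form m N Q" and \<kappa>: "\<kappa> > 0" "\<And>v. \<kappa> * norm v \<le> norm (Q v)"
    and approx: "\<And>\<eta>. \<eta> > 0 \<Longrightarrow> \<exists>r>0. \<forall>y. 0 < norm y \<and> norm y < r \<longrightarrow>
      \<bar>H (p + y) - H p - homogeneous_form.P m Q y\<bar> \<le> \<eta> * norm y powr (m + 1) \<and>
      norm (gradient H (at (p + y)) - homogeneous_form.gP m Q y) \<le> \<eta> * norm y powr m"
    and hess: "\<exists>C>0. \<exists>r>0. \<forall>y. 0 < norm y \<and> norm y < r \<longrightarrow>
      (\<exists>D. ((\<lambda>x. gradient H (at x)) has_derivative D) (at (p + y)) \<and>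
        (\<forall>v. norm (D v) \<le> C * norm y powr (m - 1) * norm v))"
    using critical_point_model[OF C2 crit A2] by metis
  interpret homogeneous_form m N Q by (rule form)
  have lin: "linear Q" using Q bounded_linear.linear by blast
  have pm: "norm y powr (m + 1) = norm y powr (m - 1) * (norm y)\<^sup>2"
    "norm y powr (m + 1) = norm y powr m * norm y" if "0 < norm y" for y :: "real^2"
    using that powr_add[of "norm y" "m - 1" 2] powr_add[of "norm y" m 1] by (simp_all add: add.commute)
  have abs\<sigma>: "\<bar>\<sigma> * x\<bar> = \<bar>x\<bar>" for x using \<sigma> by (simp add: abs_mult)
  have semi: "\<sigma> * (y \<bullet> Q y) \<ge> 0" for y
  proof (rule ccontr)
    assume neg: "\<not> \<sigma> * (y \<bullet> Q y) \<ge> 0"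
    then have "y \<noteq> 0" by auto
    then have ny: "norm y > 0" by simp
    \<comment> \<open>Chosen so that the negative model value along the ray of \<open>y\<close> and
      the error bound cancel exactly.\<close>
    define \<eta> where "\<eta> = - (\<sigma> * (y \<bullet> Q y)) / (2 * (norm y)\<^sup>2)"
    have \<eta>: "\<eta> > 0" unfolding \<eta>_def using neg ny by (intro divide_pos_pos) auto
    obtain r where r: "r > 0" "\<And>y. 0 < norm y \<Longrightarrow> norm y < r \<Longrightarrow>
      \<bar>H (p + y) - H p - P y\<bar> \<le> \<eta> * norm y powr (m + 1)"
      using approx[OF \<eta>] by blast
    define t where "t = min r0 r / (2 * norm y)"
    have t: "t > 0" using \<open>r0 > 0\<close> r(1) ny by (simp add: t_def)
    have nt: "norm (t *\<^sub>R y) = min r0 r / 2" using ny \<open>r0 > 0\<close> r(1) by (simp add: t_def)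
    then have ty: "0 < norm (t *\<^sub>R y)" "norm (t *\<^sub>R y) < r0" "norm (t *\<^sub>R y) < r"
      using \<open>r0 > 0\<close> r(1) unfolding nt by (simp_all add: min_def)
    let ?k = "norm (t *\<^sub>R y) powr (m - 1)"
    have "0 < \<sigma> * (H (p + t *\<^sub>R y) - H p)" by (rule ext[OF ty(1,2)])
    also have "\<dots> \<le> \<sigma> * P (t *\<^sub>R y) + \<eta> * norm (t *\<^sub>R y) powr (m + 1)"
    proof -
      have "\<sigma> * (H (p + t *\<^sub>R y) - H p - P (t *\<^sub>R y)) \<le> \<eta> * norm (t *\<^sub>R y) powr (m + 1)"
        using r(2)[OF ty(1,3)] abs\<sigma>[of "H (p + t *\<^sub>R y) - H p - P (t *\<^sub>R y)"] by linarith
      then show ?thesis unfolding right_diff_distrib by linarith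
    qed
    also have "\<dots> = ?k * (t\<^sup>2 * (\<sigma> * (y \<bullet> Q y) / 2 + \<eta> * (norm y)\<^sup>2))"
      unfolding pm(1)[OF ty(1)] P_def
      by (simp add: linear_cmul[OF lin] power2_eq_square algebra_simps)
    also have "\<sigma> * (y \<bullet> Q y) / 2 + \<eta> * (norm y)\<^sup>2 = 0" using ny by (simp add: \<eta>_def)
    finally show False by simp
  qed
  define d where "d = \<kappa>\<^sup>2 / N"
  have d: "d > 0" using \<kappa> N by (simp add: d_def)
  have def: "d * (norm y)\<^sup>2 \<le> \<sigma> * (y \<bullet> Q y)" for y
    unfolding d_def by (rule definite_of_semidefinite[OF \<kappa> semi \<sigma>])
  have P_lower: "d / 2 * norm y powr (m + 1) \<le> \<sigma> * P y" if "0 < norm y" for y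
    using mult_left_mono[OF def[of y], of "norm y powr (m - 1) / 2"]
    unfolding P_def pm(1)[OF that] by (simp add: algebra_simps)
  have P_upper: "\<sigma> * P y \<le> N / 2 * norm y powr (m + 1)" if "0 < norm y" for y
  proof -
    have "\<sigma> * (y \<bullet> Q y) \<le> N * (norm y)\<^sup>2"
      using Q_inner_le[of y y] abs\<sigma>[of "y \<bullet> Q y"] by (simp add: power2_eq_square mult_ac)
    from mult_left_mono[OF this, of "norm y powr (m - 1) / 2"] show ?thesis
      unfolding P_def pm(1)[OF that] by (simp add: algebra_simps)
  qed
  \<comment> \<open>In units of \<open>norm y powr (m + 1)\<close> the model is at least
    \<open>d / 2\<close>, so an error of \<open>d / 4\<close> leaves half of it.\<close>
  have "d / 4 > 0" using d by simp
  from approx[OF this] obtain r1 where r1: "r1 > 0" "\<And>y. 0 < norm y \<Longrightarrow> norm y < r1 \<Longrightarrow>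
      \<bar>H (p + y) - H p - P y\<bar> \<le> d / 4 * norm y powr (m + 1)"
    "\<And>y. 0 < norm y \<Longrightarrow> norm y < r1 \<Longrightarrow> norm (gradient H (at (p + y)) - gP y) \<le> d / 4 * norm y powr m"
    by blast
  obtain C r2 where C: "C > 0" and r2: "r2 > 0" "\<And>y. 0 < norm y \<Longrightarrow> norm y < r2 \<Longrightarrow>
      \<exists>D. ((\<lambda>x. gradient H (at x)) has_derivative D) (at (p + y)) \<and>
        (\<forall>v. norm (D v) \<le> C * norm y powr (m - 1) * norm v)"
    using hess by blast
  show ?thesis
  proof (rule that[of m "d / 4" "d / 4 + N" C "min r1 r2"])
    show "m \<ge> 1" by (rule m)
    fix y :: "real^2" assume y: "0 < norm y" "norm y < min r1 r2"
    have le: "\<bar>\<sigma> * (H (p + y) - H p) - \<sigma> * P y\<bar> \<le> d / 4 * norm y powr (m + 1)"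
      using r1(2)[of y] y abs\<sigma>[of "H (p + y) - H p - P y"] by (simp add: algebra_simps)
    have w: "norm y powr (m + 1) \<ge> 0" by simp
    show "d / 4 * norm y powr (m + 1) \<le> \<sigma> * (H (p + y) - H p)"
      using le P_lower[OF y(1)] unfolding abs_le_iff by linarith
    have "N * norm y powr (m + 1) \<ge> 0" using N by simp
    then show "\<sigma> * (H (p + y) - H p) \<le> (d / 4 + N) * norm y powr (m + 1)"
      using le P_upper[OF y(1)] unfolding abs_le_iff distrib_right by linarith
    have "\<bar>y \<bullet> (gradient H (at (p + y)) - gP y)\<bar> \<le> norm y * (d / 4 * norm y powr m)"
      using y by (intro order_trans[OF Cauchy_Schwarz_ineq2] mult_left_mono r1(3)) auto
    then have "\<bar>\<sigma> * (y \<bullet> gradient H (at (p + y))) - (m + 1) * (\<sigma> * P y)\<bar> \<le> d / 4 * norm y powr (m + 1)"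
      using abs\<sigma>[of "y \<bullet> (gradient H (at (p + y)) - gP y)"] inner_gP_self[of y] y
      unfolding pm(2)[OF y(1)] by (simp add: inner_diff_right algebra_simps)
    moreover have "2 * (\<sigma> * P y) \<le> (m + 1) * (\<sigma> * P y)"
    proof (rule mult_right_mono)
      have "0 \<le> d / 2 * norm y powr (m + 1)" using d by simp
      then show "0 \<le> \<sigma> * P y" using P_lower[OF y(1)] by linarith
    qed (use m in simp)
    ultimately show "d / 4 * norm y powr (m + 1) \<le> \<sigma> * (y \<bullet> gradient H (at (p + y)))"
      using P_lower[OF y(1)] mult_nonneg_nonneg[OF less_imp_le[OF d] w] unfolding abs_le_iff by linarith
  qed (use d N C r1 r2 in auto)
qed

section \<open>Orbits around a center\<close>

lemma powr_compare:
  fixes x y a b k :: real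
  assumes "a * x powr k \<le> b * y powr k" "0 < a" "a \<le> b" "k \<ge> 1" "x > 0" "y > 0"
  shows "x \<le> b / a * y"
proof (rule ccontr)
  assume "\<not> x \<le> b / a * y"
  then have less: "b / a * y < x" by simp
  have ba: "b / a \<ge> 1" using assms by simp
  have "x powr k \<le> b / a * y powr k" using assms by (simp add: field_simps)
  \<comment> \<open>As \<open>b / a \<ge> 1\<close> and \<open>k \<ge> 1\<close>, the ratio is at
    most its own \<open>k\<close>-th power; the resulting bound is linear in \<open>y\<close> and no
    root is taken.\<close>
  also have "\<dots> \<le> (b / a) powr k * y powr k"
    using powr_mono[of 1 k "b / a"] ba assms by (intro mult_right_mono) auto
  also have "\<dots> = (b / a * y) powr k" by (rule powr_mult[symmetric])
  also have "\<dots> < x powr k" using less ba assms by (intro powr_less_mono2) auto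
  finally show False by simp
qed

text \<open>Since \<open>w\<close> is \<open>w 0\<close> times the exponential of the antiderivative of \<open>w' / w\<close>, it is back on the ray
  of \<open>w 0\<close> when the imaginary part of that antiderivative reaches \<open>2 * pi\<close> or \<open>- 2 * pi\<close>.\<close>

lemma returns_to_ray:
  fixes w w' :: "real \<Rightarrow> complex"
  assumes w: "\<And>t. (w has_vector_derivative w' t) (at t)" "\<And>t. w t \<noteq> 0"
    and cont: "continuous_on UNIV w'"
    and ang: "\<And>t. \<sigma> * Im (w' t / w t) \<le> - \<omega>" and "\<omega> > 0" and \<sigma>: "\<bar>\<sigma>\<bar> = 1"
  obtains t c :: real where "0 < t" "t \<le> 2 * pi / \<omega>" "c > 0" "w t = of_real c * w 0"
proof -
  have "continuous_on UNIV w"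
    using w(1) by (meson continuous_at_imp_continuous_on has_vector_derivative_continuous)
  then have "continuous_on UNIV (\<lambda>t. w' t / w t)"
    using cont w(2) by (intro continuous_intros) auto
  then obtain P where P0: "P 0 = 0" and P: "\<And>t. (P has_vector_derivative w' t / w t) (at t)"
    using antiderivative_on_reals by blast
  have "((\<lambda>t. w t * exp (- P t)) has_vector_derivative 0) (at t)" for t
  proof -
    have "((\<lambda>t. exp (- P t)) has_vector_derivative - (w' t / w t) * exp (- P t)) (at t)"
      using field_vector_diff_chain_at[of "\<lambda>t. - P t" "- (w' t / w t)" t exp "exp (- P t)"] P[of t]
      by (auto simp: o_def intro!: derivative_eq_intros)
    from has_vector_derivative_mult[OF w(1)[of t] this] w(2)[of t] show ?thesis
      by (simp add: field_simps)
  qed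
  then obtain c0 where c0: "\<And>t. w t * exp (- P t) = c0"
    using has_vector_derivative_zero_constant[of UNIV "\<lambda>t. w t * exp (- P t)"] by auto
  have wP: "w t = w 0 * exp (P t)" for t
    using c0[of t] c0[of 0] P0 by (simp add: exp_minus field_simps)
  define g where "g t = \<sigma> * Im (P t)" for t
  have g: "(g has_real_derivative \<sigma> * Im (w' t / w t)) (at t)" for t
  proof -
    have "((\<lambda>t. Im (P t)) has_vector_derivative Im (w' t / w t)) (at t)"
      by (rule bounded_linear.has_vector_derivative[OF bounded_linear_Im P])
    then show ?thesis unfolding g_def
      by (intro DERIV_cmult) (simp add: has_real_derivative_iff_has_vector_derivative)
  qed
  define t1 where "t1 = 2 * pi / \<omega>"
  have t1: "t1 > 0" "\<omega> * t1 = 2 * pi" using \<open>\<omega> > 0\<close> by (simp_all add: t1_def)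
  \<comment> \<open>Adding \<open>\<omega> * t\<close> turns the bound on the angular velocity into
    monotonicity; \<open>t1\<close> is the time of a full turn at the minimal angular speed.\<close>
  have "(\<lambda>t. g t + \<omega> * t) t1 \<le> (\<lambda>t. g t + \<omega> * t) 0"
  proof (rule DERIV_nonpos_imp_nonincreasing[where f = "\<lambda>t. g t + \<omega> * t"])
    fix t
    have "((\<lambda>t. g t + \<omega> * t) has_real_derivative \<sigma> * Im (w' t / w t) + \<omega>) (at t)"
      by (auto intro!: derivative_eq_intros g)
    then show "\<exists>y. ((\<lambda>t. g t + \<omega> * t) has_real_derivative y) (at t) \<and> y \<le> 0" using ang[of t] by force
  qed (use t1 in auto)
  then have "g t1 \<le> - 2 * pi" using t1 P0 by (simp add: g_def)
  moreover have "continuous_on {0..t1} g"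
    using g by (meson DERIV_isCont continuous_at_imp_continuous_on)
  ultimately obtain t where t: "0 \<le> t" "t \<le> t1" "g t = - 2 * pi"
    using IVT2'[of g t1 "- 2 * pi" 0] t1 P0 by (auto simp: g_def)
  have "\<sigma> = 1 \<or> \<sigma> = - 1" using \<sigma> by linarith
  then have "Im (P t) = 2 * pi \<or> Im (P t) = - 2 * pi" using t(3) by (auto simp: g_def)
  then have "exp (P t) = of_real (exp (Re (P t)))"
    by (auto simp: exp_eq_polar[of "P t"] cis.ctr complex_eq_iff)
  then have "w t = of_real (exp (Re (P t))) * w 0" using wP[of t] by simp
  moreover have "t \<noteq> 0" using t(3) P0 by (auto simp: g_def)
  ultimately show ?thesis using that[of t "exp (Re (P t))"] t by (auto simp: t1_def)
qed

context planar_field begin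

text \<open>On a closed orbit at the level of \<open>p\<close>, the point closest to \<open>p\<close> moves orthogonally to the
  direction of \<open>p\<close>.\<close>

lemma aperiodic_of_transversal:
  assumes x: "x \<in> closure \<Omega>" "x \<noteq> p" "norm (x - p) < r" "H x = H p" and p: "F p = 0"
    and trans: "\<And>y. 0 < norm y \<Longrightarrow> norm y < r \<Longrightarrow> H (p + y) = H p \<Longrightarrow> grad (p + y) \<bullet> perp y \<noteq> 0"
  shows "x \<in> aperiodic_set \<Omega> V"
proof (rule ccontr)
  assume "x \<notin> aperiodic_set \<Omega> V"
  then obtain T where T: "T > 0" "phi T x = x" using aperiodic_iff[OF x(1)] by blast
  define g where "g s = (phi s x - p) \<bullet> (phi s x - p)" for s
  have g: "(g has_real_derivative 2 * (F (phi s x) \<bullet> (phi s x - p))) (at s)" for s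
  proof -
    have "((\<lambda>s. phi s x - p) has_derivative (\<lambda>h. h *\<^sub>R F (phi s x))) (at s)"
      using has_derivative_diff[OF phi_deriv[unfolded has_vector_derivative_def] has_derivative_const] by simp
    from has_derivative_inner[OF this this] show ?thesis
      unfolding g_def has_field_derivative_def
      by (rule has_derivative_eq_rhs) (auto simp: inner_commute algebra_simps)
  qed
  have "continuous_on {- T..T} g"
    using g by (meson DERIV_isCont continuous_at_imp_continuous_on)
  then obtain s1 where s1: "s1 \<in> {- T..T}" and min1: "\<And>s. s \<in> {- T..T} \<Longrightarrow> g s1 \<le> g s"
    using continuous_attains_inf[of "{- T..T}" g] T by force
  have "g T = g 0" "g (- T) = g 0"
    using phi_periodic_shift(1)[OF T(2), of 0] phi_periodic_shift(2)[OF T(2), of 0] by (simp_all add: g_def)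
  \<comment> \<open>Two periods are used so that the starting time is interior: a minimum at an
    endpoint is also attained at 0, so some minimum is interior and the derivative vanishes
    there.\<close>
  then obtain s0 where s0: "- T < s0" "s0 < T" and min: "\<And>s. s \<in> {- T..T} \<Longrightarrow> g s0 \<le> g s"
  proof (cases "s1 = T \<or> s1 = - T")
    case True
    then show ?thesis using that[of 0] T min1 \<open>g T = g 0\<close> \<open>g (- T) = g 0\<close> by auto
  next
    case False
    then show ?thesis using that[of s1] s1 min1 by auto
  qed
  have "2 * (F (phi s0 x) \<bullet> (phi s0 x - p)) = 0"
  proof (rule DERIV_local_min[OF g])
    show "0 < min (T - s0) (s0 + T)" using s0 by simp
    show "\<forall>s. \<bar>s0 - s\<bar> < min (T - s0) (s0 + T) \<longrightarrow> g s0 \<le> g s" by (auto intro!: min)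
  qed
  define y where "y = phi s0 x - p"
  have "F (phi s0 x) = perp (grad (phi s0 x))" using x(1) phi_in_closure F_eq closure_ball by blast
  then have "grad (p + y) \<bullet> perp y = 0"
    using \<open>2 * _ = 0\<close> by (simp add: y_def inner_real2 algebra_simps)
  moreover have "y \<noteq> 0"
  proof
    assume "y = 0"
    then have "phi s0 x = p" by (simp add: y_def)
    then have "phi (- s0) p = x" using phi_neg(1)[of s0 x] by simp
    then show False using phi_equilibrium[OF p] x(2) by simp
  qed
  moreover have "norm y < r"
  proof -
    have "g s0 \<le> g 0" using min T by simp
    then have "norm y \<le> norm (x - p)" by (simp add: g_def y_def norm_eq_sqrt_inner)
    then show ?thesis using x(3) by simp
  qed
  moreover have "H (p + y) = H p" using H_phi[OF x(1)] x(4) by (simp add: y_def)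
  ultimately show False using trans[of y] by simp
qed

lemma controlled_near_center:
  assumes p: "p \<in> closure \<Omega>" "F p = 0"
    and par: "m \<ge> 1" "0 < a" "a \<le> b" "0 < C" "0 < r" "\<bar>\<sigma>\<bar> = 1"
    and lower: "\<And>y. 0 < norm y \<Longrightarrow> norm y < r \<Longrightarrow> a * norm y powr (m + 1) \<le> \<sigma> * (H (p + y) - H p)"
    and upper: "\<And>y. 0 < norm y \<Longrightarrow> norm y < r \<Longrightarrow> \<sigma> * (H (p + y) - H p) \<le> b * norm y powr (m + 1)"
    and radial: "\<And>y. 0 < norm y \<Longrightarrow> norm y < r \<Longrightarrow>
      a * norm y powr (m + 1) \<le> \<sigma> * (y \<bullet> grad (p + y))"
    and hess: "\<And>y. 0 < norm y \<Longrightarrow> norm y < r \<Longrightarrow> \<exists>D. (grad has_derivative D) (at (p + y)) \<and>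
        (\<forall>v. norm (D v) \<le> C * norm y powr (m - 1) * norm v)"
  obtains \<delta> B where "\<delta> > 0"
    "\<And>x. x \<in> closure \<Omega> \<Longrightarrow> norm (x - p) < \<delta> \<Longrightarrow> F x \<noteq> 0 \<Longrightarrow> controlled B x"
proof -
  define \<kappa> where "\<kappa> = b / a"
  have \<kappa>: "\<kappa> \<ge> 1" using par by (simp add: \<kappa>_def)
  define r' where "r' = r / 2"
  have r': "0 < r'" "r' < r" using par by (auto simp: r'_def)
  show ?thesis
  \<comment> \<open>Conservation of \<open>H\<close> traps the orbit between the radii
    \<open>s0 / \<kappa>\<close> and \<open>\<kappa> * s0\<close>, and the choice
    \<open>r' / \<kappa>\<close> makes the outer one less than \<open>r'\<close>. In the bound, the
    powers of \<open>s0\<close> from the field derivative and from the angular speed cancel and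
    leave \<open>(\<kappa> * \<kappa>) powr (m - 1)\<close>.\<close>
  proof (rule that[of "r' / \<kappa>" "2 * pi * C / a * (\<kappa> * \<kappa>) powr (m - 1)"])
    show "r' / \<kappa> > 0" using r' \<kappa> by simp
    fix x assume x: "x \<in> closure \<Omega>" "norm (x - p) < r' / \<kappa>" "F x \<noteq> 0"
    define z where "z t = phi t x - p" for t
    define s0 where "s0 = norm (x - p)"
    have "x \<noteq> p" using x p by auto
    then have s0: "s0 > 0" by (simp add: s0_def)
    have s0r: "\<kappa> * s0 < r'" using x \<kappa> by (simp add: s0_def field_simps)
    have "1 * s0 \<le> \<kappa> * s0" using \<kappa> s0 by (intro mult_right_mono) auto
    with s0r have s0r': "s0 < r'" by simp
    have nz: "norm (z t) > 0" for t
    proof -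
      have "F (phi t x) \<noteq> 0" using phi_not_equilibrium x by blast
      then have "phi t x \<noteq> p" using p by auto
      then show ?thesis by (simp add: z_def)
    qed
    have Hz: "H (p + z t) = H x" for t using H_phi[OF x(1)] by (simp add: z_def)
    have energy: "\<sigma> * (H x - H p) \<le> b * s0 powr (m + 1)" "a * s0 powr (m + 1) \<le> \<sigma> * (H x - H p)"
      using upper[of "x - p"] lower[of "x - p"] s0 s0r' r' by (auto simp: s0_def)
    have le: "norm (z t) \<le> \<kappa> * s0" if "norm (z t) < r" for t
      unfolding \<kappa>_def
    proof (rule powr_compare)
      show "a * norm (z t) powr (m + 1) \<le> b * s0 powr (m + 1)"
        using lower[OF nz that] energy(1) by (simp add: Hz)
    qed (use par s0 nz in auto)
    \<comment> \<open>The bound \<open>le\<close> is available only inside the radius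
      \<open>r\<close>. Since it excludes the value \<open>r'\<close>, continuity keeps the orbit
      from ever reaching that radius.\<close>
    have stay: "norm (z t) < r'" for t
    proof (rule ccontr)
      assume "\<not> norm (z t) < r'"
      moreover have "norm (z 0) < r'" using s0r' by (simp add: z_def s0_def)
      moreover have "connected (range (\<lambda>t. norm (z t)))"
        unfolding z_def by (intro connected_continuous_image continuous_intros phi_cont) auto
      ultimately have "r' \<in> range (\<lambda>t. norm (z t))"
        using connected_contains_Icc[of "range (\<lambda>t. norm (z t))" "norm (z 0)" "norm (z t)"] by auto
      then obtain s where "norm (z s) = r'" by auto
      then show False using le[of s] s0r r' by simp
    qed
    have zr: "norm (z t) < r" for t using stay[of t] r' by simp
    have ge: "s0 \<le> \<kappa> * norm (z t)" for t
      unfolding \<kappa>_def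
    proof (rule powr_compare)
      show "a * s0 powr (m + 1) \<le> b * norm (z t) powr (m + 1)"
        using upper[OF nz zr, of t] energy(2) by (simp add: Hz)
    qed (use par s0 nz in auto)
    have Fz: "F (phi t x) = perp (grad (p + z t))" for t
      using F_eq[OF closure_ball[OF phi_in_closure[OF x(1)]]] by (simp add: z_def)

    define w where "w t = Complex (z t $ 1) (z t $ 2)" for t
    define w' where "w' t = Complex (F (phi t x) $ 1) (F (phi t x) $ 2)" for t
    have blC: "bounded_linear (\<lambda>v::real^2. Complex (v $ 1) (v $ 2))"
      by (rule linear_conv_bounded_linear[THEN iffD1])
        (auto intro!: linearI simp: complex_eq_iff)
    have zd: "(z has_vector_derivative F (phi t x)) (at t)" for t
      unfolding z_def using has_vector_derivative_diff[OF phi_deriv has_vector_derivative_const] by simp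
    have wd: "(w has_vector_derivative w' t) (at t)" for t
      unfolding w_def w'_def by (rule bounded_linear.has_vector_derivative[OF blC zd])
    have w0: "w t \<noteq> 0" for t
      using nz[of t] by (auto simp: w_def complex_eq_iff vec_eq_iff forall_2)
    have w'c: "continuous_on UNIV w'"
      unfolding w'_def
      by (intro bounded_linear.continuous_on[OF blC] continuous_on_compose2[OF F_cont[of UNIV] phi_cont]) auto
    define \<omega> where "\<omega> = a * (s0 / \<kappa>) powr (m - 1)"
    have \<omega>: "\<omega> > 0" using par s0 \<kappa> by (simp add: \<omega>_def)
    have "\<sigma> * Im (w' t / w t) \<le> - \<omega>" for t
    proof -
      \<comment> \<open>This is the angular velocity around \<open>p\<close>: for a Hamiltonian
        field, minus the radial derivative of \<open>H\<close> divided by the radius.\<close>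
      have "Im (w' t / w t) = - (z t \<bullet> grad (p + z t)) / (norm (z t))\<^sup>2"
        unfolding power2_norm_eq_inner
        by (simp add: w_def w'_def Fz Im_divide inner_real2 power2_eq_square algebra_simps)
      then have "\<sigma> * Im (w' t / w t) = - ((\<sigma> * (z t \<bullet> grad (p + z t))) / (norm (z t))\<^sup>2)" by simp
      also have "\<dots> \<le> - ((a * norm (z t) powr (m + 1)) / (norm (z t))\<^sup>2)"
        using radial[OF nz zr] by (intro le_imp_neg_le divide_right_mono) auto
      also have "(a * norm (z t) powr (m + 1)) / (norm (z t))\<^sup>2 = a * norm (z t) powr (m - 1)"
        using nz[of t] powr_add[of "norm (z t)" "m - 1" 2] by (simp add: add.commute)
      also have "- (a * norm (z t) powr (m - 1)) \<le> - \<omega>"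
      proof -
        have "s0 / \<kappa> \<le> norm (z t)" using ge[of t] \<kappa> by (simp add: field_simps)
        then show ?thesis unfolding \<omega>_def using par s0 \<kappa>
          by (intro le_imp_neg_le mult_left_mono powr_mono2) auto
      qed
      finally show ?thesis .
    qed
    then obtain t c where t: "0 < t" "t \<le> 2 * pi / \<omega>" and c: "c > 0" "w t = of_real c * w 0"
      using returns_to_ray[OF wd w0 w'c _ \<omega> par(6)] by blast
    have zt: "z t = c *\<^sub>R z 0"
      using c(2) by (simp add: w_def complex_eq_iff vec_eq_iff forall_2)
    \<comment> \<open>Returning to the ray is not yet returning to the point; but by
      \<open>radial\<close> the function \<open>H\<close> is strictly monotone along the ray, and
      the two points have the same level.\<close>
    have "c = 1"
    proof -
      obtain q where q: "q \<in> closed_segment (p + z 0) (p + z t)"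
        "H (p + z t) - H (p + z 0) = grad q \<bullet> (p + z t - (p + z 0))"
        using gradient_mvt[of "p + z 0" "p + z t" H] H_differentiable by blast
      obtain u where u: "0 \<le> u" "u \<le> 1" "q = (1 - u) *\<^sub>R (p + z 0) + u *\<^sub>R (p + z t)"
        using q(1) by (auto simp: closed_segment_def)
      define \<mu> where "\<mu> = 1 - u + u * c"
      have \<mu>: "\<mu> > 0" using u c by (cases "u = 0") (auto simp: \<mu>_def add_nonneg_pos)
      have q\<mu>: "q = p + \<mu> *\<^sub>R z 0" unfolding u(3) zt \<mu>_def by (simp add: algebra_simps)
      have "norm (\<mu> *\<^sub>R z 0) < r"
      proof -
        have "closed_segment (p + z 0) (p + z t) \<subseteq> ball p r"
          using zr by (intro closed_segment_subset) (auto simp: dist_norm)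
        then have "q \<in> ball p r" using q(1) by blast
        then show ?thesis by (simp add: q\<mu> dist_norm)
      qed
      moreover have "norm (\<mu> *\<^sub>R z 0) > 0" using \<mu> nz[of 0] by simp
      ultimately have "0 < \<sigma> * ((\<mu> *\<^sub>R z 0) \<bullet> grad q)"
        using radial[of "\<mu> *\<^sub>R z 0"] par by (simp add: q\<mu>) (smt (verit) mult_pos_pos powr_gt_zero)
      then have "z 0 \<bullet> grad q \<noteq> 0" by auto
      moreover have "(c - 1) * (z 0 \<bullet> grad q) = 0"
        using q(2) Hz[of t] Hz[of 0] by (simp add: zt inner_commute algebra_simps)
      ultimately show ?thesis by simp
    qed
    then have "phi t x = x" using zt by (simp add: z_def)
    from least_period_exists[OF x(3) t(1) this]
    obtain T where "least_period x T" "T \<le> t" by blast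
    then have T: "least_period x T" "T \<le> 2 * pi / \<omega>" using t(2) by auto

    define M where "M = C * (\<kappa> * s0) powr (m - 1)"
    have AM: "norm (A (phi t x)) \<le> M" for t
    proof -
      obtain D where D: "(grad has_derivative D) (at (p + z t))"
        "\<And>v. norm (D v) \<le> C * norm (z t) powr (m - 1) * norm v"
        using hess[OF nz zr] by blast
      have pz: "phi t x = p + z t" by (simp add: z_def)
      have inb: "p + z t \<in> ball 0 R"
        using closure_ball[OF phi_in_closure[OF x(1), of t]] by (simp add: pz)
      have "((\<lambda>y. perp (grad y)) has_derivative (\<lambda>v. perp (D v))) (at (p + z t))"
        by (rule bounded_linear.has_derivative[OF bounded_linear_perp D(1)])
      then have "(F has_derivative (\<lambda>v. perp (D v))) (at (p + z t))"
        by (rule has_derivative_transform_within_open[of _ _ _ _ "ball 0 R"]) (use inb F_eq in auto)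
      then have "blinfun_apply (A (p + z t)) = (\<lambda>v. perp (D v))"
        using F_der[OF inb] has_derivative_unique by blast
      then have "norm (A (p + z t) v) \<le> C * norm (z t) powr (m - 1) * norm v" for v
        using D(2) by simp
      then have "norm (A (p + z t)) \<le> C * norm (z t) powr (m - 1)"
        using par by (intro norm_blinfun_bound) auto
      also have "\<dots> \<le> M" unfolding M_def
        using le[OF zr] par by (intro mult_left_mono powr_mono2) auto
      finally show ?thesis by (simp add: pz)
    qed
    have "M * T \<le> M * (2 * pi / \<omega>)" using T(2) par by (intro mult_left_mono) (auto simp: M_def)
    also have "\<dots> = 2 * pi * C / a * (\<kappa> * \<kappa>) powr (m - 1)"
    proof -
      have "(\<kappa> * s0) powr (m - 1) = (\<kappa> * \<kappa>) powr (m - 1) * (s0 / \<kappa>) powr (m - 1)"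
        using \<kappa> s0 by (subst powr_mult[symmetric]) auto
      then show ?thesis using \<omega> s0 \<kappa> par by (simp add: M_def \<omega>_def field_simps)
    qed
    finally show "controlled (2 * pi * C / a * (\<kappa> * \<kappa>) powr (m - 1)) x"
      unfolding controlled_def using x T(1) AM by blast
  qed
qed

text \<open>Points near \<open>p\<close> at the level of \<open>p\<close> would be aperiodic, so
  \<open>H - H p\<close> has no zero in a small punctured neighbourhood. This excludes a frontier
  point, as the boundary graph stays at level 0; and since a punctured disc in the plane is
  connected, the sign of \<open>H - H p\<close> is constant.\<close>

lemma controlled_near_critical:
  assumes A2: "assumption_A2 \<Omega> H" and "\<epsilon> > 0"
    and p: "p \<in> Omega_ge \<Omega> V \<epsilon>" "F p = 0"
  shows "\<exists>\<delta>>0. \<exists>B. \<forall>x\<in>closure \<Omega>. norm (x - p) < \<delta> \<longrightarrow> F x \<noteq> 0 \<longrightarrow> controlled B x"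
proof -
  have pc: "p \<in> closure \<Omega>" and far: "ereal \<epsilon> \<le> set_distance p (aperiodic_set \<Omega> V)"
    using p by (auto simp: Omega_ge_def)
  have "grad p = 0" using F_eq[OF closure_ball[OF pc]] p by simp
  then have crit: "p \<in> critical_points \<Omega> H" using pc by (simp add: critical_points_def)
  obtain r where r: "r > 0" "\<And>y. 0 < norm y \<Longrightarrow> norm y < r \<Longrightarrow> H (p + y) = H p \<Longrightarrow>
      grad (p + y) \<bullet> perp y \<noteq> 0"
    using critical_level_set_transversal[OF C2 crit A2] by blast
  \<comment> \<open>Within \<open>r\<close> the level set of \<open>p\<close> is transversal; within
    \<open>\<epsilon>\<close> there is no aperiodic point.\<close>
  define r1 where "r1 = min r \<epsilon>"
  have r1: "r1 > 0" using r \<open>\<epsilon> > 0\<close> by (simp add: r1_def)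
  have iso: "H x \<noteq> H p" if "x \<in> closure \<Omega>" "x \<noteq> p" "norm (x - p) < r1" for x
  proof
    assume "H x = H p"
    then have "x \<in> aperiodic_set \<Omega> V"
      using that p r by (intro aperiodic_of_transversal[where r = r and p = p]) (auto simp: r1_def)
    from order_trans[OF far set_distance_le[OF this]] show False
      using that by (simp add: r1_def dist_norm norm_minus_commute)
  qed
  have "p \<in> \<Omega>"
  proof (rule ccontr)
    assume "p \<notin> \<Omega>"
    then have fr: "p \<in> frontier \<Omega>" using pc open_dom by (simp add: frontier_def interior_open)
    then obtain e1 e2 \<rho> \<gamma> where chart: "lipschitz_chart \<Omega> p e1 e2 \<rho> \<gamma>"
      using dom unfolding bounded_lipschitz_domain_def by blast
    then obtain l where l: "l-lipschitz_on UNIV \<gamma>" by (auto simp: lipschitz_chart_def)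
    note graph = chart_frontier_graph[OF chart fr open_dom]
    define g where "g u = p + u *\<^sub>R e1 + \<gamma> u *\<^sub>R e2" for u
    have "continuous_on UNIV g"
      unfolding g_def by (intro continuous_intros lipschitz_on_continuous_on[OF l])
    then have "isCont g 0" by (simp add: continuous_on_eq_continuous_at)
    moreover have g0: "g 0 = p" using graph(1) by (simp add: g_def)
    moreover have "\<rho> > 0" using chart by (simp add: lipschitz_chart_def)
    ultimately obtain d where d: "d > 0" "\<And>u. dist u 0 < d \<Longrightarrow> dist (g u) p < min r1 \<rho>"
      unfolding continuous_at_eps_delta using r1 by (metis dist_commute min_less_iff_conj)
    define u where "u = d / 2"
    have u: "u > 0" "dist (g u) p < min r1 \<rho>" using d by (auto simp: u_def intro!: d(2))
    have gu: "g u \<in> frontier \<Omega>" using graph(2)[of u] u by (simp add: g_def dist_commute)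
    moreover have "g u \<noteq> p"
    proof
      assume "g u = p"
      then have "(g u - p) \<bullet> e1 = 0" by simp
      moreover have "(g u - p) \<bullet> e1 = u"
      proof -
        have "e1 \<bullet> e1 = 1" "e2 \<bullet> e1 = 0"
          using chart by (auto simp: lipschitz_chart_def norm_eq_1 inner_commute)
        then show ?thesis by (simp add: g_def inner_add_left)
      qed
      ultimately show False using u by simp
    qed
    ultimately have "H (g u) \<noteq> H p" using u by (intro iso) (auto simp: frontier_def dist_norm)
    then show False using H_frontier gu fr by simp
  qed
  then obtain r2 where r2: "r2 > 0" "ball p r2 \<subseteq> \<Omega>" using open_dom openE by blast
  define r0 where "r0 = min r1 r2"
  have r0: "r0 > 0" using r1 r2 by (simp add: r0_def)
  have ne: "H x \<noteq> H p" if "x \<in> ball p r0 - {p}" for x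
    using that r2 closure_subset[of \<Omega>] by (intro iso) (auto simp: r0_def dist_norm norm_minus_commute)
  have "connected (ball p r0 - {p})"
    using r0 by (intro connected_punctured_convex convex_ball) (simp add: aff_dim_open)
  moreover have "continuous_on (ball p r0 - {p}) H"
    using H_differentiable differentiable_imp_continuous_within continuous_at_imp_continuous_on by blast
  ultimately have conn: "connected (H ` (ball p r0 - {p}))" by (rule connected_continuous_image[rotated])
  have same: "(H x > H p) = (H y > H p)" if xy: "x \<in> ball p r0 - {p}" "y \<in> ball p r0 - {p}" for x y
  proof (rule ccontr)
    assume "(H x > H p) \<noteq> (H y > H p)"
    then have "H p \<in> {H x..H y} \<or> H p \<in> {H y..H x}" using ne xy by force
    then have "H p \<in> H ` (ball p r0 - {p})"
      using connected_contains_Icc[OF conn imageI[OF xy(1)] imageI[OF xy(2)]]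
        connected_contains_Icc[OF conn imageI[OF xy(2)] imageI[OF xy(1)]] by blast
    then show False using ne by force
  qed
  have mem: "p + y \<in> ball p r0 - {p}" if "0 < norm y" "norm y < r0" for y
    using that by (simp add: dist_norm)
  obtain \<sigma> :: real where \<sigma>: "\<bar>\<sigma>\<bar> = 1" and ext: "\<And>y. 0 < norm y \<Longrightarrow> norm y < r0 \<Longrightarrow> \<sigma> * (H (p + y) - H p) > 0"
  proof (cases "\<exists>x\<in>ball p r0 - {p}. H x > H p")
    case True
    then obtain x where x: "x \<in> ball p r0 - {p}" "H x > H p" by blast
    have "1 * (H (p + y) - H p) > 0" if "0 < norm y" "norm y < r0" for y
      using same[OF x(1) mem[OF that]] x(2) by simp
    then show ?thesis using that[of 1] by simp
  next
    case False
    have "- 1 * (H (p + y) - H p) > 0" if "0 < norm y" "norm y < r0" for y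
    proof -
      have "\<not> H (p + y) > H p" using False mem[OF that] by blast
      then show ?thesis using ne[OF mem[OF that]] by simp
    qed
    then show ?thesis using that[of "- 1"] by simp
  qed
  obtain m a b C r3 :: real where *: "m \<ge> 1" "0 < a" "a \<le> b" "0 < C" "0 < r3"
    "\<And>y. 0 < norm y \<Longrightarrow> norm y < r3 \<Longrightarrow> a * norm y powr (m + 1) \<le> \<sigma> * (H (p + y) - H p)"
    "\<And>y. 0 < norm y \<Longrightarrow> norm y < r3 \<Longrightarrow> \<sigma> * (H (p + y) - H p) \<le> b * norm y powr (m + 1)"
    "\<And>y. 0 < norm y \<Longrightarrow> norm y < r3 \<Longrightarrow> a * norm y powr (m + 1) \<le> \<sigma> * (y \<bullet> grad (p + y))"
    "\<And>y. 0 < norm y \<Longrightarrow> norm y < r3 \<Longrightarrow> \<exists>D. (grad has_derivative D) (at (p + y)) \<and>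
        (\<forall>v. norm (D v) \<le> C * norm y powr (m - 1) * norm v)"
    using critical_extremum_bounds[OF C2 crit A2 r0 \<sigma> ext] by blast
  obtain \<delta> B where "\<delta> > 0"
    "\<And>x. x \<in> closure \<Omega> \<Longrightarrow> norm (x - p) < \<delta> \<Longrightarrow> F x \<noteq> 0 \<Longrightarrow> controlled B x"
    by (rule controlled_near_center[OF pc p(2) *(1-5) \<sigma> *(6-9)]) auto
  then show ?thesis by blast
qed

end

section \<open>Truncation of the field and conclusion\<close>

lemma truncated_field_exists:
  assumes dom: "bounded_lipschitz_domain \<Omega>" and A1: "assumption_A1 \<Omega> V H"
  obtains F L R A where "planar_field F L \<Omega> H R A V"
proof -
  have C2: "C2_on UNIV H" using A1 by (simp add: assumption_A1_def)
  have "bounded (closure \<Omega>)" using dom bounded_closure bounded_lipschitz_domain_def by blast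
  then obtain R where R: "0 < R" "closure \<Omega> \<subseteq> ball 0 R" using bounded_subset_ballD by blast
  define g where "g x = gradient H (at x)" for x
  have "C1_on UNIV g" using C2 by (simp add: C2_on_def g_def[abs_def])
  then obtain g' :: "real^2 \<Rightarrow> ((real^2) \<Rightarrow>\<^sub>L (real^2))" where
    g': "\<And>x. (g has_derivative blinfun_apply (g' x)) (at x)" and g'_cont: "continuous_on UNIV g'"
    unfolding C1_on_def by blast
  \<comment> \<open>Composing with the nearest-point projection onto a closed ball makes the field
    globally Lipschitz and changes nothing on the open ball, where it stays differentiable.\<close>
  define pr where "pr x = closest_point (cball 0 R) x" for x :: "real^2"
  have pr_mem: "pr x \<in> cball 0 R" for x
    unfolding pr_def using R by (intro closest_point_in_set) auto
  have pr_id: "pr x = x" if "x \<in> ball 0 R" for x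
    unfolding pr_def using that by (intro closest_point_self) auto
  have pr_lip: "norm (pr x - pr y) \<le> norm (x - y)" for x y
    unfolding pr_def dist_norm[symmetric] using R by (intro closest_point_lipschitz) auto
  have "bounded (g' ` cball 0 R)"
    by (intro compact_imp_bounded compact_continuous_image continuous_on_subset[OF g'_cont]) auto
  then obtain N where N: "\<And>x. x \<in> cball 0 R \<Longrightarrow> norm (g' x) \<le> N"
    unfolding bounded_iff by blast
  have N0: "N \<ge> 0" using N[OF pr_mem] norm_ge_zero order_trans by blast
  define F where "F x = perp (g (pr x))" for x
  define A where "A x = Blinfun perp o\<^sub>L g' x" for x
  have blp: "blinfun_apply (Blinfun perp) = perp"
    by (rule bounded_linear_Blinfun_apply[OF bounded_linear_perp])
  \<comment> \<open>\<open>N + 1\<close> instead of \<open>N\<close>, because the Lipschitz constant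
    of the locale must be positive.\<close>
  have "planar_field F (N + 1) \<Omega> H R A V"
  proof unfold_locales
    show "norm (F x - F y) \<le> (N + 1) * norm (x - y)" for x y
    proof -
      have "norm (g (pr x) - g (pr y)) \<le> N * norm (pr x - pr y)"
      proof (rule differentiable_bound[OF convex_cball])
        show "(g has_derivative g' z) (at z within cball 0 R)" for z
          using g' has_derivative_at_withinI by blast
        show "onorm (blinfun_apply (g' z)) \<le> N" if "z \<in> cball 0 R" for z
          using N[OF that] by (simp add: norm_blinfun.rep_eq)
      qed (rule pr_mem)+
      also have "\<dots> \<le> (N + 1) * norm (x - y)"
        using pr_lip N0 by (intro mult_mono) auto
      finally show ?thesis by (simp add: F_def perp_diff)
    qed
    show "F x = perp (gradient H (at x))" if "x \<in> ball 0 R" for x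
      using pr_id[OF that] by (simp add: F_def g_def)
    show "(F has_derivative blinfun_apply (A x)) (at x)" if x: "x \<in> ball 0 R" for x
    proof -
      have "((\<lambda>y. perp (g y)) has_derivative (\<lambda>v. perp (g' x v))) (at x)"
        by (rule bounded_linear.has_derivative[OF bounded_linear_perp g'])
      then have "(F has_derivative (\<lambda>v. perp (g' x v))) (at x)"
        by (rule has_derivative_transform_within_open[of _ _ _ _ "ball 0 R"])
          (use x pr_id in \<open>auto simp: F_def\<close>)
      moreover have "(\<lambda>v. perp (g' x v)) = blinfun_apply (A x)" by (simp add: A_def blp fun_eq_iff)
      ultimately show ?thesis by simp
    qed
    show "continuous_on (ball 0 R) A"
      unfolding A_def by (intro continuous_intros continuous_on_subset[OF g'_cont]) auto
    show "V x = F x" if "x \<in> closure \<Omega>" for x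
      using A1 that R(2) pr_id[of x] by (auto simp: assumption_A1_def F_def g_def perp_def)
    show "H x = 0" if "x \<in> frontier \<Omega>" for x
      using A1 that by (simp add: assumption_A1_def)
  qed (use dom C2 R N0 in auto)
  then show ?thesis by (rule that)
qed

theorem theorem3p5:
  fixes \<Omega> :: "(real^2) set"
    and V :: "real^2 \<Rightarrow> real^2"
    and H :: "real^2 \<Rightarrow> real"
    and \<epsilon> :: real
  assumes "bounded_lipschitz_domain \<Omega>"
    and "steady_field \<Omega> V"
    and "assumption_A1 \<Omega> V H"
    and "assumption_A2 \<Omega> H"
    and "\<epsilon> > 0"
  shows "(\<exists>C>0. \<forall>x0\<in>Omega_ge \<Omega> V \<epsilon>. V x0 \<noteq> 0 \<longrightarrow>
            (\<forall>w0 :: real^2.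
               (SUP t. ereal (norm (flow_jacobian \<Omega> V t x0 *v w0
                  + (t * (w0 \<bullet> grad_ln_period \<Omega> V x0)) *\<^sub>R V (flow \<Omega> V t x0))))
               \<le> ereal (C * norm w0)))
       \<and> (\<exists>C>0. \<forall>x0\<in>Omega_ge \<Omega> V \<epsilon>. V x0 \<noteq> 0 \<longrightarrow>
            (\<forall>(t::real) (w0 :: real^2).
               inverse C * inverse (1 + \<bar>t\<bar>) * norm w0 \<le> norm (flow_jacobian \<Omega> V t x0 *v w0) \<and>
               norm (flow_jacobian \<Omega> V t x0 *v w0) \<le> C * (1 + \<bar>t\<bar>) * norm w0))"
proof -
  obtain F L R A where "planar_field F L \<Omega> H R A V"
    using truncated_field_exists[OF assms(1,3)] .
  then interpret planar_field F L \<Omega> H R A V .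
  obtain B where "\<And>x. x \<in> Omega_ge \<Omega> V \<epsilon> \<Longrightarrow> F x \<noteq> 0 \<Longrightarrow> controlled B x"
    using controlled_on_Omega_ge[OF assms(5) controlled_near_critical[OF assms(4,5)]] by blast
  then show ?thesis by (rule controlled_imp_estimates)
qed

end
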